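(* Let $0<p\le1$ be a constant and $0<\varepsilon<(p/4)^{12}$. Then there is a constant $n_0$ such that for every natural number $n\ge n_0$, every graph $G\in\mathcal{Q}(n,p,\varepsilon)$ admits a $9\varepsilon$-near triangular embedding.
   Context: Cut distance: for edge-weighted graphs $G,H$ on the same vertex set $V$, $\mathsf{d}_\square(G,H)=\max_{U,W\subseteq V}|\mathsf{e}_G(U,W)-\mathsf{e}_H(U,W)|/|V|^2$, where $\mathsf{e}_G(U,W)$ is the total weight of edges with one endvertex in $U$ and the other in $W$. $K(n,p)$ is the complete graph on $n$ vertices with all edge weights $p$; $\mathcal{Q}(n,p,\varepsilon)$ is the set of graphs $G$ on $n$ vertices with $\mathsf{d}_\square(G,K(n,p))<\varepsilon$ after identifying $V(G)$ with $V(K(n,p))$ by a bijection. An embedding means a 2-cell embedding of $G$ in an orientable surface (given by a rotation system). For $\delta>0$, an embedding is $\delta$-near triangular if all but at most $2\delta|E(G)|$ edges of $G$ belong to two triangular faces (faces bounded by 3-cycles). *)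

theory Defs
  imports Complex_Main "HOL-Combinatorics.Orbits" "Graph_Theory.Pair_Digraph"
begin

text \<open>
  Finite simple graphs are \<^locale>\<open>pair_graph\<close>s: an undirected edge \<open>{u, v}\<close> is represented by
  the two arcs \<open>(u, v)\<close> and \<open>(v, u)\<close>.
\<close>

definition uedges :: "'a pair_pre_digraph \<Rightarrow> 'a set set" where
  "uedges G = {{u, v} | u v. (u, v) \<in> parcs G}"


subsection \<open>Cut distance\<close>

text \<open>
  An edge-weighted graph on a given vertex set is a function assigning a weight to each edge
  \<open>{u, v}\<close>, with weight 0 for non-edges. In \<open>cut_weight w U W\<close> the sum ranges over a set of
  unordered pairs, so an edge with both endvertices in \<open>U \<inter> W\<close> contributes its weight once.
\<close>

definition cut_weight :: "('a set \<Rightarrow> real) \<Rightarrow> 'a set \<Rightarrow> 'a set \<Rightarrow> real" where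
  "cut_weight w U W = (\<Sum>e \<in> {{u, v} | u v. u \<in> U \<and> v \<in> W \<and> u \<noteq> v}. w e)"

definition cut_dist :: "'a set \<Rightarrow> ('a set \<Rightarrow> real) \<Rightarrow> ('a set \<Rightarrow> real) \<Rightarrow> real" where
  "cut_dist V w w' =
     Max ((\<lambda>(U, W). \<bar>cut_weight w U W - cut_weight w' U W\<bar> / (real (card V))\<^sup>2) ` (Pow V \<times> Pow V))"

definition graph_weight :: "'a pair_pre_digraph \<Rightarrow> 'a set \<Rightarrow> real" where
  "graph_weight G e = (if e \<in> uedges G then 1 else 0)"

definition K_weight :: "nat \<Rightarrow> real \<Rightarrow> nat set \<Rightarrow> real" where
  "K_weight n p e = (if e \<subseteq> {..<n} \<and> card e = 2 then p else 0)"

definition quasirandom_class :: "nat \<Rightarrow> real \<Rightarrow> real \<Rightarrow> 'a pair_pre_digraph set" where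
  "quasirandom_class n p \<epsilon> =
     {G. pair_graph G \<and> card (pverts G) = n \<and>
         (\<exists>\<phi>. bij_betw \<phi> (pverts G) {..<n} \<and>
              cut_dist (pverts G) (graph_weight G) (\<lambda>e. K_weight n p (\<phi> ` e)) < \<epsilon>)}"


subsection \<open>Embeddings in orientable surfaces\<close>

text \<open>
  A rotation system assigns to each vertex a cyclic permutation of its neighbours; only the values
  \<open>rot v u\<close> with \<open>u\<close> a neighbour of \<open>v\<close> are relevant. An isolated vertex has the empty rotation,
  which \<^const>\<open>cyclic_on\<close> excludes.
\<close>

definition rotation_system :: "'a pair_pre_digraph \<Rightarrow> ('a \<Rightarrow> 'a \<Rightarrow> 'a) \<Rightarrow> bool" where
  "rotation_system G rot \<longleftrightarrow>
     (\<forall>v \<in> pverts G. parcs G `` {v} \<noteq> {} \<longrightarrow> cyclic_on (rot v) (parcs G `` {v}))"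

text \<open>
  Face tracing: having traversed the arc from \<open>u\<close> to \<open>v\<close>, continue along the edge that follows
  \<open>{v, u}\<close> in the rotation at \<open>v\<close>. Faces are the orbits of this map, i.e. facial walks as sets of
  arcs; each edge is traversed twice in total, once in each direction.
\<close>

fun face_step :: "('a \<Rightarrow> 'a \<Rightarrow> 'a) \<Rightarrow> 'a \<times> 'a \<Rightarrow> 'a \<times> 'a" where
  "face_step rot (u, v) = (v, rot v u)"

definition faces :: "'a pair_pre_digraph \<Rightarrow> ('a \<Rightarrow> 'a \<Rightarrow> 'a) \<Rightarrow> ('a \<times> 'a) set set" where
  "faces G rot = orbit (face_step rot) ` parcs G"

definition triangular_face :: "('a \<times> 'a) set \<Rightarrow> bool" where
  "triangular_face F \<longleftrightarrow> (\<exists>u v w. distinct [u, v, w] \<and> F = {(u, v), (v, w), (w, u)})"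

definition edge_on_face :: "'a set \<Rightarrow> ('a \<times> 'a) set \<Rightarrow> bool" where
  "edge_on_face e F \<longleftrightarrow> (\<exists>u v. e = {u, v} \<and> (u, v) \<in> F)"

definition in_two_triangular_faces ::
  "'a pair_pre_digraph \<Rightarrow> ('a \<Rightarrow> 'a \<Rightarrow> 'a) \<Rightarrow> 'a set \<Rightarrow> bool" where
  "in_two_triangular_faces G rot e \<longleftrightarrow>
     (\<exists>F \<in> faces G rot. \<exists>F' \<in> faces G rot. F \<noteq> F' \<and>
        triangular_face F \<and> triangular_face F' \<and> edge_on_face e F \<and> edge_on_face e F')"

definition near_triangular ::
  "real \<Rightarrow> 'a pair_pre_digraph \<Rightarrow> ('a \<Rightarrow> 'a \<Rightarrow> 'a) \<Rightarrow> bool" where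
  "near_triangular \<delta> G rot \<longleftrightarrow>
     real (card {e \<in> uedges G. \<not> in_two_triangular_faces G rot e}) \<le> 2 * \<delta> * real (card (uedges G))"

end

theory Submission
  imports Defs "HOL-Analysis.Infinite_Products" "HOL-Probability.Product_PMF" "HOL-Real_Asymp.Real_Asymp"
begin

text \<open>
  Write \<open>A = p + R\<close> for the adjacency matrix, where \<open>R\<close> has small cut norm, and fix the rotations
  through a large family of arc-disjoint directed triangles that become faces.

  \<^emph>\<open>Fractional packing.\<close> Giving weight \<open>1/(p\<^sup>2n)\<close> to every triangle almost covers every edge once, but the
  error is of first order in \<open>\<epsilon>\<close> with a bad dependence on \<open>p\<close>. A correction of the weights that is
  linear in the codegree deviations removes the first-order error. The deviations themselves are the
  entries of \<open>R\<^sup>2\<close>; Grothendieck's inequality bounds their square sum by \<open>O(\<epsilon>\<^sup>3\<^sup>/\<^sup>2)\<close>, which the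
  assumption \<open>\<epsilon> < (p/4)\<^sup>1\<^sup>2\<close> turns into a small multiple of \<open>\<epsilon>p\<close>. The few vertices of exceptional
  degree are treated first, through triangles with exactly one exceptional vertex.

  \<^emph>\<open>Integral packing.\<close> The arcs and the directed triangles form a linear 3-uniform hypergraph, in which a
  semi-random greedy argument converts fractional matchings with small weights into integral ones of
  almost the same size.

  \<^emph>\<open>Rotations.\<close> The triangles at a vertex \<open>v\<close> prescribe a partial injection on its neighbours, which
  extends to a cyclic rotation once each of its cycles is cut open. To keep the cycles long, the pairs
  \<open>(v, u)\<close> get random labels modulo \<open>L\<close> beforehand, and only triangles along which the labels increase
  by 1 at all three corners are used; this costs only an error tending to 0, and every cycle has length
  at least \<open>L\<close>.
\<close>

section \<open>Grothendieck's inequality\<close>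

definition infty_one_norm_le :: "'i set \<Rightarrow> 'j set \<Rightarrow> ('i \<Rightarrow> 'j \<Rightarrow> real) \<Rightarrow> real \<Rightarrow> bool" where
  "infty_one_norm_le I J R K \<longleftrightarrow>
     (\<forall>f g. (\<forall>i\<in>I. \<bar>f i\<bar> \<le> 1) \<longrightarrow> (\<forall>j\<in>J. \<bar>g j\<bar> \<le> 1) \<longrightarrow>
       \<bar>\<Sum>i\<in>I. \<Sum>j\<in>J. R i j * f i * g j\<bar> \<le> K)"

lemma infty_one_norm_leD:
  assumes R: "infty_one_norm_le I J R K"
    and f: "\<And>i. i \<in> I \<Longrightarrow> \<bar>f i\<bar> \<le> a" "a > 0" and g: "\<And>j. j \<in> J \<Longrightarrow> \<bar>g j\<bar> \<le> b" "b > 0"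
  shows "\<bar>\<Sum>i\<in>I. \<Sum>j\<in>J. R i j * f i * g j\<bar> \<le> a * b * K"
proof -
  have "(\<Sum>i\<in>I. \<Sum>j\<in>J. R i j * f i * g j) = a * b * (\<Sum>i\<in>I. \<Sum>j\<in>J. R i j * (f i / a) * (g j / b))"
    using f(2) g(2) by (simp add: sum_distrib_left)
  moreover have "\<bar>\<Sum>i\<in>I. \<Sum>j\<in>J. R i j * (f i / a) * (g j / b)\<bar> \<le> K"
  proof -
    have "\<forall>i\<in>I. \<bar>f i / a\<bar> \<le> 1" "\<forall>j\<in>J. \<bar>g j / b\<bar> \<le> 1" using f g by simp_all
    then show ?thesis
      using R[unfolded infty_one_norm_le_def, rule_format, of "\<lambda>i. f i / a" "\<lambda>j. g j / b"] by blast
  qed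
  ultimately show ?thesis using f(2) g(2) by (simp add: abs_mult)
qed

lemma infty_one_norm_le_nonneg: "infty_one_norm_le I J R K \<Longrightarrow> 0 \<le> K"
  using infty_one_norm_leD[of I J R K "\<lambda>_. 0" 1 "\<lambda>_. 0" 1] by simp

lemma infty_one_norm_le_mono: "infty_one_norm_le I J R K \<Longrightarrow> K \<le> K' \<Longrightarrow> infty_one_norm_le I J R K'"
  unfolding infty_one_norm_le_def by (meson order_trans)

lemma infty_one_norm_le_subset:
  assumes R: "infty_one_norm_le I J R K" and fin: "finite I" "finite J" and sub: "I' \<subseteq> I" "J' \<subseteq> J"
  shows "infty_one_norm_le I' J' R K"
  unfolding infty_one_norm_le_def
proof (intro allI impI)
  fix f g :: "_ \<Rightarrow> real"
  assume fg: "\<forall>i\<in>I'. \<bar>f i\<bar> \<le> 1" "\<forall>j\<in>J'. \<bar>g j\<bar> \<le> 1"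
  let ?f = "\<lambda>i. if i \<in> I' then f i else 0" and ?g = "\<lambda>j. if j \<in> J' then g j else 0"
  have "(\<Sum>i\<in>I'. \<Sum>j\<in>J'. R i j * f i * g j) = (\<Sum>i\<in>I'. \<Sum>j\<in>J. R i j * ?f i * ?g j)"
    using fin sub by (intro sum.cong refl sum.mono_neutral_cong_left) auto
  also have "\<dots> = (\<Sum>i\<in>I. \<Sum>j\<in>J. R i j * ?f i * ?g j)"
    using fin sub by (intro sum.mono_neutral_left) auto
  finally show "\<bar>\<Sum>i\<in>I'. \<Sum>j\<in>J'. R i j * f i * g j\<bar> \<le> K"
    using infty_one_norm_leD[OF R, of ?f 1 ?g 1] fg by simp
qed

lemma sum_abs_row_le:
  assumes R: "infty_one_norm_le I J R K" and g: "\<And>j. j \<in> J \<Longrightarrow> \<bar>g j\<bar> \<le> c" "c > 0"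
  shows "(\<Sum>i\<in>I. \<bar>\<Sum>j\<in>J. R i j * g j\<bar>) \<le> c * K"
proof -
  define f where "f i = sgn (\<Sum>j\<in>J. R i j * g j)" for i
  have "\<bar>\<Sum>j\<in>J. R i j * g j\<bar> = (\<Sum>j\<in>J. R i j * f i * g j)" for i
  proof -
    have "\<bar>\<Sum>j\<in>J. R i j * g j\<bar> = f i * (\<Sum>j\<in>J. R i j * g j)"
      unfolding f_def by (simp add: abs_sgn mult.commute)
    then show ?thesis by (simp add: sum_distrib_left mult_ac)
  qed
  moreover have "\<bar>f i\<bar> \<le> 1" for i by (simp add: f_def abs_sgn_eq)
  ultimately show ?thesis
    using infty_one_norm_leD[OF R, of f 1 g c] g by simp
qed

definition gram_norm_le :: "'i set \<Rightarrow> 'j set \<Rightarrow> ('i \<Rightarrow> 'j \<Rightarrow> real) \<Rightarrow> real \<Rightarrow> bool" where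
  "gram_norm_le I J R C \<longleftrightarrow>
     (\<forall>(m::nat) u v. (\<forall>i\<in>I. L2_set (u i) {..<m} \<le> 1) \<longrightarrow> (\<forall>j\<in>J. L2_set (v j) {..<m} \<le> 1) \<longrightarrow>
       \<bar>\<Sum>i\<in>I. \<Sum>j\<in>J. R i j * (\<Sum>l<m. u i l * v j l)\<bar> \<le> C)"

lemma L2_set_le_iff: "0 \<le> c \<Longrightarrow> L2_set f A \<le> c \<longleftrightarrow> (\<Sum>x\<in>A. (f x)\<^sup>2) \<le> c\<^sup>2"
  by (metis L2_set_def real_sqrt_le_iff real_sqrt_unique)

lemma gram_norm_leD:
  assumes R: "gram_norm_le I J R C" and L: "finite L"
    and u: "\<And>i. i \<in> I \<Longrightarrow> L2_set (u i) L \<le> a" "a > 0" and v: "\<And>j. j \<in> J \<Longrightarrow> L2_set (v j) L \<le> b" "b > 0"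
  shows "\<bar>\<Sum>i\<in>I. \<Sum>j\<in>J. R i j * (\<Sum>l\<in>L. u i l * v j l)\<bar> \<le> C * a * b"
proof -
  obtain e where e: "bij_betw e {..<card L} L"
    using ex_bij_betw_nat_finite[OF L] by (auto simp: atLeast0LessThan)
  have reindex: "(\<Sum>l<card L. h (e l)) = (\<Sum>l\<in>L. h l)" for h :: "_ \<Rightarrow> real"
    using sum.reindex_bij_betw[OF e, of h] by simp
  have unit: "L2_set (\<lambda>l. w (e l) / c) {..<card L} \<le> 1" if "L2_set w L \<le> c" "c > 0" for w c
  proof -
    have "L2_set (\<lambda>l. w (e l) / c) {..<card L} = L2_set w L / c"
      using reindex[of "\<lambda>l. (w l)\<^sup>2"] that(2)
      by (simp add: L2_set_def power_divide sum_divide_distrib[symmetric] real_sqrt_divide)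
    then show ?thesis using that by simp
  qed
  have "\<bar>\<Sum>i\<in>I. \<Sum>j\<in>J. R i j * (\<Sum>l<card L. u i (e l) / a * (v j (e l) / b))\<bar> \<le> C"
  proof -
    have "\<forall>i\<in>I. L2_set (\<lambda>l. u i (e l) / a) {..<card L} \<le> 1"
      "\<forall>j\<in>J. L2_set (\<lambda>l. v j (e l) / b) {..<card L} \<le> 1"
      using u v by (simp_all add: unit)
    then show ?thesis
      using R[unfolded gram_norm_le_def, rule_format, of "\<lambda>i l. u i (e l) / a" "card L" "\<lambda>j l. v j (e l) / b"]
      by blast
  qed
  also have "(\<Sum>i\<in>I. \<Sum>j\<in>J. R i j * (\<Sum>l<card L. u i (e l) / a * (v j (e l) / b))) =
      (\<Sum>i\<in>I. \<Sum>j\<in>J. R i j * (\<Sum>l\<in>L. u i l * v j l)) / (a * b)"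
    by (simp add: reindex[of "\<lambda>l. u _ l * v _ l"] sum_divide_distrib[symmetric])
  finally show ?thesis using u(2) v(2) by (simp add: abs_mult divide_le_eq mult.assoc)
qed

lemma gram_norm_le_sum_abs: "gram_norm_le I J R (\<Sum>i\<in>I. \<Sum>j\<in>J. \<bar>R i j\<bar>)"
  unfolding gram_norm_le_def
proof (intro allI impI order_trans[OF sum_abs sum_mono])
  fix m :: nat and u v i j
  assume "\<forall>i\<in>I. L2_set (u i) {..<m} \<le> 1" "\<forall>j\<in>J. L2_set (v j) {..<m} \<le> 1" "i \<in> I" "j \<in> J"
  then have "(\<Sum>l<m. \<bar>u i l\<bar> * \<bar>v j l\<bar>) \<le> 1 * 1"
    by (intro order_trans[OF L2_set_mult_ineq mult_mono]) auto
  then have "\<bar>\<Sum>l<m. u i l * v j l\<bar> \<le> 1"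
    using sum_abs[of "\<lambda>l. u i l * v j l" "{..<m}"] by (simp add: abs_mult)
  then show "\<bar>R i j * (\<Sum>l<m. u i l * v j l)\<bar> \<le> \<bar>R i j\<bar>"
    by (simp add: abs_mult mult_left_le)
qed

lemma gram_norm_le_of_infty_one:
  fixes R :: "'i \<Rightarrow> 'j \<Rightarrow> real"
  assumes R: "infty_one_norm_le I J R K" and L: "finite L" and M: "M > 0"
    and F: "\<And>i l. i \<in> I \<Longrightarrow> l \<in> L \<Longrightarrow> \<bar>F i l\<bar> \<le> M" and G: "\<And>j l. j \<in> J \<Longrightarrow> l \<in> L \<Longrightarrow> \<bar>G j l\<bar> \<le> M"
  shows "\<bar>\<Sum>i\<in>I. \<Sum>j\<in>J. R i j * (\<Sum>l\<in>L. F i l * G j l)\<bar> \<le> real (card L) * (M\<^sup>2 * K)"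
proof -
  have "(\<Sum>i\<in>I. \<Sum>j\<in>J. R i j * (\<Sum>l\<in>L. F i l * G j l)) = (\<Sum>i\<in>I. \<Sum>l\<in>L. \<Sum>j\<in>J. R i j * F i l * G j l)"
    by (intro sum.cong refl) (subst sum.swap, simp add: sum_distrib_left mult.assoc)
  also have "\<dots> = (\<Sum>l\<in>L. \<Sum>i\<in>I. \<Sum>j\<in>J. R i j * F i l * G j l)" by (rule sum.swap)
  also have "\<bar>\<dots>\<bar> \<le> (\<Sum>l\<in>L. M * M * K)"
    by (intro order_trans[OF sum_abs sum_mono] infty_one_norm_leD[OF R] F G M)
  finally show ?thesis by (simp add: power2_eq_square)
qed

definition rademacher_sum :: "(nat \<Rightarrow> real) \<Rightarrow> nat \<Rightarrow> nat set \<Rightarrow> real" where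
  "rademacher_sum u m S = (\<Sum>k<m. if k \<in> S then u k else - u k)"

lemma sum_Pow_lessThan_Suc:
  fixes F :: "nat set \<Rightarrow> real"
  shows "(\<Sum>S\<in>Pow {..<Suc m}. F S) = (\<Sum>S\<in>Pow {..<m}. F S + F (insert m S))"
proof -
  have "inj_on (insert m) (Pow {..<m})"
    by (rule inj_onI) (metis Diff_insert_absorb PowD lessThan_iff less_irrefl subsetD)
  moreover have "Pow {..<m} \<inter> insert m ` Pow {..<m} = {}"
    by auto
  ultimately show ?thesis
    by (simp add: lessThan_Suc Pow_insert sum.union_disjoint sum.reindex sum.distrib)
qed

lemma rademacher_sum_Suc:
  assumes "S \<in> Pow {..<m}"
  shows "rademacher_sum u (Suc m) S = rademacher_sum u m S - u m"
    and "rademacher_sum u (Suc m) (insert m S) = rademacher_sum u m S + u m"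
  using assms by (auto simp: rademacher_sum_def)

lemma sum_rademacher_mult:
  "(\<Sum>S\<in>Pow {..<m}. rademacher_sum u m S * rademacher_sum v m S) = 2 ^ m * (\<Sum>k<m. u k * v k)"
proof (induction m)
  case 0
  show ?case by (simp add: rademacher_sum_def)
next
  case (Suc m)
  have "(\<Sum>S\<in>Pow {..<Suc m}. rademacher_sum u (Suc m) S * rademacher_sum v (Suc m) S) =
      (\<Sum>S\<in>Pow {..<m}. 2 * (rademacher_sum u m S * rademacher_sum v m S) + 2 * (u m * v m))"
    unfolding sum_Pow_lessThan_Suc
    by (intro sum.cong refl) (simp add: rademacher_sum_Suc algebra_simps)
  also have "\<dots> = 2 ^ Suc m * (\<Sum>k<Suc m. u k * v k)"
    using Suc.IH by (simp add: sum.distrib sum_distrib_left[symmetric] card_Pow algebra_simps)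
  finally show ?case .
qed

lemma sum_rademacher_power4:
  "(\<Sum>S\<in>Pow {..<m}. rademacher_sum u m S ^ 4) \<le> 3 * 2 ^ m * (\<Sum>k<m. (u k)\<^sup>2)\<^sup>2"
proof (induction m)
  case 0
  show ?case by (simp add: rademacher_sum_def)
next
  case (Suc m)
  let ?s = "\<Sum>k<m. (u k)\<^sup>2"
  have square: "(\<Sum>S\<in>Pow {..<m}. (rademacher_sum u m S)\<^sup>2) = 2 ^ m * ?s"
    using sum_rademacher_mult[of u m u] by (simp add: power2_eq_square)
  have "(\<Sum>S\<in>Pow {..<Suc m}. rademacher_sum u (Suc m) S ^ 4) =
      (\<Sum>S\<in>Pow {..<m}. 2 * rademacher_sum u m S ^ 4 + 12 * (u m)\<^sup>2 * (rademacher_sum u m S)\<^sup>2 + 2 * u m ^ 4)"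
    unfolding sum_Pow_lessThan_Suc
    by (intro sum.cong refl) (simp add: rademacher_sum_Suc, algebra)
  also have "\<dots> = 2 * (\<Sum>S\<in>Pow {..<m}. rademacher_sum u m S ^ 4) + 12 * (u m)\<^sup>2 * (2 ^ m * ?s)
      + 2 ^ m * (2 * u m ^ 4)"
    by (simp add: sum.distrib sum_distrib_left[symmetric] card_Pow square)
  also have "\<dots> \<le> 2 * (3 * 2 ^ m * ?s\<^sup>2) + 12 * (u m)\<^sup>2 * (2 ^ m * ?s) + 2 ^ m * (6 * u m ^ 4)"
    using Suc.IH by (intro add_mono mult_left_mono) auto
  also have "\<dots> = 3 * 2 ^ Suc m * (\<Sum>k<Suc m. (u k)\<^sup>2)\<^sup>2"
    by simp algebra
  finally show ?case .
qed

text \<open>The threshold \<open>3\<surd>3/4\<close> minimises the constant in the final inequality.\<close>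

definition clip :: "real \<Rightarrow> real" where
  "clip x = max (- (3 * sqrt 3 / 4)) (min (3 * sqrt 3 / 4) x)"

lemma abs_clip_le: "\<bar>clip x\<bar> \<le> 3 * sqrt 3 / 4" "\<bar>clip x\<bar> \<le> \<bar>x\<bar>"
  by (auto simp: clip_def max_def min_def abs_if)

lemma clip_error_square_le: "(x - clip x)\<^sup>2 \<le> x ^ 4 / 27"
proof -
  let ?M = "3 * sqrt 3 / 4"
  have M: "?M > 0" "?M\<^sup>2 = 27 / 16" by (auto simp: power2_eq_square)
  have "4 * ?M * \<bar>x - clip x\<bar> \<le> x\<^sup>2"
  proof (cases "\<bar>x\<bar> \<le> ?M")
    case True
    then have "clip x = x" by (auto simp: clip_def)
    then show ?thesis by simp
  next
    case False
    with M(1) have "\<bar>x - clip x\<bar> = \<bar>x\<bar> - ?M" unfolding clip_def by linarith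
    moreover have "0 \<le> (\<bar>x\<bar> - 2 * ?M)\<^sup>2" by simp
    then have "4 * ?M * (\<bar>x\<bar> - ?M) \<le> x\<^sup>2"
      by (simp add: power2_eq_square algebra_simps abs_if split: if_splits)
    ultimately show ?thesis by simp
  qed
  then have "(4 * ?M * \<bar>x - clip x\<bar>)\<^sup>2 \<le> (x\<^sup>2)\<^sup>2"
    using M(1) by (intro power_mono) auto
  moreover have "(4 * ?M * \<bar>x - clip x\<bar>)\<^sup>2 = 16 * ?M\<^sup>2 * (x - clip x)\<^sup>2"
    using M(2) by (simp add: power_mult_distrib)
  ultimately show ?thesis unfolding M by simp
qed

lemma L2_set_rademacher_sum: "L2_set (rademacher_sum u m) (Pow {..<m}) = sqrt (2 ^ m) * L2_set u {..<m}"
  using sum_rademacher_mult[of u m u] by (simp add: L2_set_def power2_eq_square real_sqrt_mult)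

lemma L2_set_clip_error_le:
  assumes "L2_set u {..<m} \<le> 1"
  shows "L2_set (\<lambda>S. rademacher_sum u m S - clip (rademacher_sum u m S)) (Pow {..<m}) \<le> sqrt (2 ^ m) / 3"
proof -
  have "(\<Sum>S\<in>Pow {..<m}. (rademacher_sum u m S - clip (rademacher_sum u m S))\<^sup>2)
      \<le> (\<Sum>S\<in>Pow {..<m}. rademacher_sum u m S ^ 4 / 27)"
    by (intro sum_mono clip_error_square_le)
  also have "\<dots> \<le> 3 * 2 ^ m * (\<Sum>l<m. (u l)\<^sup>2)\<^sup>2 / 27"
    using sum_rademacher_power4[of u m] by (simp add: sum_divide_distrib[symmetric])
  also have "\<dots> \<le> 3 * 2 ^ m * 1 / 27"
    using assms by (intro divide_right_mono mult_left_mono power_le_one sum_nonneg) (auto simp: L2_set_le_iff)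
  also have "\<dots> = (sqrt (2 ^ m) / 3)\<^sup>2" by (simp add: power_divide)
  finally show ?thesis by (subst L2_set_le_iff) simp_all
qed

lemma L2_set_clip_le: "L2_set (\<lambda>x. clip (f x)) A \<le> L2_set f A"
  using abs_clip_le(2) by (simp add: L2_set_def sum_mono abs_le_square_iff[symmetric])

text \<open>
  Expand inner products as averages of products of random sign sums. Clipping those sums leaves two
  inner products of vectors whose norms multiply to at most 1/3.
\<close>

lemma gram_norm_le_improve:
  assumes R: "infty_one_norm_le I J R K" and C: "gram_norm_le I J R C"
  shows "gram_norm_le I J R (27 / 16 * K + 2 / 3 * C)"
  unfolding gram_norm_le_def
proof (intro allI impI)
  fix m :: nat and u v
  assume u: "\<forall>i\<in>I. L2_set (u i) {..<m} \<le> 1" and v: "\<forall>j\<in>J. L2_set (v j) {..<m} \<le> 1"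
  define \<Omega> where "\<Omega> = Pow {..<m}"
  define a where "a i = rademacher_sum (u i) m" for i
  define b where "b j = rademacher_sum (v j) m" for j
  define form where "form F G = (\<Sum>i\<in>I. \<Sum>j\<in>J. R i j * (\<Sum>S\<in>\<Omega>. F i S * G j S))"
    for F :: "_ \<Rightarrow> nat set \<Rightarrow> real" and G :: "_ \<Rightarrow> nat set \<Rightarrow> real"
  let ?c = "\<lambda>i S. clip (a i S)" and ?d = "\<lambda>j S. clip (b j S)" and ?q = "sqrt (2 ^ m)"
  have \<Omega>: "finite \<Omega>" "card \<Omega> = 2 ^ m" by (auto simp: \<Omega>_def card_Pow)
  have a_norm: "L2_set (a i) \<Omega> \<le> ?q" "L2_set (\<lambda>S. a i S - ?c i S) \<Omega> \<le> ?q / 3" if "i \<in> I" for i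
    using u that L2_set_clip_error_le[of "u i" m]
    by (auto simp: a_def \<Omega>_def L2_set_rademacher_sum mult_left_le)
  then have c_norm: "L2_set (?c i) \<Omega> \<le> ?q" if "i \<in> I" for i using that L2_set_clip_le order_trans by blast
  have b_norm: "L2_set (b j) \<Omega> \<le> ?q" "L2_set (\<lambda>S. b j S - ?d j S) \<Omega> \<le> ?q / 3" if "j \<in> J" for j
    using v that L2_set_clip_error_le[of "v j" m]
    by (auto simp: b_def \<Omega>_def L2_set_rademacher_sum mult_left_le)
  have "2 ^ m * (\<Sum>i\<in>I. \<Sum>j\<in>J. R i j * (\<Sum>l<m. u i l * v j l)) = form a b"
    unfolding form_def a_def b_def \<Omega>_def sum_rademacher_mult
    by (simp add: sum_distrib_left mult.left_commute)
  also have "\<dots> = form ?c ?d + form (\<lambda>i S. a i S - ?c i S) b + form ?c (\<lambda>j S. b j S - ?d j S)"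
    by (simp add: form_def sum.distrib[symmetric] distrib_left[symmetric]) (simp add: algebra_simps)
  finally have "2 ^ m * \<bar>\<Sum>i\<in>I. \<Sum>j\<in>J. R i j * (\<Sum>l<m. u i l * v j l)\<bar> \<le> \<bar>form ?c ?d\<bar>
      + \<bar>form (\<lambda>i S. a i S - ?c i S) b\<bar> + \<bar>form ?c (\<lambda>j S. b j S - ?d j S)\<bar>"
    by (simp add: abs_mult[symmetric, of "2 ^ m", simplified])
  also have "\<dots> \<le> 2 ^ m * ((3 * sqrt 3 / 4)\<^sup>2 * K) + C * (?q / 3) * ?q + C * ?q * (?q / 3)"
  proof (intro add_mono)
    show "\<bar>form ?c ?d\<bar> \<le> 2 ^ m * ((3 * sqrt 3 / 4)\<^sup>2 * K)"
      using gram_norm_le_of_infty_one[OF R \<Omega>(1), of "3 * sqrt 3 / 4" ?c ?d] abs_clip_le(1)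
      by (simp add: \<Omega>(2) form_def)
    show "\<bar>form (\<lambda>i S. a i S - ?c i S) b\<bar> \<le> C * (?q / 3) * ?q"
      unfolding form_def using a_norm b_norm by (intro gram_norm_leD[OF C \<Omega>(1)]) auto
    show "\<bar>form ?c (\<lambda>j S. b j S - ?d j S)\<bar> \<le> C * ?q * (?q / 3)"
      unfolding form_def using c_norm b_norm by (intro gram_norm_leD[OF C \<Omega>(1)]) auto
  qed
  also have "\<dots> = 2 ^ m * (27 / 16 * K + 2 / 3 * C)"
    by (simp add: power2_eq_square algebra_simps)
  finally show "\<bar>\<Sum>i\<in>I. \<Sum>j\<in>J. R i j * (\<Sum>l<m. u i l * v j l)\<bar> \<le> 27 / 16 * K + 2 / 3 * C" by simp
qed

theorem grothendieck_inequality: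
  assumes R: "infty_one_norm_le I J R K"
  shows "gram_norm_le I J R (81 / 16 * K)"
proof -
  define C where "C k = 81 / 16 * K + (2 / 3) ^ k * (\<Sum>i\<in>I. \<Sum>j\<in>J. \<bar>R i j\<bar>)" for k
  have C: "gram_norm_le I J R (C k)" for k
  proof (induction k)
    case 0
    show ?case
      using gram_norm_le_sum_abs[of I J R] infty_one_norm_le_nonneg[OF R]
      unfolding C_def gram_norm_le_def by (fastforce intro: order_trans)
  next
    case (Suc k)
    have "27 / 16 * K + 2 / 3 * C k = C (Suc k)" by (simp add: C_def algebra_simps)
    then show ?case using gram_norm_le_improve[OF R Suc.IH] by simp
  qed
  have "C \<longlonglongrightarrow> 81 / 16 * K + 0 * (\<Sum>i\<in>I. \<Sum>j\<in>J. \<bar>R i j\<bar>)"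
    unfolding C_def by (intro tendsto_intros LIMSEQ_realpow_zero) auto
  then have "x \<le> 81 / 16 * K" if "\<And>k. x \<le> C k" for x
    using that by (intro LIMSEQ_le_const[of C]) auto
  with C show ?thesis unfolding gram_norm_le_def by blast
qed

section \<open>Weighted families of directed triangles\<close>

definition tri :: "'a \<Rightarrow> 'a \<Rightarrow> 'a \<Rightarrow> ('a \<times> 'a) set" where
  "tri u v w = {(u, v), (v, w), (w, u)}"

lemma tri_rotate: "tri u v w = tri v w u"
  by (auto simp: tri_def)

definition triangle_weighting :: "('a \<times> 'a) set \<Rightarrow> real \<Rightarrow> ('a \<Rightarrow> 'a \<Rightarrow> 'a \<Rightarrow> real) \<Rightarrow> bool" where
  "triangle_weighting E \<delta> X \<longleftrightarrow>
     (\<forall>u v w. 0 \<le> X u v w \<and> X u v w \<le> \<delta> \<and> X u v w = X v w u \<and>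
       (X u v w \<noteq> 0 \<longrightarrow> distinct [u, v, w] \<and> tri u v w \<subseteq> E))"

lemma triangle_weightingD:
  assumes "triangle_weighting E \<delta> X"
  shows "0 \<le> X u v w" "X u v w \<le> \<delta>" "X u v w = X v w u"
    and "X u v w \<noteq> 0 \<Longrightarrow> distinct [u, v, w] \<and> tri u v w \<subseteq> E"
  using assms by (auto simp: triangle_weighting_def)

lemma triangle_weighting_mono:
  assumes "triangle_weighting E \<delta> X" "\<delta> \<le> \<delta>'"
  shows "triangle_weighting E \<delta>' X"
  unfolding triangle_weighting_def
  using triangle_weightingD[OF assms(1)] order_trans[OF triangle_weightingD(2)[OF assms(1)] assms(2)] by blast

text \<open>
  The number of arcs lost per arc that is covered \<open>t\<close> times: a deficit is lost as it is, while removing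
  an excess \<open>t - 1\<close> by shrinking triangles also uncovers the two further arcs of each triangle.
\<close>

definition cover_cost :: "real \<Rightarrow> real" where
  "cover_cost t = max (1 - t) (2 * (t - 1))"

lemma cover_cost_nonneg: "0 \<le> cover_cost t"
  by (auto simp: cover_cost_def max_def)

lemma cover_cost_le: "0 \<le> l \<Longrightarrow> cover_cost (1 - l + e) \<le> l + 2 * \<bar>e\<bar>"
  by (auto simp: cover_cost_def abs_if)

lemma cover_cost_lipschitz: "cover_cost t \<le> cover_cost t' + 2 * \<bar>t - t'\<bar>"
  unfolding cover_cost_def by (auto simp: abs_if max_def)

definition total_cost :: "'a set \<Rightarrow> ('a \<times> 'a) set \<Rightarrow> ('a \<Rightarrow> 'a \<Rightarrow> 'a \<Rightarrow> real) \<Rightarrow> real" where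
  "total_cost V E X = (\<Sum>(u, v)\<in>E. cover_cost (\<Sum>w\<in>V. X u v w))"

lemma sum_arcs_eq:
  fixes h :: "'a \<Rightarrow> 'a \<Rightarrow> real"
  assumes "finite V" "E \<subseteq> V \<times> V"
  shows "(\<Sum>(u, v)\<in>E. h u v) = (\<Sum>u\<in>V. \<Sum>v\<in>V. of_bool ((u, v) \<in> E) * h u v)"
proof -
  have "(\<Sum>(u, v)\<in>E. h u v) = (\<Sum>(u, v)\<in>V \<times> V. of_bool ((u, v) \<in> E) * h u v)"
    using assms by (intro sum.mono_neutral_cong_left) auto
  then show ?thesis by (simp add: sum.cartesian_product)
qed

section \<open>Fractional triangle covers of quasirandom matrices\<close>

text \<open>The bounds on \<open>k\<close> and on the norm are those of \<open>k = 3\<surd>\<epsilon>\<close> for \<open>\<epsilon> < (p/4)\<^sup>1\<^sup>2\<close>.\<close>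

locale quasirandom_matrix =
  fixes V :: "'a set" and A :: "'a \<Rightarrow> 'a \<Rightarrow> real" and p k :: real
  assumes V: "finite V" "V \<noteq> {}"
    and A_01: "A u v = 0 \<or> A u v = 1"
    and A_sym: "A u v = A v u"
    and p: "0 < p" "p \<le> 1"
    and k: "0 < k" "k \<le> 3 * p ^ 6 / 4096"
    and norm: "infty_one_norm_le V V (\<lambda>u v. A u v - p) (k\<^sup>2 * (real (card V))\<^sup>2)"
    and degree: "u \<in> V \<Longrightarrow> \<bar>\<Sum>v\<in>V. A u v - p\<bar> \<le> p ^ 3 / 150 * p * real (card V)"
begin

definition N :: real where "N = real (card V)"
definition R :: "'a \<Rightarrow> 'a \<Rightarrow> real" where "R u v = A u v - p"
definition D :: real where "D = p\<^sup>2 * N"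
definition \<rho>\<^sub>0 :: real where "\<rho>\<^sub>0 = p ^ 3 / 150"
definition \<rho> :: "'a \<Rightarrow> real" where "\<rho> u = (\<Sum>v\<in>V. R u v) / (p * N)"

definition R2 :: "'a \<Rightarrow> 'a \<Rightarrow> real" where
  "R2 u v = (\<Sum>z\<in>V. R u z * R z v)"

definition \<mu> :: "'a \<Rightarrow> 'a \<Rightarrow> real" where "\<mu> u v = R2 u v / D"
definition \<tau> :: "'a \<Rightarrow> 'a \<Rightarrow> real" where "\<tau> u v = \<rho> u + \<rho> v + \<mu> u v"

lemma N_pos: "N > 0" using V by (simp add: N_def card_gt_0_iff)

lemma D_pos: "D > 0" using N_pos p by (simp add: D_def)

lemma \<rho>\<^sub>0_bounds: "0 < \<rho>\<^sub>0" "\<rho>\<^sub>0 \<le> 1 / 150"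
  using p power_le_one[of p 3] by (auto simp: \<rho>\<^sub>0_def)

lemma R_sym: "R u v = R v u" by (simp add: R_def A_sym[of u v])

lemma \<mu>_sym: "\<mu> u v = \<mu> v u"
  by (simp add: \<mu>_def R2_def R_sym[of u] R_sym[of v] mult.commute)

lemma A_bounds: "0 \<le> A u v" "A u v \<le> 1" using A_01[of u v] by auto

lemma abs_R_le: "\<bar>R u v\<bar> \<le> 1" using A_01[of u v] p by (auto simp: R_def)

lemma norm_R: "infty_one_norm_le V V R (k\<^sup>2 * N\<^sup>2)"
  using norm by (simp add: R_def[abs_def] N_def)

lemma sum_abs_R_mult_le:
  assumes "\<And>v. v \<in> V \<Longrightarrow> \<bar>g v\<bar> \<le> c" "c > 0"
  shows "(\<Sum>u\<in>V. \<bar>\<Sum>v\<in>V. R u v * g v\<bar>) \<le> c * (k\<^sup>2 * N\<^sup>2)"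
  using norm_R assms by (rule sum_abs_row_le)

lemma abs_\<rho>_le: "u \<in> V \<Longrightarrow> \<bar>\<rho> u\<bar> \<le> \<rho>\<^sub>0"
  using degree[of u] p N_pos by (simp add: \<rho>_def R_def \<rho>\<^sub>0_def N_def field_simps abs_mult)

lemma sum_abs_\<rho>_le: "(\<Sum>u\<in>V. \<bar>\<rho> u\<bar>) \<le> k\<^sup>2 * N / p"
proof -
  have "(\<Sum>u\<in>V. \<bar>\<rho> u\<bar>) = (\<Sum>u\<in>V. \<bar>\<Sum>v\<in>V. R u v\<bar>) / (p * N)"
    unfolding sum_divide_distrib using p N_pos by (simp add: \<rho>_def abs_mult)
  also have "\<dots> \<le> k\<^sup>2 * N\<^sup>2 / (p * N)"
    using p N_pos sum_abs_R_mult_le[of "\<lambda>_. 1" 1] by (intro divide_right_mono) auto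
  also have "\<dots> = k\<^sup>2 * N / p" using N_pos p by (simp add: power2_eq_square)
  finally show ?thesis .
qed

lemma sum_abs_R2_row_le: "(\<Sum>v\<in>V. \<bar>R2 u v\<bar>) \<le> k\<^sup>2 * N\<^sup>2"
proof -
  have "R2 u v = (\<Sum>z\<in>V. R v z * R u z)" for v
    by (simp add: R2_def R_sym[of v] mult.commute)
  then show ?thesis using sum_abs_R_mult_le[of "R u" 1] abs_R_le by simp
qed

lemma sum_abs_\<mu>_row_le: "(\<Sum>v\<in>V. \<bar>\<mu> u v\<bar>) \<le> k\<^sup>2 * N / p\<^sup>2"
proof -
  have "(\<Sum>v\<in>V. \<bar>\<mu> u v\<bar>) = (\<Sum>v\<in>V. \<bar>R2 u v\<bar>) / D"
    using D_pos by (simp add: \<mu>_def sum_divide_distrib)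
  also have "\<dots> \<le> k\<^sup>2 * N\<^sup>2 / D" using D_pos sum_abs_R2_row_le by (intro divide_right_mono) auto
  also have "\<dots> = k\<^sup>2 * N / p\<^sup>2" using N_pos p by (simp add: D_def power2_eq_square)
  finally show ?thesis .
qed

lemma sum_abs_\<mu>_le: "(\<Sum>u\<in>V. \<Sum>v\<in>V. \<bar>\<mu> u v\<bar>) \<le> k\<^sup>2 / p\<^sup>2 * N\<^sup>2"
proof -
  have "(\<Sum>u\<in>V. \<Sum>v\<in>V. \<bar>\<mu> u v\<bar>) \<le> (\<Sum>u\<in>V. k\<^sup>2 * N / p\<^sup>2)"
    by (intro sum_mono sum_abs_\<mu>_row_le)
  then show ?thesis by (simp add: N_def power2_eq_square mult_ac)
qed

definition \<sigma> :: real where "\<sigma> = 1 - p + \<rho>\<^sub>0"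

lemma \<sigma>_pos: "0 < \<sigma>" using p \<rho>\<^sub>0_bounds by (simp add: \<sigma>_def)

lemma sum_R_square_row_le:
  assumes "u \<in> V"
  shows "(\<Sum>v\<in>V. (R u v)\<^sup>2) \<le> p * \<sigma> * N"
proof -
  have "(R u v)\<^sup>2 = (1 - 2 * p) * R u v + p * (1 - p)" for v
    using A_01[of u v] by (auto simp: R_def power2_eq_square algebra_simps)
  then have "(\<Sum>v\<in>V. (R u v)\<^sup>2) = (1 - 2 * p) * (\<Sum>v\<in>V. R u v) + N * (p * (1 - p))"
    by (simp add: sum.distrib sum_distrib_left N_def)
  also have "(1 - 2 * p) * (\<Sum>v\<in>V. R u v) \<le> \<bar>1 - 2 * p\<bar> * \<bar>\<Sum>v\<in>V. R u v\<bar>"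
    by (simp add: abs_mult[symmetric])
  also have "\<dots> \<le> 1 * (\<rho>\<^sub>0 * p * N)"
    using degree[OF assms] p \<rho>\<^sub>0_bounds N_pos by (intro mult_mono) (auto simp: R_def \<rho>\<^sub>0_def N_def)
  finally show ?thesis by (simp add: \<sigma>_def algebra_simps)
qed

lemma abs_R2_le:
  assumes "u \<in> V" "v \<in> V"
  shows "\<bar>R2 u v\<bar> \<le> p * \<sigma> * N"
proof -
  have row: "L2_set (R w) V \<le> sqrt (p * \<sigma> * N)" if "w \<in> V" for w
    using sum_R_square_row_le[OF that] by (simp add: L2_set_def)
  have "\<bar>R2 u v\<bar> \<le> (\<Sum>z\<in>V. \<bar>R u z\<bar> * \<bar>R v z\<bar>)"
    unfolding R2_def by (rule order_trans[OF sum_abs]) (simp add: abs_mult R_sym[of v])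
  also have "\<dots> \<le> sqrt (p * \<sigma> * N) * sqrt (p * \<sigma> * N)"
    using row assms p \<sigma>_pos N_pos by (intro order_trans[OF L2_set_mult_ineq] mult_mono) auto
  also have "\<dots> = p * \<sigma> * N" using p \<sigma>_pos N_pos by simp
  finally show ?thesis .
qed

lemma L2_set_R2_row_le:
  assumes "u \<in> V"
  shows "L2_set (R2 u) V \<le> sqrt (p * \<sigma> * N) * (k * N)"
proof -
  have pos: "0 < p * \<sigma> * N" using p \<sigma>_pos N_pos by simp
  have "(\<Sum>v\<in>V. (R2 u v)\<^sup>2) \<le> (\<Sum>v\<in>V. (p * \<sigma> * N) * \<bar>R2 u v\<bar>)"
  proof (rule sum_mono)
    fix v assume "v \<in> V"
    then have "\<bar>R2 u v\<bar> * \<bar>R2 u v\<bar> \<le> (p * \<sigma> * N) * \<bar>R2 u v\<bar>"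
      using assms abs_R2_le by (intro mult_right_mono) auto
    then show "(R2 u v)\<^sup>2 \<le> (p * \<sigma> * N) * \<bar>R2 u v\<bar>" by (simp add: power2_eq_square)
  qed
  also have "\<dots> \<le> (p * \<sigma> * N) * (k\<^sup>2 * N\<^sup>2)"
    unfolding sum_distrib_left[symmetric] using pos sum_abs_R2_row_le by (intro mult_left_mono) auto
  also have "\<dots> = (sqrt (p * \<sigma> * N) * (k * N))\<^sup>2" using pos by (simp add: power_mult_distrib)
  finally show ?thesis using pos k(1) N_pos by (subst L2_set_le_iff) auto
qed

text \<open>
  The square sum of the entries of \<open>R\<^sup>2\<close> is the pairing of \<open>R\<close> with the Gram matrix of the rows of
  \<open>R\<^sup>2\<close> and \<open>R\<close>.
\<close>

lemma sum_R2_square_le: "(\<Sum>u\<in>V. \<Sum>v\<in>V. (R2 u v)\<^sup>2) \<le> 81 / 16 * k ^ 3 * p * \<sigma> * N ^ 4"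
proof -
  let ?b = "sqrt (p * \<sigma> * N)"
  have pos: "0 < p * \<sigma> * N" using p \<sigma>_pos N_pos by simp
  have "(\<Sum>v\<in>V. (R2 u v)\<^sup>2) = (\<Sum>z\<in>V. R u z * (\<Sum>v\<in>V. R2 u v * R z v))" for u
  proof -
    have "(\<Sum>v\<in>V. (R2 u v)\<^sup>2) = (\<Sum>v\<in>V. \<Sum>z\<in>V. R u z * (R2 u v * R z v))"
      by (intro sum.cong refl) (simp add: power2_eq_square R2_def[of u] sum_distrib_left mult_ac)
    then show ?thesis by (subst (asm) sum.swap) (simp add: sum_distrib_left)
  qed
  then have "(\<Sum>u\<in>V. \<Sum>v\<in>V. (R2 u v)\<^sup>2) \<le> \<bar>\<Sum>u\<in>V. \<Sum>z\<in>V. R u z * (\<Sum>v\<in>V. R2 u v * R z v)\<bar>" by simp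
  also have "\<dots> \<le> 81 / 16 * (k\<^sup>2 * N\<^sup>2) * (?b * (k * N)) * ?b"
  proof (rule gram_norm_leD[OF grothendieck_inequality[OF norm_R] V(1) L2_set_R2_row_le])
    show "L2_set (R z) V \<le> ?b" if "z \<in> V" for z using sum_R_square_row_le[OF that] by (simp add: L2_set_def)
  qed (use pos k N_pos in auto)
  also have "\<dots> = 81 / 16 * (k\<^sup>2 * N\<^sup>2) * (k * N) * (?b * ?b)" by (simp only: mult_ac)
  also have "\<dots> = 81 / 16 * k ^ 3 * p * \<sigma> * N ^ 4" using pos by (simp add: eval_nat_numeral mult_ac)
  finally show ?thesis .
qed

lemma k_div_p3_le: "k / p ^ 3 \<le> 3 * p ^ 3 / 4096"
  using k p by (simp add: field_simps power_add[symmetric])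

definition msq_bound :: real where "msq_bound = k\<^sup>2 * \<sigma> * p ^ 3 / 268"

lemma sum_\<mu>_square_le: "(\<Sum>u\<in>V. \<Sum>v\<in>V. (\<mu> u v)\<^sup>2) \<le> msq_bound * N\<^sup>2"
proof -
  have "(\<Sum>u\<in>V. \<Sum>v\<in>V. (\<mu> u v)\<^sup>2) = (\<Sum>u\<in>V. \<Sum>v\<in>V. (R2 u v)\<^sup>2) / D\<^sup>2"
    by (simp add: \<mu>_def power_divide sum_divide_distrib)
  also have "\<dots> \<le> 81 / 16 * k ^ 3 * p * \<sigma> * N ^ 4 / D\<^sup>2"
    using sum_R2_square_le D_pos by (intro divide_right_mono) auto
  also have "\<dots> = 81 / 16 * k\<^sup>2 * \<sigma> * N\<^sup>2 * (k / p ^ 3)"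
    using N_pos p by (simp add: D_def field_simps eval_nat_numeral)
  also have "\<dots> \<le> 81 / 16 * k\<^sup>2 * \<sigma> * N\<^sup>2 * (3 * p ^ 3 / 4096)"
    using \<sigma>_pos by (intro mult_left_mono k_div_p3_le) auto
  also have "\<dots> = k\<^sup>2 * \<sigma> * p ^ 3 * N\<^sup>2 * (243 / 65536)" by simp
  also have "\<dots> \<le> k\<^sup>2 * \<sigma> * p ^ 3 * N\<^sup>2 * (1 / 268)"
    using \<sigma>_pos p by (intro mult_left_mono) auto
  finally show ?thesis by (simp add: msq_bound_def)
qed

lemma codegree:
  assumes "u \<in> V" "v \<in> V"
  shows "(\<Sum>w\<in>V. A u w * A v w) = D * (1 + \<tau> u v)"
proof -
  have "(\<Sum>w\<in>V. A u w * A v w) = (\<Sum>w\<in>V. p\<^sup>2 + p * R u w + p * R v w + R u w * R w v)"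
    by (intro sum.cong refl) (simp add: R_sym[of _ v], simp add: R_def algebra_simps power2_eq_square)
  also have "\<dots> = p\<^sup>2 * N + p * (\<Sum>w\<in>V. R u w) + p * (\<Sum>w\<in>V. R v w) + R2 u v"
    by (simp add: sum.distrib sum_distrib_left R2_def N_def)
  also have "\<dots> = D * (1 + \<tau> u v)"
    using p N_pos by (simp add: D_def \<tau>_def \<rho>_def \<mu>_def field_simps power2_eq_square)
  finally show ?thesis .
qed

lemma degree_eq: "(\<Sum>v\<in>V. A u v) = p * N * (1 + \<rho> u)"
  using p N_pos by (simp add: \<rho>_def R_def sum_subtractf N_def field_simps)

lemma degree_le: "u \<in> V \<Longrightarrow> (\<Sum>v\<in>V. A u v) \<le> 151 / 150 * (p * N)"
  using abs_\<rho>_le[of u] \<rho>\<^sub>0_bounds p N_pos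
  unfolding degree_eq by (subst mult.commute, intro mult_right_mono) auto

lemma sum_A_mult_add_le:
  assumes "\<And>u. 0 \<le> f u"
  shows "(\<Sum>u\<in>V. \<Sum>v\<in>V. A u v * (f u + f v)) \<le> 151 / 75 * (p * N) * (\<Sum>u\<in>V. f u)"
proof -
  have "(\<Sum>u\<in>V. \<Sum>v\<in>V. A u v * (f u + f v)) = (\<Sum>u\<in>V. \<Sum>v\<in>V. A u v * f u) + (\<Sum>u\<in>V. \<Sum>v\<in>V. A u v * f v)"
    by (simp only: distrib_left sum.distrib)
  also have "(\<Sum>u\<in>V. \<Sum>v\<in>V. A u v * f v) = (\<Sum>u\<in>V. \<Sum>v\<in>V. A u v * f u)"
    by (subst sum.swap) (simp add: A_sym)
  also have "(\<Sum>u\<in>V. \<Sum>v\<in>V. A u v * f u) = (\<Sum>u\<in>V. (\<Sum>v\<in>V. A u v) * f u)"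
    by (simp only: sum_distrib_right)
  also have "\<dots> \<le> (\<Sum>u\<in>V. 151 / 150 * (p * N) * f u)"
    using degree_le assms by (intro sum_mono mult_right_mono) auto
  also have "\<dots> = 151 / 150 * (p * N) * (\<Sum>u\<in>V. f u)" by (simp only: sum_distrib_left)
  finally show ?thesis by (simp add: algebra_simps)
qed

end

text \<open>
  The weight \<open>U u v\<close> is already used up on the pair \<open>u v\<close>. To first order, the triangle weights
  \<open>(1 + \<alpha> u v + \<alpha> v w + \<alpha> u w) / D\<close> fill the remaining \<open>1 - U u v\<close> iff
  \<open>\<alpha> u v + a u + a v = defect u v\<close>, where \<open>a u\<close> is the average of \<open>\<alpha> u\<close> over the neighbours of \<open>u\<close>;
  averaging this equation once and twice gives the formula for \<open>a = potential\<close>. The pairs of atypical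
  codegree are given up.
\<close>

locale triangle_weights = quasirandom_matrix V A p k
  for V :: "'a set" and A :: "'a \<Rightarrow> 'a \<Rightarrow> real" and p k :: real +
  fixes U :: "'a \<Rightarrow> 'a \<Rightarrow> real"
  assumes U_sym: "U u v = U v u"
    and U: "0 \<le> U u v" "U u v \<le> p ^ 5 / 750"
begin

definition bad :: "'a \<Rightarrow> 'a \<Rightarrow> real" where
  "bad u v = (if \<bar>\<mu> u v\<bar> > 1 / 4 then A u v else 0)"

definition good :: "'a \<Rightarrow> 'a \<Rightarrow> real" where "good u v = A u v - bad u v"
definition defect :: "'a \<Rightarrow> 'a \<Rightarrow> real" where "defect u v = - (U u v + \<tau> u v)"

definition mean_defect :: "'a \<Rightarrow> real" where
  "mean_defect u = (\<Sum>v\<in>V. good u v * defect u v) / (p * N)"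

definition grand_mean :: real where "grand_mean = (\<Sum>u\<in>V. mean_defect u) / N"

definition potential :: "'a \<Rightarrow> real" where
  "potential u = mean_defect u / 2 - grand_mean / 6"

definition \<alpha> :: "'a \<Rightarrow> 'a \<Rightarrow> real" where
  "\<alpha> u v = good u v * (defect u v - potential u - potential v)"

definition factor :: "'a \<Rightarrow> 'a \<Rightarrow> 'a \<Rightarrow> real" where
  "factor u v w = 1 + \<alpha> u v + \<alpha> v w + \<alpha> u w"

definition weight :: "'a \<Rightarrow> 'a \<Rightarrow> 'a \<Rightarrow> real" where
  "weight u v w = good u v * good v w * good u w * factor u v w / D"

lemma bad_sym: "bad u v = bad v u" using A_sym[of u v] \<mu>_sym[of u v] by (simp add: bad_def)

lemma good_sym: "good u v = good v u" using A_sym[of u v] bad_sym[of u v] by (simp add: good_def)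

lemma defect_sym: "defect u v = defect v u"
  using U_sym[of u v] \<mu>_sym[of u v] by (simp add: defect_def \<tau>_def)

lemma \<alpha>_sym: "\<alpha> u v = \<alpha> v u" using good_sym[of u v] defect_sym[of u v] by (simp add: \<alpha>_def)

lemma good_cases:
  obtains (no_arc) "A u v = 0" "bad u v = 0" "good u v = 0"
  | (bad) "A u v = 1" "bad u v = 1" "good u v = 0"
  | (good) "A u v = 1" "bad u v = 0" "good u v = 1" "\<bar>\<mu> u v\<bar> \<le> 1 / 4"
  using A_01[of u v] by (cases "\<bar>\<mu> u v\<bar> > 1 / 4") (auto simp: good_def bad_def)

lemma good_bounds: "0 \<le> good u v" "good u v \<le> A u v" "good u v \<le> 1"
  by (cases rule: good_cases[of u v]; simp)+

lemma bad_bounds: "0 \<le> bad u v" "bad u v \<le> A u v" "bad u v \<le> 1"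
  by (cases rule: good_cases[of u v]; simp)+

lemma bad_le: "bad u v \<le> 16 * (\<mu> u v)\<^sup>2" "bad u v * \<bar>\<mu> u v\<bar> \<le> 4 * (\<mu> u v)\<^sup>2"
proof -
  have "bad u v \<le> 16 * (\<mu> u v)\<^sup>2 \<and> bad u v * \<bar>\<mu> u v\<bar> \<le> 4 * (\<mu> u v)\<^sup>2"
  proof (cases "\<bar>\<mu> u v\<bar> > 1 / 4")
    case True
    then have "1 / 4 * (1 / 4) \<le> \<bar>\<mu> u v\<bar> * \<bar>\<mu> u v\<bar>" "1 / 4 * \<bar>\<mu> u v\<bar> \<le> \<bar>\<mu> u v\<bar> * \<bar>\<mu> u v\<bar>"
      by (intro mult_mono mult_right_mono; simp)+
    then have "1 \<le> 16 * (\<mu> u v)\<^sup>2" "\<bar>\<mu> u v\<bar> \<le> 4 * (\<mu> u v)\<^sup>2" by (simp_all add: power2_eq_square)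
    moreover have "bad u v * \<bar>\<mu> u v\<bar> \<le> 1 * \<bar>\<mu> u v\<bar>" using bad_bounds by (intro mult_right_mono) auto
    ultimately show ?thesis using bad_bounds(3)[of u v] by linarith
  qed (simp add: bad_def)
  then show "bad u v \<le> 16 * (\<mu> u v)\<^sup>2" "bad u v * \<bar>\<mu> u v\<bar> \<le> 4 * (\<mu> u v)\<^sup>2" by blast+
qed

lemma sum_bad_le: "(\<Sum>u\<in>V. \<Sum>v\<in>V. bad u v) \<le> 16 * (msq_bound * N\<^sup>2)"
proof -
  have "(\<Sum>u\<in>V. \<Sum>v\<in>V. bad u v) \<le> (\<Sum>u\<in>V. \<Sum>v\<in>V. 16 * (\<mu> u v)\<^sup>2)"
    by (intro sum_mono bad_le)
  also have "\<dots> = 16 * (\<Sum>u\<in>V. \<Sum>v\<in>V. (\<mu> u v)\<^sup>2)" by (simp only: sum_distrib_left)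
  finally show ?thesis using sum_\<mu>_square_le by linarith
qed

lemma U_le: "U u v \<le> \<rho>\<^sub>0 / 5"
proof -
  have "p ^ 5 \<le> p ^ 3" using p by (intro power_decreasing) auto
  then show ?thesis using U(2)[of u v] by (simp add: \<rho>\<^sub>0_def)
qed

lemma abs_defect_le:
  assumes "u \<in> V" "v \<in> V"
  shows "\<bar>defect u v\<bar> \<le> 11 / 5 * \<rho>\<^sub>0 + \<bar>\<mu> u v\<bar>"
  unfolding defect_def \<tau>_def
  using U(1)[of u v] U_le[of u v] abs_\<rho>_le[OF assms(1)] abs_\<rho>_le[OF assms(2)] by linarith

lemma sum_abs_\<mu>_row_le_\<rho>\<^sub>0: "(\<Sum>v\<in>V. \<bar>\<mu> u v\<bar>) \<le> p * N * (\<rho>\<^sub>0 / 1000)"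
proof -
  have "k\<^sup>2 \<le> (3 * p ^ 6 / 4096)\<^sup>2" using k by (intro power_mono) auto
  also have "\<dots> = 9 * p ^ 12 / 16777216" by (simp add: power_divide power_mult_distrib power_mult[symmetric])
  finally have "k\<^sup>2 * N / p\<^sup>2 \<le> (9 * p ^ 12 / 16777216) * N / p\<^sup>2"
    using N_pos p by (intro divide_right_mono mult_right_mono) auto
  also have "\<dots> = p * N * (p ^ 9 * 9 / 16777216)" using p by (simp add: field_simps eval_nat_numeral)
  also have "\<dots> \<le> p * N * (\<rho>\<^sub>0 / 1000)"
  proof (intro mult_left_mono)
    have "p ^ 9 \<le> p ^ 3" using p by (intro power_decreasing) auto
    moreover have "0 \<le> p ^ 3" using p by simp
    ultimately show "p ^ 9 * 9 / 16777216 \<le> \<rho>\<^sub>0 / 1000" unfolding \<rho>\<^sub>0_def by linarith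
  qed (use p N_pos in auto)
  finally show ?thesis using sum_abs_\<mu>_row_le[of u] by linarith
qed

lemma abs_mean_defect_le:
  assumes "u \<in> V"
  shows "\<bar>mean_defect u\<bar> \<le> 9 / 4 * \<rho>\<^sub>0"
proof -
  have "\<bar>\<Sum>v\<in>V. good u v * defect u v\<bar> \<le> (\<Sum>v\<in>V. A u v * (11 / 5 * \<rho>\<^sub>0) + \<bar>\<mu> u v\<bar>)"
  proof (rule order_trans[OF sum_abs sum_mono])
    fix v assume v: "v \<in> V"
    have "\<bar>good u v * defect u v\<bar> \<le> good u v * (11 / 5 * \<rho>\<^sub>0 + \<bar>\<mu> u v\<bar>)"
      using good_bounds(1)[of u v] abs_defect_le[OF assms v] by (simp add: abs_mult mult_left_mono)
    also have "\<dots> = good u v * (11 / 5 * \<rho>\<^sub>0) + good u v * \<bar>\<mu> u v\<bar>" by (simp add: distrib_left)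
    also have "\<dots> \<le> A u v * (11 / 5 * \<rho>\<^sub>0) + 1 * \<bar>\<mu> u v\<bar>"
      using good_bounds[of u v] \<rho>\<^sub>0_bounds by (intro add_mono mult_right_mono) auto
    finally show "\<bar>good u v * defect u v\<bar> \<le> A u v * (11 / 5 * \<rho>\<^sub>0) + \<bar>\<mu> u v\<bar>" by simp
  qed
  also have "\<dots> = (\<Sum>v\<in>V. A u v) * (11 / 5 * \<rho>\<^sub>0) + (\<Sum>v\<in>V. \<bar>\<mu> u v\<bar>)"
    by (simp only: sum.distrib sum_distrib_right)
  also have "\<dots> \<le> 151 / 150 * (p * N) * (11 / 5 * \<rho>\<^sub>0) + p * N * (\<rho>\<^sub>0 / 1000)"
    using degree_le[OF assms] sum_abs_\<mu>_row_le_\<rho>\<^sub>0[of u] \<rho>\<^sub>0_bounds by (intro add_mono mult_right_mono) auto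
  also have "\<dots> = (151 / 150 * (11 / 5) + 1 / 1000) * \<rho>\<^sub>0 * (p * N)" by (simp add: algebra_simps)
  also have "\<dots> \<le> (9 / 4) * \<rho>\<^sub>0 * (p * N)" using p N_pos \<rho>\<^sub>0_bounds by (intro mult_right_mono) auto
  finally show ?thesis using p N_pos by (simp add: mean_defect_def divide_le_eq abs_mult)
qed

lemma abs_grand_mean_le: "\<bar>grand_mean\<bar> \<le> 9 / 4 * \<rho>\<^sub>0"
proof -
  have "\<bar>\<Sum>u\<in>V. mean_defect u\<bar> \<le> (\<Sum>u\<in>V. 9 / 4 * \<rho>\<^sub>0)"
    by (rule order_trans[OF sum_abs sum_mono]) (rule abs_mean_defect_le)
  then show ?thesis using N_pos by (simp add: grand_mean_def N_def divide_le_eq mult.commute)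
qed

lemma abs_potential_le: "u \<in> V \<Longrightarrow> \<bar>potential u\<bar> \<le> 3 / 2 * \<rho>\<^sub>0"
  using abs_mean_defect_le[of u] abs_grand_mean_le unfolding potential_def by linarith

lemma abs_\<alpha>_add_\<mu>_le:
  assumes "u \<in> V" "v \<in> V"
  shows "\<bar>\<alpha> u v + good u v * \<mu> u v\<bar> \<le> good u v * (26 / 5 * \<rho>\<^sub>0)"
proof -
  have bound: "\<bar>defect u v - potential u - potential v + \<mu> u v\<bar> \<le> 26 / 5 * \<rho>\<^sub>0"
    unfolding defect_def \<tau>_def
    using U(1)[of u v] U_le[of u v] abs_\<rho>_le[OF assms(1)] abs_\<rho>_le[OF assms(2)]
      abs_potential_le[OF assms(1)] abs_potential_le[OF assms(2)]
    by linarith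
  have "\<alpha> u v + good u v * \<mu> u v = good u v * (defect u v - potential u - potential v + \<mu> u v)"
    by (simp add: \<alpha>_def algebra_simps)
  then show ?thesis
    using mult_left_mono[OF bound good_bounds(1)] good_bounds(1)[of u v] by (simp only: abs_mult abs_of_nonneg)
qed

lemma abs_\<alpha>_le:
  assumes "u \<in> V" "v \<in> V"
  shows "\<bar>\<alpha> u v\<bar> \<le> good u v * (\<bar>\<mu> u v\<bar> + 26 / 5 * \<rho>\<^sub>0)" "\<bar>\<alpha> u v\<bar> \<le> 1 / 3"
proof -
  have "\<bar>\<alpha> u v\<bar> \<le> \<bar>good u v * \<mu> u v\<bar> + good u v * (26 / 5 * \<rho>\<^sub>0)"
    using abs_\<alpha>_add_\<mu>_le[OF assms] by linarith
  then show le: "\<bar>\<alpha> u v\<bar> \<le> good u v * (\<bar>\<mu> u v\<bar> + 26 / 5 * \<rho>\<^sub>0)"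
    using good_bounds(1)[of u v] by (simp add: abs_mult distrib_left)
  show "\<bar>\<alpha> u v\<bar> \<le> 1 / 3" using le \<rho>\<^sub>0_bounds by (cases rule: good_cases[of u v]) auto
qed

lemma factor_bounds:
  assumes "u \<in> V" "v \<in> V" "w \<in> V"
  shows "0 \<le> factor u v w" "factor u v w \<le> 2"
  using abs_\<alpha>_le(2)[of u v] abs_\<alpha>_le(2)[of v w] abs_\<alpha>_le(2)[of u w] assms
  unfolding factor_def by linarith+

lemma weight_bounds:
  assumes "u \<in> V" "v \<in> V" "w \<in> V"
  shows "0 \<le> weight u v w" "weight u v w \<le> 2 / D"
proof -
  have unit: "0 \<le> good u v * good v w * good u w" "good u v * good v w * good u w \<le> 1"
    using good_bounds(1,3) by (simp_all add: mult_le_one)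
  show "0 \<le> weight u v w" unfolding weight_def using unit factor_bounds[OF assms] D_pos by simp
  have "good u v * good v w * good u w * factor u v w \<le> 1 * 2"
    using unit factor_bounds[OF assms] by (intro mult_mono) auto
  then show "weight u v w \<le> 2 / D" unfolding weight_def using D_pos by (intro divide_right_mono) auto
qed

lemma weight_cyclic: "weight u v w = weight v w u"
  unfolding weight_def factor_def
  using good_sym[of w u] good_sym[of v u] \<alpha>_sym[of w u] \<alpha>_sym[of v u] by (simp add: mult_ac add_ac)

lemma weight_swap: "weight u v w = weight v u w"
  unfolding weight_def factor_def
  using good_sym[of v u] \<alpha>_sym[of v u] by (simp add: mult_ac add_ac)

lemma weight_nonzeroD: "weight u v w \<noteq> 0 \<Longrightarrow> A u v = 1 \<and> A v w = 1 \<and> A w u = 1"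
  using A_sym[of w u]
  by (cases rule: good_cases[of u v]; cases rule: good_cases[of v w]; cases rule: good_cases[of u w])
     (auto simp: weight_def)

definition \<alpha>_mean :: "'a \<Rightarrow> real" where "\<alpha>_mean u = (\<Sum>w\<in>V. \<alpha> u w) / (p * N)"

lemma \<alpha>_mean_eq:
  "\<alpha>_mean u - potential u = - \<rho> u * potential u - (\<Sum>w\<in>V. R u w * potential w) / (p * N)
    + (\<Sum>w\<in>V. bad u w * (potential u + potential w)) / (p * N)"
proof -
  have pN: "p * N > 0" using p N_pos by simp
  have "\<alpha> u w = good u w * defect u w - potential u * A u w - p * potential w - R u w * potential w
      + bad u w * (potential u + potential w)" for w
    by (simp add: \<alpha>_def good_def R_def algebra_simps)
  then have "(\<Sum>w\<in>V. \<alpha> u w) = (\<Sum>w\<in>V. good u w * defect u w) - potential u * (\<Sum>w\<in>V. A u w)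
      - p * (\<Sum>w\<in>V. potential w) - (\<Sum>w\<in>V. R u w * potential w)
      + (\<Sum>w\<in>V. bad u w * (potential u + potential w))"
    by (simp add: sum.distrib sum_subtractf sum_distrib_left)
  moreover have "(\<Sum>w\<in>V. potential w) = N * (grand_mean / 3)"
  proof -
    have "(\<Sum>w\<in>V. potential w) = (\<Sum>w\<in>V. mean_defect w) / 2 - N * (grand_mean / 6)"
      by (simp add: potential_def sum_subtractf sum_divide_distrib N_def)
    also have "(\<Sum>w\<in>V. mean_defect w) = N * grand_mean" using N_pos by (simp add: grand_mean_def)
    finally show ?thesis by (simp add: algebra_simps)
  qed
  moreover have "(\<Sum>w\<in>V. good u w * defect u w) = p * N * mean_defect u"
    unfolding mean_defect_def using pN by (metis nonzero_mult_div_cancel_left times_divide_eq_right less_irrefl)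
  ultimately have "(\<Sum>w\<in>V. \<alpha> u w) = p * N * (mean_defect u - potential u * (1 + \<rho> u) - grand_mean / 3)
      - (\<Sum>w\<in>V. R u w * potential w) + (\<Sum>w\<in>V. bad u w * (potential u + potential w))"
    unfolding degree_eq by (simp add: algebra_simps)
  then have "\<alpha>_mean u = (mean_defect u - potential u * (1 + \<rho> u) - grand_mean / 3)
      - (\<Sum>w\<in>V. R u w * potential w) / (p * N) + (\<Sum>w\<in>V. bad u w * (potential u + potential w)) / (p * N)"
    using p N_pos by (simp add: \<alpha>_mean_def add_divide_distrib diff_divide_distrib)
  moreover have "mean_defect u - grand_mean / 3 = 2 * potential u" by (simp add: potential_def)
  moreover have "potential u * (1 + \<rho> u) = potential u - - \<rho> u * potential u" by (simp add: algebra_simps)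
  ultimately show ?thesis by linarith
qed

definition mixed :: "'a \<Rightarrow> 'a \<Rightarrow> real" where
  "mixed u v = (\<Sum>w\<in>V. R v w * \<alpha> u w)"

definition loss :: "'a \<Rightarrow> 'a \<Rightarrow> real" where
  "loss u v = good u v * (\<Sum>w\<in>V. (A v w * A u w - good v w * good u w) * factor u v w) / D"

lemma A_mult_diff_good_bounds:
  "0 \<le> A v w * A u w - good v w * good u w"
  "A v w * A u w - good v w * good u w \<le> bad v w * A u w + A v w * bad u w"
  by (cases rule: good_cases[of v w]; cases rule: good_cases[of u w]; simp)+

lemma loss_nonneg:
  assumes "u \<in> V" "v \<in> V"
  shows "0 \<le> loss u v"
  unfolding loss_def using A_mult_diff_good_bounds(1) factor_bounds[OF assms] D_pos good_bounds(1)[of u v]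
  by (intro divide_nonneg_pos mult_nonneg_nonneg sum_nonneg) auto

lemma sum_A_mult_\<alpha>: "(\<Sum>w\<in>V. A v w * \<alpha> u w) = D * \<alpha>_mean u + mixed u v"
proof -
  have "(\<Sum>w\<in>V. A v w * \<alpha> u w) = (\<Sum>w\<in>V. p * \<alpha> u w + R v w * \<alpha> u w)"
    by (intro sum.cong refl) (simp add: R_def algebra_simps)
  also have "\<dots> = p * (\<Sum>w\<in>V. \<alpha> u w) + mixed u v" by (simp add: sum.distrib sum_distrib_left mixed_def)
  finally show ?thesis using p N_pos by (simp add: \<alpha>_mean_def D_def power2_eq_square)
qed

lemma sum_A_mult_factor:
  assumes "u \<in> V" "v \<in> V"
  shows "(\<Sum>w\<in>V. A v w * A u w * factor u v w) / D =
    (1 + \<alpha> u v) * (1 + \<tau> u v) + \<alpha>_mean u + \<alpha>_mean v + (mixed u v + mixed v u) / D"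
proof -
  have A_\<alpha>: "A x y * \<alpha> x y = \<alpha> x y" for x y by (cases rule: good_cases[of x y]) (auto simp: \<alpha>_def)
  have "A v w * A u w * factor u v w = (1 + \<alpha> u v) * (A u w * A v w) + A u w * \<alpha> v w + A v w * \<alpha> u w" for w
  proof -
    have "A v w * A u w * factor u v w =
        (1 + \<alpha> u v) * (A u w * A v w) + A u w * (A v w * \<alpha> v w) + A v w * (A u w * \<alpha> u w)"
      by (simp add: factor_def algebra_simps)
    then show ?thesis by (simp only: A_\<alpha>)
  qed
  then have "(\<Sum>w\<in>V. A v w * A u w * factor u v w) =
      (1 + \<alpha> u v) * (D * (1 + \<tau> u v)) + (D * \<alpha>_mean v + mixed v u) + (D * \<alpha>_mean u + mixed u v)"
    by (simp only: sum.distrib sum_distrib_left[symmetric] sum_A_mult_\<alpha> codegree[OF assms])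
  then show ?thesis using D_pos by (simp add: field_simps)
qed

lemma sum_weight_add_U:
  assumes V: "u \<in> V" "v \<in> V" and good: "good u v = 1"
  shows "(\<Sum>w\<in>V. weight u v w) + U u v = 1 - loss u v + (\<tau> u v * \<alpha> u v
    + (\<alpha>_mean u - potential u) + (\<alpha>_mean v - potential v) + (mixed u v + mixed v u) / D)"
proof -
  have "(\<Sum>w\<in>V. weight u v w) = (\<Sum>w\<in>V. A v w * A u w * factor u v w) / D - loss u v"
    unfolding loss_def weight_def good sum_divide_distrib[symmetric] diff_divide_distrib[symmetric]
    by (simp add: sum_subtractf[symmetric] algebra_simps)
  moreover have "\<alpha> u v = - (U u v + \<tau> u v) - potential u - potential v"
    using good by (simp add: \<alpha>_def defect_def)
  moreover have "(1 + \<alpha> u v) * (1 + \<tau> u v) = 1 + \<alpha> u v + \<tau> u v + \<tau> u v * \<alpha> u v"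
    by (simp add: algebra_simps)
  ultimately show ?thesis using sum_A_mult_factor[OF V] by linarith
qed

lemma loss_le:
  assumes V: "u \<in> V" "v \<in> V"
  shows "loss u v \<le> 2 / D * (\<Sum>w\<in>V. A u v * (bad v w * A u w) + A u v * (A v w * bad u w))"
proof -
  have "good u v * ((A v w * A u w - good v w * good u w) * factor u v w)
      \<le> 2 * (A u v * (bad v w * A u w) + A u v * (A v w * bad u w))" if w: "w \<in> V" for w
  proof -
    have "good u v * ((A v w * A u w - good v w * good u w) * factor u v w)
        \<le> A u v * ((bad v w * A u w + A v w * bad u w) * 2)"
      using good_bounds[of u v] A_bounds A_mult_diff_good_bounds factor_bounds[OF V w] bad_bounds(1)
      by (intro mult_mono mult_nonneg_nonneg add_nonneg_nonneg) auto
    then show ?thesis by (simp add: algebra_simps)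
  qed
  then have "(\<Sum>w\<in>V. good u v * ((A v w * A u w - good v w * good u w) * factor u v w))
      \<le> (\<Sum>w\<in>V. 2 * (A u v * (bad v w * A u w) + A u v * (A v w * bad u w)))"
    by (rule sum_mono)
  then have "loss u v \<le> 2 * (\<Sum>w\<in>V. A u v * (bad v w * A u w) + A u v * (A v w * bad u w)) / D"
    unfolding loss_def sum_distrib_left using D_pos by (intro divide_right_mono) auto
  then show ?thesis by simp
qed

lemma sum_bad_codegree_le:
  "(\<Sum>v\<in>V. \<Sum>w\<in>V. bad v w * (\<Sum>u\<in>V. A v u * A w u)) \<le> D * (41 / 2 * (msq_bound * N\<^sup>2))"
proof -
  have "(\<Sum>v\<in>V. \<Sum>w\<in>V. bad v w * (\<Sum>u\<in>V. A v u * A w u)) \<le> (\<Sum>v\<in>V. \<Sum>w\<in>V. D * (41 / 2 * (\<mu> v w)\<^sup>2))"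
  proof (intro sum_mono)
    fix v w assume V: "v \<in> V" "w \<in> V"
    have "bad v w * (1 + \<tau> v w) \<le> bad v w * (76 / 75 + \<bar>\<mu> v w\<bar>)"
      unfolding \<tau>_def using abs_\<rho>_le[OF V(1)] abs_\<rho>_le[OF V(2)] \<rho>\<^sub>0_bounds bad_bounds(1)
      by (intro mult_left_mono) auto
    also have "\<dots> = 76 / 75 * bad v w + bad v w * \<bar>\<mu> v w\<bar>" by (simp add: algebra_simps)
    also have "\<dots> \<le> 76 / 75 * (16 * (\<mu> v w)\<^sup>2) + 4 * (\<mu> v w)\<^sup>2"
      by (intro add_mono mult_left_mono bad_le) auto
    also have "\<dots> \<le> 41 / 2 * (\<mu> v w)\<^sup>2" by simp
    finally have "D * (bad v w * (1 + \<tau> v w)) \<le> D * (41 / 2 * (\<mu> v w)\<^sup>2)"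
      using D_pos by (intro mult_left_mono) auto
    then show "bad v w * (\<Sum>u\<in>V. A v u * A w u) \<le> D * (41 / 2 * (\<mu> v w)\<^sup>2)"
      by (simp add: codegree[OF V] mult_ac)
  qed
  also have "\<dots> = D * (41 / 2 * (\<Sum>v\<in>V. \<Sum>w\<in>V. (\<mu> v w)\<^sup>2))" by (simp only: sum_distrib_left)
  also have "\<dots> \<le> D * (41 / 2 * (msq_bound * N\<^sup>2))" using D_pos sum_\<mu>_square_le by (intro mult_left_mono) auto
  finally show ?thesis .
qed

lemma sum_loss_le: "(\<Sum>u\<in>V. \<Sum>v\<in>V. loss u v) \<le> 82 * (msq_bound * N\<^sup>2)"
proof -
  let ?T = "\<Sum>v\<in>V. \<Sum>w\<in>V. bad v w * (\<Sum>u\<in>V. A v u * A w u)"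
  have "(\<Sum>u\<in>V. \<Sum>v\<in>V. \<Sum>w\<in>V. A u v * (bad v w * A u w)) = (\<Sum>v\<in>V. \<Sum>u\<in>V. \<Sum>w\<in>V. A u v * (bad v w * A u w))"
    by (rule sum.swap)
  also have "\<dots> = (\<Sum>v\<in>V. \<Sum>w\<in>V. \<Sum>u\<in>V. A u v * (bad v w * A u w))"
    by (intro sum.cong refl sum.swap)
  also have "\<dots> = ?T"
    by (intro sum.cong refl) (simp add: sum_distrib_left A_sym mult_ac)
  finally have T: "(\<Sum>u\<in>V. \<Sum>v\<in>V. \<Sum>w\<in>V. A u v * (bad v w * A u w)) = ?T" .
  have T': "(\<Sum>u\<in>V. \<Sum>v\<in>V. \<Sum>w\<in>V. A u v * (A v w * bad u w)) = ?T"
    unfolding T[symmetric] by (subst sum.swap) (simp add: A_sym mult_ac)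
  have "(\<Sum>u\<in>V. \<Sum>v\<in>V. loss u v)
      \<le> (\<Sum>u\<in>V. \<Sum>v\<in>V. 2 / D * (\<Sum>w\<in>V. A u v * (bad v w * A u w) + A u v * (A v w * bad u w)))"
    by (intro sum_mono loss_le)
  also have "\<dots> = 2 / D * (\<Sum>u\<in>V. \<Sum>v\<in>V. \<Sum>w\<in>V. A u v * (bad v w * A u w) + A u v * (A v w * bad u w))"
    by (simp only: sum_distrib_left)
  also have "\<dots> = 2 / D * (?T + ?T)" unfolding sum.distrib T T' ..
  also have "\<dots> \<le> 2 / D * (D * (41 / 2 * (msq_bound * N\<^sup>2)) + D * (41 / 2 * (msq_bound * N\<^sup>2)))"
    using D_pos sum_bad_codegree_le by (intro mult_left_mono add_mono) auto
  also have "\<dots> = 82 * (msq_bound * N\<^sup>2)" using D_pos by (simp add: field_simps)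
  finally show ?thesis .
qed

lemma abs_\<tau>_mult_\<alpha>_le:
  assumes V: "u \<in> V" "v \<in> V"
  shows "\<bar>\<tau> u v * \<alpha> u v\<bar>
    \<le> (\<mu> u v)\<^sup>2 + 36 / 5 * \<rho>\<^sub>0 * \<bar>\<mu> u v\<bar> + 26 / 5 * \<rho>\<^sub>0 * (A u v * (\<bar>\<rho> u\<bar> + \<bar>\<rho> v\<bar>))"
proof -
  let ?r = "\<bar>\<rho> u\<bar> + \<bar>\<rho> v\<bar>" and ?m = "\<bar>\<mu> u v\<bar>" and ?g = "26 / 5 * \<rho>\<^sub>0"
  have "\<bar>\<tau> u v * \<alpha> u v\<bar> \<le> (?r + ?m) * (good u v * (?m + ?g))"
    unfolding abs_mult \<tau>_def using abs_\<alpha>_le(1)[OF V] by (intro mult_mono) auto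
  also have "\<dots> = good u v * (?m * ?m + ?m * (?g + ?r)) + ?g * (good u v * ?r)" by (simp add: algebra_simps)
  also have "\<dots> \<le> 1 * (?m * ?m + ?m * (36 / 5 * \<rho>\<^sub>0)) + ?g * (A u v * ?r)"
  proof (intro add_mono mult_mono order_refl)
    show "?g + ?r \<le> 36 / 5 * \<rho>\<^sub>0" using abs_\<rho>_le[OF V(1)] abs_\<rho>_le[OF V(2)] by linarith
  qed (use good_bounds[of u v] \<rho>\<^sub>0_bounds in auto)
  finally show ?thesis by (simp add: power2_eq_square mult_ac)
qed

lemma sum_abs_\<tau>_mult_\<alpha>_le:
  "(\<Sum>u\<in>V. \<Sum>v\<in>V. \<bar>\<tau> u v * \<alpha> u v\<bar>) \<le> (msq_bound + 36 / 5 * \<rho>\<^sub>0 * k\<^sup>2 / p\<^sup>2 + 11 * \<rho>\<^sub>0 * k\<^sup>2) * N\<^sup>2"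
proof -
  have "(\<Sum>u\<in>V. \<Sum>v\<in>V. \<bar>\<tau> u v * \<alpha> u v\<bar>) \<le> (\<Sum>u\<in>V. \<Sum>v\<in>V. (\<mu> u v)\<^sup>2
      + 36 / 5 * \<rho>\<^sub>0 * \<bar>\<mu> u v\<bar> + 26 / 5 * \<rho>\<^sub>0 * (A u v * (\<bar>\<rho> u\<bar> + \<bar>\<rho> v\<bar>)))"
    by (intro sum_mono abs_\<tau>_mult_\<alpha>_le)
  also have "\<dots> = (\<Sum>u\<in>V. \<Sum>v\<in>V. (\<mu> u v)\<^sup>2) + 36 / 5 * \<rho>\<^sub>0 * (\<Sum>u\<in>V. \<Sum>v\<in>V. \<bar>\<mu> u v\<bar>)
      + 26 / 5 * \<rho>\<^sub>0 * (\<Sum>u\<in>V. \<Sum>v\<in>V. A u v * (\<bar>\<rho> u\<bar> + \<bar>\<rho> v\<bar>))"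
    by (simp only: sum.distrib sum_distrib_left)
  also have "\<dots> \<le> msq_bound * N\<^sup>2 + 36 / 5 * \<rho>\<^sub>0 * (k\<^sup>2 / p\<^sup>2 * N\<^sup>2)
      + 26 / 5 * \<rho>\<^sub>0 * (151 / 75 * (p * N) * (k\<^sup>2 * N / p))"
  proof (intro add_mono mult_left_mono sum_\<mu>_square_le sum_abs_\<mu>_le)
    have "(\<Sum>u\<in>V. \<Sum>v\<in>V. A u v * (\<bar>\<rho> u\<bar> + \<bar>\<rho> v\<bar>)) \<le> 151 / 75 * (p * N) * (\<Sum>u\<in>V. \<bar>\<rho> u\<bar>)"
      by (rule sum_A_mult_add_le) simp
    also have "\<dots> \<le> 151 / 75 * (p * N) * (k\<^sup>2 * N / p)"
      using sum_abs_\<rho>_le p N_pos by (intro mult_left_mono) auto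
    finally show "(\<Sum>u\<in>V. \<Sum>v\<in>V. A u v * (\<bar>\<rho> u\<bar> + \<bar>\<rho> v\<bar>)) \<le> 151 / 75 * (p * N) * (k\<^sup>2 * N / p)" .
  qed (use \<rho>\<^sub>0_bounds in auto)
  also have "\<dots> = (msq_bound + 36 / 5 * \<rho>\<^sub>0 * k\<^sup>2 / p\<^sup>2 + 26 / 5 * 151 / 75 * (\<rho>\<^sub>0 * k\<^sup>2)) * N\<^sup>2"
    using p by (simp add: algebra_simps power2_eq_square)
  also have "\<dots> \<le> (msq_bound + 36 / 5 * \<rho>\<^sub>0 * k\<^sup>2 / p\<^sup>2 + 11 * (\<rho>\<^sub>0 * k\<^sup>2)) * N\<^sup>2"
    using \<rho>\<^sub>0_bounds by (intro mult_right_mono add_left_mono) auto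
  finally show ?thesis by (simp add: mult.assoc)
qed

lemma abs_\<alpha>_mean_diff_le:
  assumes u: "u \<in> V"
  shows "\<bar>\<alpha>_mean u - potential u\<bar> \<le> 3 / 2 * \<rho>\<^sub>0 * \<bar>\<rho> u\<bar> + \<bar>\<Sum>w\<in>V. R u w * potential w\<bar> / (p * N)
    + 3 * \<rho>\<^sub>0 * (\<Sum>w\<in>V. bad u w) / (p * N)"
proof -
  have pN: "p * N > 0" using p N_pos by simp
  have "\<bar>potential u\<bar> * \<bar>\<rho> u\<bar> \<le> 3 / 2 * \<rho>\<^sub>0 * \<bar>\<rho> u\<bar>"
    using abs_potential_le[OF u] by (intro mult_right_mono) auto
  then have "\<bar>- \<rho> u * potential u\<bar> \<le> 3 / 2 * \<rho>\<^sub>0 * \<bar>\<rho> u\<bar>" by (simp add: abs_mult mult.commute)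
  moreover have "\<bar>\<Sum>w\<in>V. bad u w * (potential u + potential w)\<bar> \<le> 3 * \<rho>\<^sub>0 * (\<Sum>w\<in>V. bad u w)"
    unfolding sum_distrib_left
  proof (rule order_trans[OF sum_abs sum_mono])
    fix w assume w: "w \<in> V"
    have bound: "\<bar>potential u + potential w\<bar> \<le> 3 * \<rho>\<^sub>0"
      using abs_potential_le[OF u] abs_potential_le[OF w] by linarith
    then show "\<bar>bad u w * (potential u + potential w)\<bar> \<le> 3 * \<rho>\<^sub>0 * bad u w"
      using mult_left_mono[OF bound bad_bounds(1)] bad_bounds(1)[of u w]
      by (simp only: abs_mult abs_of_nonneg mult.commute)
  qed
  then have "\<bar>(\<Sum>w\<in>V. bad u w * (potential u + potential w)) / (p * N)\<bar> \<le> 3 * \<rho>\<^sub>0 * (\<Sum>w\<in>V. bad u w) / (p * N)"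
    using pN by (simp add: divide_right_mono)
  moreover have "\<bar>(\<Sum>w\<in>V. R u w * potential w) / (p * N)\<bar> = \<bar>\<Sum>w\<in>V. R u w * potential w\<bar> / (p * N)"
    using pN by simp
  moreover have "\<bar>x - y + z\<bar> \<le> \<bar>x\<bar> + \<bar>y\<bar> + \<bar>z\<bar>" for x y z :: real by linarith
  ultimately show ?thesis unfolding \<alpha>_mean_eq by (smt (verit))
qed

lemma sum_abs_\<alpha>_mean_diff_le:
  "(\<Sum>u\<in>V. \<bar>\<alpha>_mean u - potential u\<bar>) \<le> (3 * \<rho>\<^sub>0 * k\<^sup>2 + 48 * \<rho>\<^sub>0 * msq_bound) * N / p"
proof -
  have pN: "p * N > 0" using p N_pos by simp
  have "(\<Sum>u\<in>V. \<bar>\<alpha>_mean u - potential u\<bar>) \<le> (\<Sum>u\<in>V. 3 / 2 * \<rho>\<^sub>0 * \<bar>\<rho> u\<bar>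
      + \<bar>\<Sum>w\<in>V. R u w * potential w\<bar> / (p * N) + 3 * \<rho>\<^sub>0 * (\<Sum>w\<in>V. bad u w) / (p * N))"
    by (intro sum_mono abs_\<alpha>_mean_diff_le)
  also have "\<dots> = 3 / 2 * \<rho>\<^sub>0 * (\<Sum>u\<in>V. \<bar>\<rho> u\<bar>) + (\<Sum>u\<in>V. \<bar>\<Sum>w\<in>V. R u w * potential w\<bar>) / (p * N)
      + 3 * \<rho>\<^sub>0 * (\<Sum>u\<in>V. \<Sum>w\<in>V. bad u w) / (p * N)"
    by (simp only: sum.distrib sum_distrib_left sum_divide_distrib)
  also have "\<dots> \<le> 3 / 2 * \<rho>\<^sub>0 * (k\<^sup>2 * N / p) + (3 / 2 * \<rho>\<^sub>0 * (k\<^sup>2 * N\<^sup>2)) / (p * N)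
      + 3 * \<rho>\<^sub>0 * (16 * (msq_bound * N\<^sup>2)) / (p * N)"
    using pN \<rho>\<^sub>0_bounds abs_potential_le
    by (intro add_mono mult_left_mono divide_right_mono sum_abs_\<rho>_le sum_abs_R_mult_le sum_bad_le) auto
  also have "\<dots> = (3 * \<rho>\<^sub>0 * k\<^sup>2 + 48 * \<rho>\<^sub>0 * msq_bound) * N / p"
    using p N_pos by (simp add: field_simps power2_eq_square)
  finally show ?thesis .
qed

definition good_\<mu> :: "'a \<Rightarrow> 'a \<Rightarrow> real" where "good_\<mu> u v = good u v * \<mu> u v"

lemma abs_good_\<mu>_le: "\<bar>good_\<mu> u w\<bar> \<le> 1 / 4" "\<bar>good_\<mu> u w\<bar> \<le> \<bar>\<mu> u w\<bar>"
  by (cases rule: good_cases[of u w]; simp add: good_\<mu>_def)+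

lemma L2_set_good_\<mu>_le: "L2_set (\<lambda>u. good_\<mu> u w) V \<le> k * sqrt N / (2 * p)"
proof -
  have "(\<Sum>u\<in>V. (good_\<mu> u w)\<^sup>2) \<le> (\<Sum>u\<in>V. 1 / 4 * \<bar>\<mu> w u\<bar>)"
  proof (rule sum_mono)
    fix u
    have "\<bar>good_\<mu> u w\<bar> * \<bar>good_\<mu> u w\<bar> \<le> 1 / 4 * \<bar>\<mu> u w\<bar>" using abs_good_\<mu>_le by (intro mult_mono) auto
    then show "(good_\<mu> u w)\<^sup>2 \<le> 1 / 4 * \<bar>\<mu> w u\<bar>" by (simp add: power2_eq_square \<mu>_sym[of w u])
  qed
  also have "\<dots> \<le> 1 / 4 * (k\<^sup>2 * N / p\<^sup>2)"
    unfolding sum_distrib_left[symmetric] by (intro mult_left_mono sum_abs_\<mu>_row_le) auto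
  also have "\<dots> = (k * sqrt N / (2 * p))\<^sup>2" using N_pos by (simp add: power_divide power_mult_distrib)
  finally show ?thesis using k(1) p N_pos by (subst L2_set_le_iff) auto
qed

lemma sum_abs_R_mult_good_\<mu>_le:
  "(\<Sum>u\<in>V. \<Sum>v\<in>V. \<bar>\<Sum>w\<in>V. R v w * good_\<mu> u w\<bar>) \<le> 81 / 32 * k ^ 3 / p * N ^ 3"
proof -
  define s where "s v u = sgn (\<Sum>w\<in>V. R v w * good_\<mu> u w)" for v u
  have "(\<Sum>u\<in>V. \<Sum>v\<in>V. \<bar>\<Sum>w\<in>V. R v w * good_\<mu> u w\<bar>) = (\<Sum>v\<in>V. \<Sum>u\<in>V. \<bar>\<Sum>w\<in>V. R v w * good_\<mu> u w\<bar>)"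
    by (rule sum.swap)
  also have "\<dots> = (\<Sum>v\<in>V. \<Sum>u\<in>V. \<Sum>w\<in>V. R v w * (s v u * good_\<mu> u w))"
  proof (intro sum.cong refl)
    fix v u
    have "\<bar>\<Sum>w\<in>V. R v w * good_\<mu> u w\<bar> = s v u * (\<Sum>w\<in>V. R v w * good_\<mu> u w)"
      unfolding s_def by (simp add: abs_sgn mult.commute)
    then show "\<bar>\<Sum>w\<in>V. R v w * good_\<mu> u w\<bar> = (\<Sum>w\<in>V. R v w * (s v u * good_\<mu> u w))"
      by (simp add: sum_distrib_left mult_ac)
  qed
  also have "\<dots> = (\<Sum>v\<in>V. \<Sum>w\<in>V. R v w * (\<Sum>u\<in>V. s v u * good_\<mu> u w))"
    by (rule sum.cong[OF refl], subst sum.swap) (simp add: sum_distrib_left)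
  also have "\<dots> \<le> 81 / 16 * (k\<^sup>2 * N\<^sup>2) * sqrt N * (k * sqrt N / (2 * p))"
  proof (rule order_trans[OF abs_ge_self gram_norm_leD[OF grothendieck_inequality[OF norm_R] V(1)]])
    fix v
    have "(\<Sum>u\<in>V. (s v u)\<^sup>2) \<le> (\<Sum>u\<in>V. 1)" by (intro sum_mono) (auto simp: s_def sgn_if)
    then show "L2_set (s v) V \<le> sqrt N" by (simp add: L2_set_def N_def)
  qed (use N_pos k p L2_set_good_\<mu>_le in auto)
  also have "\<dots> = 81 / 16 * (k\<^sup>2 * N\<^sup>2) * (k / (2 * p)) * (sqrt N * sqrt N)" by simp
  also have "\<dots> = 81 / 32 * k ^ 3 / p * N ^ 3" using N_pos by (simp add: eval_nat_numeral mult_ac)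
  finally show ?thesis .
qed

lemma sum_abs_mixed_le:
  "(\<Sum>u\<in>V. \<Sum>v\<in>V. \<bar>mixed u v\<bar>) \<le> (26 / 5 * \<rho>\<^sub>0 * k\<^sup>2 + 81 / 32 * k ^ 3 / p) * N ^ 3"
proof -
  have "\<bar>mixed u v\<bar> \<le> \<bar>\<Sum>w\<in>V. R v w * (\<alpha> u w + good_\<mu> u w)\<bar> + \<bar>\<Sum>w\<in>V. R v w * good_\<mu> u w\<bar>" for u v
  proof -
    have "mixed u v = (\<Sum>w\<in>V. R v w * (\<alpha> u w + good_\<mu> u w)) - (\<Sum>w\<in>V. R v w * good_\<mu> u w)"
      by (simp add: mixed_def sum_subtractf[symmetric] algebra_simps)
    then show ?thesis by linarith
  qed
  then have "(\<Sum>u\<in>V. \<Sum>v\<in>V. \<bar>mixed u v\<bar>) \<le> (\<Sum>u\<in>V. \<Sum>v\<in>V.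
      \<bar>\<Sum>w\<in>V. R v w * (\<alpha> u w + good_\<mu> u w)\<bar> + \<bar>\<Sum>w\<in>V. R v w * good_\<mu> u w\<bar>)"
    by (intro sum_mono)
  also have "\<dots> = (\<Sum>u\<in>V. \<Sum>v\<in>V. \<bar>\<Sum>w\<in>V. R v w * (\<alpha> u w + good_\<mu> u w)\<bar>)
      + (\<Sum>u\<in>V. \<Sum>v\<in>V. \<bar>\<Sum>w\<in>V. R v w * good_\<mu> u w\<bar>)"
    by (simp only: sum.distrib)
  also have "\<dots> \<le> (\<Sum>u\<in>V. 26 / 5 * \<rho>\<^sub>0 * (k\<^sup>2 * N\<^sup>2)) + 81 / 32 * k ^ 3 / p * N ^ 3"
  proof (intro add_mono sum_mono sum_abs_R_mult_le sum_abs_R_mult_good_\<mu>_le)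
    fix u w assume V: "u \<in> V" "w \<in> V"
    have "good u w * (26 / 5 * \<rho>\<^sub>0) \<le> 1 * (26 / 5 * \<rho>\<^sub>0)"
      using good_bounds(3) \<rho>\<^sub>0_bounds by (intro mult_right_mono) auto
    then show "\<bar>\<alpha> u w + good_\<mu> u w\<bar> \<le> 26 / 5 * \<rho>\<^sub>0"
      using abs_\<alpha>_add_\<mu>_le[OF V] unfolding good_\<mu>_def by linarith
  qed (use \<rho>\<^sub>0_bounds in auto)
  also have "(\<Sum>u\<in>V. 26 / 5 * \<rho>\<^sub>0 * (k\<^sup>2 * N\<^sup>2)) = 26 / 5 * \<rho>\<^sub>0 * k\<^sup>2 * N ^ 3"
    by (simp add: N_def[symmetric] eval_nat_numeral mult_ac)
  finally show ?thesis by (simp add: distrib_right)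
qed

definition error :: "'a \<Rightarrow> 'a \<Rightarrow> real" where
  "error u v = bad u v + loss u v + 2 * \<bar>\<tau> u v * \<alpha> u v\<bar>
  + 2 * (A u v * (\<bar>\<alpha>_mean u - potential u\<bar> + \<bar>\<alpha>_mean v - potential v\<bar>))
  + 2 / D * \<bar>mixed u v\<bar> + 2 / D * \<bar>mixed v u\<bar>"

lemma A_mult_cover_cost_le:
  assumes V: "u \<in> V" "v \<in> V"
  shows "A u v * cover_cost ((\<Sum>w\<in>V. weight u v w) + U u v) \<le> error u v"
proof -
  have nonneg: "0 \<le> loss u v" "0 \<le> 2 / D * \<bar>mixed u v\<bar>" "0 \<le> 2 / D * \<bar>mixed v u\<bar>"
    "0 \<le> A u v * (\<bar>\<alpha>_mean u - potential u\<bar> + \<bar>\<alpha>_mean v - potential v\<bar>)"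
    using D_pos A_bounds loss_nonneg[OF V] by auto
  show ?thesis
  proof (cases rule: good_cases[of u v])
    case no_arc
    then show ?thesis using nonneg unfolding error_def by (simp add: add_nonneg_nonneg)
  next
    case bad
    have "(\<Sum>w\<in>V. weight u v w) = 0" using bad(3) by (simp add: weight_def)
    then have "A u v * cover_cost ((\<Sum>w\<in>V. weight u v w) + U u v) \<le> bad u v"
      using U(1)[of u v] U_le[of u v] \<rho>\<^sub>0_bounds bad(1,2) by (simp add: cover_cost_def)
    moreover have "0 \<le> 2 * \<bar>\<tau> u v * \<alpha> u v\<bar>" by simp
    ultimately show ?thesis using nonneg unfolding error_def by linarith
  next
    case good
    let ?e = "\<tau> u v * \<alpha> u v + (\<alpha>_mean u - potential u) + (\<alpha>_mean v - potential v) + (mixed u v + mixed v u) / D"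
    have "cover_cost ((\<Sum>w\<in>V. weight u v w) + U u v) \<le> loss u v + 2 * \<bar>?e\<bar>"
      unfolding sum_weight_add_U[OF V good(3)] using nonneg(1) by (rule cover_cost_le)
    also have "\<bar>?e\<bar> \<le> \<bar>\<tau> u v * \<alpha> u v\<bar> + \<bar>\<alpha>_mean u - potential u\<bar> + \<bar>\<alpha>_mean v - potential v\<bar>
        + (\<bar>mixed u v\<bar> + \<bar>mixed v u\<bar>) / D"
    proof -
      have "\<bar>(mixed u v + mixed v u) / D\<bar> \<le> (\<bar>mixed u v\<bar> + \<bar>mixed v u\<bar>) / D"
        using D_pos by (simp add: divide_right_mono)
      moreover have "\<bar>x + y + z + t\<bar> \<le> \<bar>x\<bar> + \<bar>y\<bar> + \<bar>z\<bar> + t'" if "\<bar>t\<bar> \<le> t'" for x y z t t' :: real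
        using that by linarith
      ultimately show ?thesis by blast
    qed
    finally show ?thesis using good by (simp add: error_def add_divide_distrib)
  qed
qed

lemma error_coefficient_le:
  "(100 + 14496 / 75 * \<rho>\<^sub>0) * msq_bound + (72 / 5 + 104 / 5) * (\<rho>\<^sub>0 / p\<^sup>2) * k\<^sup>2
    + (22 + 906 / 75) * \<rho>\<^sub>0 * k\<^sup>2 + 81 / 8 * (k / p ^ 3) * k\<^sup>2 \<le> 11 / 20 * p * k\<^sup>2"
proof -
  have p3: "p ^ 3 \<le> p" using p power_decreasing[of 1 3 p] by simp
  have "(100 + 14496 / 75 * \<rho>\<^sub>0) * msq_bound \<le> 102 * msq_bound"
    using \<rho>\<^sub>0_bounds \<sigma>_pos p by (intro mult_right_mono) (auto simp: msq_bound_def)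
  also have "\<dots> = 102 / 268 * (\<sigma> * p\<^sup>2) * (p * k\<^sup>2)" by (simp add: msq_bound_def eval_nat_numeral)
  also have "\<dots> \<le> 102 / 268 * (4 / 27 + 1 / 150) * (p * k\<^sup>2)"
  proof (intro mult_right_mono mult_left_mono)
    have "0 \<le> (p - 2 / 3)\<^sup>2 * (p + 1 / 3)" using p by simp
    also have "(p - 2 / 3)\<^sup>2 * (p + 1 / 3) = 4 / 27 - (1 - p) * p\<^sup>2"
      by (simp add: power2_eq_square field_simps)
    finally have "(1 - p) * p\<^sup>2 \<le> 4 / 27" by simp
    moreover have "\<rho>\<^sub>0 * p\<^sup>2 \<le> 1 / 150 * 1"
      using \<rho>\<^sub>0_bounds p by (intro mult_mono) (auto simp: power_le_one)
    ultimately show "\<sigma> * p\<^sup>2 \<le> 4 / 27 + 1 / 150" by (simp add: \<sigma>_def algebra_simps)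
  qed (use p in auto)
  finally have first: "(100 + 14496 / 75 * \<rho>\<^sub>0) * msq_bound \<le> 102 / 268 * (4 / 27 + 1 / 150) * (p * k\<^sup>2)" .
  have \<rho>\<^sub>0_div: "\<rho>\<^sub>0 / p\<^sup>2 = p / 150" using p by (simp add: \<rho>\<^sub>0_def eval_nat_numeral)
  have second: "(72 / 5 + 104 / 5) * (\<rho>\<^sub>0 / p\<^sup>2) * k\<^sup>2 = (176 / 5) / 150 * (p * k\<^sup>2)" unfolding \<rho>\<^sub>0_div by simp
  have "(22 + 906 / 75) * \<rho>\<^sub>0 * k\<^sup>2 = (22 + 906 / 75) / 150 * (p ^ 3 * k\<^sup>2)" by (simp add: \<rho>\<^sub>0_def)
  also have "\<dots> \<le> (22 + 906 / 75) / 150 * (p * k\<^sup>2)" using p3 by (intro mult_left_mono mult_right_mono) auto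
  finally have third: "(22 + 906 / 75) * \<rho>\<^sub>0 * k\<^sup>2 \<le> (22 + 906 / 75) / 150 * (p * k\<^sup>2)" .
  have "k / p ^ 3 \<le> 3 / 4096 * p" using k_div_p3_le p3 by linarith
  then have "81 / 8 * (k / p ^ 3) * k\<^sup>2 \<le> 81 / 8 * (3 / 4096 * p) * k\<^sup>2"
    by (intro mult_left_mono mult_right_mono) auto
  then have fourth: "81 / 8 * (k / p ^ 3) * k\<^sup>2 \<le> 243 / 32768 * (p * k\<^sup>2)" by simp
  have "x1 + x2 + x3 + x4 \<le> 11 / 20 * t"
    if "x1 \<le> 102 / 268 * (4 / 27 + 1 / 150) * t" "x2 = 176 / 5 / 150 * t"
      "x3 \<le> (22 + 906 / 75) / 150 * t" "x4 \<le> 243 / 32768 * t" "0 \<le> t" for x1 x2 x3 x4 t :: real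
    using that by argo
  from this[OF first second third fourth] show ?thesis using p by (simp only: mult.assoc) simp
qed

lemma sum_error_le: "(\<Sum>u\<in>V. \<Sum>v\<in>V. error u v) \<le> 11 / 20 * p * k\<^sup>2 * N\<^sup>2"
proof -
  let ?d = "\<lambda>u. \<bar>\<alpha>_mean u - potential u\<bar>" and ?q = "(26 / 5 * \<rho>\<^sub>0 * k\<^sup>2 + 81 / 32 * k ^ 3 / p) * N ^ 3"
  have "(\<Sum>u\<in>V. \<Sum>v\<in>V. error u v) = (\<Sum>u\<in>V. \<Sum>v\<in>V. bad u v) + (\<Sum>u\<in>V. \<Sum>v\<in>V. loss u v)
      + 2 * (\<Sum>u\<in>V. \<Sum>v\<in>V. \<bar>\<tau> u v * \<alpha> u v\<bar>) + 2 * (\<Sum>u\<in>V. \<Sum>v\<in>V. A u v * (?d u + ?d v))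
      + 2 / D * (\<Sum>u\<in>V. \<Sum>v\<in>V. \<bar>mixed u v\<bar>) + 2 / D * (\<Sum>u\<in>V. \<Sum>v\<in>V. \<bar>mixed v u\<bar>)"
    unfolding error_def by (simp only: sum.distrib sum_distrib_left)
  also have "(\<Sum>u\<in>V. \<Sum>v\<in>V. \<bar>mixed v u\<bar>) = (\<Sum>u\<in>V. \<Sum>v\<in>V. \<bar>mixed u v\<bar>)" by (rule sum.swap)
  also have "(\<Sum>u\<in>V. \<Sum>v\<in>V. bad u v) + (\<Sum>u\<in>V. \<Sum>v\<in>V. loss u v)
      + 2 * (\<Sum>u\<in>V. \<Sum>v\<in>V. \<bar>\<tau> u v * \<alpha> u v\<bar>) + 2 * (\<Sum>u\<in>V. \<Sum>v\<in>V. A u v * (?d u + ?d v))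
      + 2 / D * (\<Sum>u\<in>V. \<Sum>v\<in>V. \<bar>mixed u v\<bar>) + 2 / D * (\<Sum>u\<in>V. \<Sum>v\<in>V. \<bar>mixed u v\<bar>)
    \<le> 16 * (msq_bound * N\<^sup>2) + 82 * (msq_bound * N\<^sup>2)
      + 2 * ((msq_bound + 36 / 5 * \<rho>\<^sub>0 * k\<^sup>2 / p\<^sup>2 + 11 * \<rho>\<^sub>0 * k\<^sup>2) * N\<^sup>2)
      + 2 * (151 / 75 * (p * N) * ((3 * \<rho>\<^sub>0 * k\<^sup>2 + 48 * \<rho>\<^sub>0 * msq_bound) * N / p))
      + 2 / D * ?q + 2 / D * ?q"
  proof (intro add_mono mult_left_mono sum_bad_le sum_loss_le sum_abs_\<tau>_mult_\<alpha>_le sum_abs_mixed_le)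
    have "(\<Sum>u\<in>V. \<Sum>v\<in>V. A u v * (?d u + ?d v)) \<le> 151 / 75 * (p * N) * (\<Sum>u\<in>V. ?d u)"
      by (rule sum_A_mult_add_le) simp
    also have "\<dots> \<le> 151 / 75 * (p * N) * ((3 * \<rho>\<^sub>0 * k\<^sup>2 + 48 * \<rho>\<^sub>0 * msq_bound) * N / p)"
      using p N_pos by (intro mult_left_mono sum_abs_\<alpha>_mean_diff_le) auto
    finally show "(\<Sum>u\<in>V. \<Sum>v\<in>V. A u v * (?d u + ?d v))
      \<le> 151 / 75 * (p * N) * ((3 * \<rho>\<^sub>0 * k\<^sup>2 + 48 * \<rho>\<^sub>0 * msq_bound) * N / p)" .
  qed (use D_pos in auto)
  also have "\<dots> = ((100 + 14496 / 75 * \<rho>\<^sub>0) * msq_bound + (72 / 5 + 104 / 5) * (\<rho>\<^sub>0 / p\<^sup>2) * k\<^sup>2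
      + (22 + 906 / 75) * \<rho>\<^sub>0 * k\<^sup>2 + 81 / 8 * (k / p ^ 3) * k\<^sup>2) * N\<^sup>2"
    using p N_pos by (simp add: D_def field_simps eval_nat_numeral)
  also have "\<dots> \<le> 11 / 20 * p * k\<^sup>2 * N\<^sup>2" by (intro mult_right_mono error_coefficient_le) simp
  finally show ?thesis .
qed

lemma sum_cover_cost_le:
  "(\<Sum>u\<in>V. \<Sum>v\<in>V. A u v * cover_cost ((\<Sum>w\<in>V. weight u v w) + U u v)) \<le> 11 / 20 * p * k\<^sup>2 * N\<^sup>2"
  by (rule order_trans[OF sum_mono[OF sum_mono] sum_error_le]) (rule A_mult_cover_cost_le)

end

lemma sum_symmetric_split_le:
  fixes h :: "'a \<Rightarrow> 'a \<Rightarrow> real"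
  assumes "finite C" "finite P" "finite S" "C \<inter> P = {}" "C \<inter> S = {}" "P \<inter> S = {}"
    and h: "\<And>u v. h u v = h v u" "\<And>u v. 0 \<le> h u v"
  shows "(\<Sum>u\<in>C \<union> P \<union> S. \<Sum>v\<in>C \<union> P \<union> S. h u v) \<le> (\<Sum>u\<in>C. \<Sum>v\<in>C. h u v)
    + 2 * (\<Sum>u\<in>P. \<Sum>v\<in>C. h u v) + (\<Sum>u\<in>P. \<Sum>v\<in>P. h u v) + 2 * (\<Sum>u\<in>S. \<Sum>v\<in>C \<union> P \<union> S. h u v)"
proof -
  have split: "sum f (C \<union> P \<union> S) = sum f C + sum f P + sum f S" for f :: "'a \<Rightarrow> real"
    using assms by (simp add: sum.union_disjoint Int_Un_distrib2)
  have swap: "(\<Sum>u\<in>X. \<Sum>v\<in>Y. h u v) = (\<Sum>u\<in>Y. \<Sum>v\<in>X. h u v)" for X Y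
    by (subst sum.swap) (intro sum.cong refl h)
  have "0 \<le> (\<Sum>u\<in>S. \<Sum>v\<in>S. h u v)" by (intro sum_nonneg h)
  then show ?thesis using swap[of C P] swap[of C S] swap[of P S] by (simp add: split sum.distrib)
qed

text \<open>
  Vertices of irregular degree violate the assumptions of the previous construction. Such a vertex \<open>x\<close>
  becomes the apex of triangles \<open>x b c\<close> of weight \<open>1 / (p * d x)\<close>, one for each arc \<open>b c\<close> between
  regular neighbours: this covers most arcs at \<open>x\<close> about once and uses up the weight \<open>U b c\<close> of \<open>b c\<close>.
  The arcs at deficient vertices are given up.
\<close>

locale cut_close_matrix =
  fixes V :: "'a set" and A :: "'a \<Rightarrow> 'a \<Rightarrow> real" and p \<epsilon> :: real
  assumes V: "finite V" "V \<noteq> {}"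
    and A_01: "A u v = 0 \<or> A u v = 1"
    and A_sym: "A u v = A v u"
    and p: "0 < p" "p \<le> 1"
    and \<epsilon>: "0 < \<epsilon>" "\<epsilon> < (p / 4) ^ 12"
    and norm: "infty_one_norm_le V V (\<lambda>u v. A u v - p) (17 / 2 * \<epsilon> * (real (card V))\<^sup>2)"
begin

definition n :: real where "n = real (card V)"
definition d :: "'a \<Rightarrow> real" where "d u = (\<Sum>v\<in>V. A u v)"
definition irregular :: "'a set" where "irregular = {u \<in> V. \<bar>d u - p * n\<bar> > p ^ 4 * n / 160}"
definition deficient :: "'a set" where "deficient = {u \<in> V. d u < p\<^sup>2 * n / 16}"
definition apexes :: "'a set" where "apexes = irregular - deficient"
definition core :: "'a set" where "core = V - irregular"

lemma n_pos: "0 < n" using V by (simp add: n_def card_gt_0_iff)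

lemma A_bounds: "0 \<le> A u v" "A u v \<le> 1" using A_01[of u v] by auto

lemma \<epsilon>_le: "\<epsilon> \<le> p ^ 12 / 16777216" using \<epsilon>(2) by (simp add: power_divide)

lemma sum_abs_deviation_le:
  "(\<And>v. v \<in> V \<Longrightarrow> \<bar>g v\<bar> \<le> 1) \<Longrightarrow> (\<Sum>u\<in>V. \<bar>\<Sum>v\<in>V. (A u v - p) * g v\<bar>) \<le> 17 / 2 * \<epsilon> * n\<^sup>2"
  using sum_abs_row_le[OF norm, of g 1] by (simp add: n_def)

lemma degree_deviation_eq: "d u - p * n = (\<Sum>v\<in>V. A u v - p)"
  by (simp add: d_def n_def sum_subtractf)

lemma card_deviating_le:
  assumes "S \<subseteq> V" "\<And>u. u \<in> S \<Longrightarrow> c \<le> \<bar>d u - p * n\<bar>"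
  shows "real (card S) * c \<le> 17 / 2 * \<epsilon> * n\<^sup>2"
proof -
  have "real (card S) * c = (\<Sum>u\<in>S. c)" by simp
  also have "\<dots> \<le> (\<Sum>u\<in>S. \<bar>d u - p * n\<bar>)" by (intro sum_mono assms)
  also have "\<dots> \<le> (\<Sum>u\<in>V. \<bar>d u - p * n\<bar>)" using V assms(1) by (intro sum_mono2) auto
  also have "\<dots> \<le> 17 / 2 * \<epsilon> * n\<^sup>2"
    using sum_abs_deviation_le[of "\<lambda>_. 1"] by (simp add: degree_deviation_eq)
  finally show ?thesis .
qed

lemma deficient_deviation:
  assumes "u \<in> deficient"
  shows "15 / 16 * p * n \<le> \<bar>d u - p * n\<bar>"
proof -
  have "p\<^sup>2 * n \<le> p * n" using p n_pos by (simp add: power2_eq_square mult_left_le)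
  moreover have "d u < p\<^sup>2 * n / 16" using assms by (simp add: deficient_def)
  ultimately show ?thesis by linarith
qed

lemma deficient_subset: "deficient \<subseteq> irregular"
proof
  fix u assume u: "u \<in> deficient"
  have "p ^ 4 * n \<le> p * n" using p n_pos power_decreasing[of 1 4 p] by (intro mult_right_mono) auto
  moreover have "0 < p * n" using p n_pos by simp
  ultimately show "u \<in> irregular" using deficient_deviation[OF u] u by (auto simp: irregular_def deficient_def)
qed

lemma parts_subset: "irregular \<subseteq> V" "deficient \<subseteq> V" "apexes \<subseteq> V" "core \<subseteq> V"
  by (auto simp: irregular_def deficient_def apexes_def core_def)

lemma finite_parts: "finite irregular" "finite deficient" "finite apexes" "finite core"
  using parts_subset V finite_subset by blast+

lemma parts_partition:
  "core \<union> apexes \<union> deficient = V" "core \<inter> apexes = {}" "core \<inter> deficient = {}" "apexes \<inter> deficient = {}"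
  using deficient_subset parts_subset by (auto simp: core_def apexes_def)

lemma card_irregular_le:
  "real (card irregular) \<le> 1360 * \<epsilon> / p ^ 4 * n" "real (card irregular) \<le> p ^ 8 * n / 12000"
proof -
  have "real (card irregular) * (p ^ 4 * n / 160) \<le> 17 / 2 * \<epsilon> * n\<^sup>2"
    by (rule card_deviating_le) (auto simp: irregular_def)
  then show le: "real (card irregular) \<le> 1360 * \<epsilon> / p ^ 4 * n"
    using p n_pos by (simp add: field_simps power2_eq_square)
  also have "\<dots> \<le> 1360 * (p ^ 12 / 16777216) / p ^ 4 * n"
    using \<epsilon>_le p n_pos by (intro mult_right_mono divide_right_mono mult_left_mono) auto
  also have "\<dots> = p ^ 8 * n * (1360 / 16777216)" using p by (simp add: field_simps power_add[symmetric])
  also have "\<dots> \<le> p ^ 8 * n * (1 / 12000)" using p n_pos by (intro mult_left_mono) auto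
  finally show "real (card irregular) \<le> p ^ 8 * n / 12000" by simp
qed

lemma card_apexes_le: "real (card apexes) \<le> real (card irregular)"
  by (simp add: apexes_def card_mono finite_parts)

lemma card_core_bounds: "real (card core) \<le> n" "11999 / 12000 * n \<le> real (card core)"
proof -
  have eq: "real (card core) = n - real (card irregular)"
    unfolding core_def n_def
    using card_Diff_subset[OF finite_parts(1) parts_subset(1)] card_mono[OF V(1) parts_subset(1)]
    by (simp add: of_nat_diff)
  show "real (card core) \<le> n" by (simp add: eq)
  have "p ^ 8 * n \<le> 1 * n" using p n_pos by (intro mult_right_mono power_le_one) auto
  then show "11999 / 12000 * n \<le> real (card core)" using card_irregular_le(2) unfolding eq by simp
qed

lemma core_nonempty: "core \<noteq> {}"
  using card_core_bounds(2) n_pos by auto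

lemma apex_degree:
  assumes "x \<in> apexes"
  shows "0 < d x" "1 / (p * d x) \<le> 16 / (p ^ 3 * n)"
proof -
  have ge: "p\<^sup>2 * n / 16 \<le> d x" using assms by (auto simp: apexes_def irregular_def deficient_def)
  moreover have pos: "0 < p\<^sup>2 * n / 16" using p n_pos by simp
  ultimately show "0 < d x" by linarith
  then have "1 / (p * d x) \<le> 1 / (p * (p\<^sup>2 * n / 16))"
    using p n_pos ge by (intro divide_left_mono mult_left_mono) auto
  then show "1 / (p * d x) \<le> 16 / (p ^ 3 * n)" by (simp add: power3_eq_cube power2_eq_square mult.assoc)
qed

definition U :: "'a \<Rightarrow> 'a \<Rightarrow> real" where
  "U u v = (\<Sum>x\<in>apexes. A x u * A x v / (p * d x))"

lemma cone_arc_bounds: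
  assumes "x \<in> apexes"
  shows "0 \<le> A x u * A x v / (p * d x)" "A x u * A x v / (p * d x) \<le> 16 / (p ^ 3 * n)"
proof -
  show "0 \<le> A x u * A x v / (p * d x)" using apex_degree(1)[OF assms] p A_bounds by auto
  have "A x u * A x v \<le> 1" using A_bounds by (intro mult_le_one) auto
  then have "A x u * A x v / (p * d x) \<le> 1 / (p * d x)"
    using apex_degree(1)[OF assms] p by (intro divide_right_mono) auto
  then show "A x u * A x v / (p * d x) \<le> 16 / (p ^ 3 * n)" using apex_degree(2)[OF assms] by linarith
qed

lemma U_bounds: "0 \<le> U u v" "U u v \<le> p ^ 5 / 750"
proof -
  show "0 \<le> U u v" unfolding U_def by (intro sum_nonneg cone_arc_bounds)
  have "U u v \<le> (\<Sum>x\<in>apexes. 16 / (p ^ 3 * n))" unfolding U_def by (intro sum_mono cone_arc_bounds)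
  also have "\<dots> = real (card apexes) * (16 / (p ^ 3 * n))" by simp
  also have "\<dots> \<le> (p ^ 8 * n / 12000) * (16 / (p ^ 3 * n))"
    using card_apexes_le card_irregular_le(2) p n_pos by (intro mult_right_mono) auto
  also have "\<dots> = p ^ 5 / 750" using p n_pos by (simp add: field_simps power_add[symmetric])
  finally show "U u v \<le> p ^ 5 / 750" .
qed

lemma infty_one_norm_core_le:
  "infty_one_norm_le core core (\<lambda>u v. A u v - p) ((3 * sqrt \<epsilon>)\<^sup>2 * (real (card core))\<^sup>2)"
proof (rule infty_one_norm_le_mono[OF infty_one_norm_le_subset[OF norm V(1) V(1) parts_subset(4) parts_subset(4)]])
  have "(11999 / 12000 * n)\<^sup>2 \<le> (real (card core))\<^sup>2"
    using card_core_bounds(2) n_pos by (intro power_mono) auto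
  moreover have "17 / 18 * n\<^sup>2 \<le> (11999 / 12000)\<^sup>2 * n\<^sup>2"
    by (intro mult_right_mono) (auto simp: power2_eq_square)
  ultimately have "17 / 18 * n\<^sup>2 \<le> (real (card core))\<^sup>2" unfolding power_mult_distrib by linarith
  then have "9 * \<epsilon> * (17 / 18 * n\<^sup>2) \<le> 9 * \<epsilon> * (real (card core))\<^sup>2" using \<epsilon> by (intro mult_left_mono) auto
  then show "17 / 2 * \<epsilon> * (real (card V))\<^sup>2 \<le> (3 * sqrt \<epsilon>)\<^sup>2 * (real (card core))\<^sup>2"
    using \<epsilon> by (simp add: power_mult_distrib n_def)
qed

lemma core_degree:
  assumes u: "u \<in> core"
  shows "\<bar>\<Sum>v\<in>core. A u v - p\<bar> \<le> p ^ 3 / 150 * p * real (card core)"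
proof -
  have regular: "\<bar>d u - p * n\<bar> \<le> p ^ 4 * n / 160" using u by (auto simp: core_def irregular_def)
  have split: "d u - p * n = (\<Sum>v\<in>core. A u v - p) + (\<Sum>v\<in>irregular. A u v - p)"
    unfolding degree_deviation_eq core_def using V parts_subset by (subst sum.subset_diff[of irregular V]) auto
  have "\<bar>\<Sum>v\<in>irregular. A u v - p\<bar> \<le> (\<Sum>v\<in>irregular. 1)"
  proof (rule order_trans[OF sum_abs sum_mono])
    fix v show "\<bar>A u v - p\<bar> \<le> 1" using A_01[of u v] p by auto
  qed
  also have "\<dots> \<le> p ^ 8 * n / 12000" using card_irregular_le(2) by simp
  also have "\<dots> \<le> p ^ 4 * n / 12000"
    using p n_pos power_decreasing[of 4 8 p] by (intro divide_right_mono mult_right_mono) auto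
  finally have "\<bar>\<Sum>v\<in>core. A u v - p\<bar> \<le> p ^ 4 * n / 160 + p ^ 4 * n / 12000"
    using split regular by linarith
  also have "\<dots> \<le> p ^ 4 * (11999 / 12000 * n) / 150" using p n_pos by simp
  also have "\<dots> \<le> p ^ 4 * real (card core) / 150"
    using card_core_bounds(2) p by (intro divide_right_mono mult_left_mono) auto
  also have "\<dots> = p ^ 3 / 150 * p * real (card core)" by (simp add: eval_nat_numeral)
  finally show ?thesis .
qed

sublocale core: triangle_weights core A p "3 * sqrt \<epsilon>" U
proof
  have "sqrt \<epsilon> \<le> (p / 4) ^ 6" using \<epsilon> p by (intro real_le_lsqrt) (auto simp: power_mult[symmetric])
  then show "3 * sqrt \<epsilon> \<le> 3 * p ^ 6 / 4096" using p by (simp add: power_divide)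
qed (use finite_parts core_nonempty A_01 A_sym p \<epsilon> infty_one_norm_core_le core_degree U_bounds in
    \<open>auto simp: U_def mult.commute\<close>)

definition share :: "'a \<Rightarrow> 'a \<Rightarrow> 'a \<Rightarrow> real" where
  "share x b c = (if x \<in> apexes \<and> b \<in> core \<and> c \<in> core then 1 / (p * d x) else 0)"

definition cone_weight :: "'a \<Rightarrow> 'a \<Rightarrow> 'a \<Rightarrow> real" where
  "cone_weight u v w = A u v * A v w * A w u * (share u v w + share v w u + share w u v)"

definition core_weight :: "'a \<Rightarrow> 'a \<Rightarrow> 'a \<Rightarrow> real" where
  "core_weight u v w = (if u \<in> core \<and> v \<in> core \<and> w \<in> core then core.weight u v w else 0)"

definition weight :: "'a \<Rightarrow> 'a \<Rightarrow> 'a \<Rightarrow> real" where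
  "weight u v w = cone_weight u v w + core_weight u v w"

definition cover :: "'a \<Rightarrow> 'a \<Rightarrow> real" where
  "cover u v = (\<Sum>w\<in>V. weight u v w)"

lemma apex_not_core: "x \<in> apexes \<Longrightarrow> x \<notin> core" using parts_partition by auto

lemma share_nonneg: "0 \<le> share x b c"
  using apex_degree(1)[of x] p by (auto simp: share_def zero_le_mult_iff)

lemma cone_weight_bounds: "0 \<le> cone_weight u v w" "cone_weight u v w \<le> 16 / (p ^ 3 * n)"
proof -
  have A3: "0 \<le> A u v * A v w * A w u" "A u v * A v w * A w u \<le> 1"
    using A_01[of u v] A_01[of v w] A_01[of w u] by auto
  have cones: "0 \<le> share u v w + share v w u + share w u v" using share_nonneg by (simp add: add_nonneg_nonneg)
  show "0 \<le> cone_weight u v w" unfolding cone_weight_def by (intro mult_nonneg_nonneg[OF A3(1) cones])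
  have "cone_weight u v w \<le> 1 * (share u v w + share v w u + share w u v)"
    unfolding cone_weight_def by (intro mult_right_mono A3 cones)
  moreover have "0 \<le> 16 / (p ^ 3 * n)" using p n_pos by simp
  then have "share u v w + share v w u + share w u v \<le> 16 / (p ^ 3 * n)"
    using apex_degree(2) apex_not_core by (auto simp: share_def)
  ultimately show "cone_weight u v w \<le> 16 / (p ^ 3 * n)" by simp
qed

lemma core_weight_bounds: "0 \<le> core_weight u v w" "core_weight u v w \<le> 4 / (p ^ 3 * n)"
proof -
  show "0 \<le> core_weight u v w" using core.weight_bounds(1) by (auto simp: core_weight_def)
  have "p ^ 3 \<le> p\<^sup>2" using p by (intro power_decreasing) auto
  then have "p ^ 3 * n \<le> p\<^sup>2 * (2 * real (card core))"
    using card_core_bounds n_pos p by (intro mult_mono) auto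
  then have "4 / (p\<^sup>2 * (2 * real (card core))) \<le> 4 / (p ^ 3 * n)"
    using p n_pos card_core_bounds(2) by (intro divide_left_mono mult_pos_pos) auto
  then have "2 / core.D \<le> 4 / (p ^ 3 * n)" by (simp add: core.D_def core.N_def mult.commute)
  moreover have "0 \<le> 4 / (p ^ 3 * n)" using p n_pos by simp
  ultimately show "core_weight u v w \<le> 4 / (p ^ 3 * n)"
    using core.weight_bounds(2)[of u v w] by (auto simp: core_weight_def)
qed

lemma weight_bounds: "0 \<le> weight u v w" "weight u v w \<le> 20 / (p ^ 3 * n)"
  using cone_weight_bounds[of u v w] core_weight_bounds[of u v w]
  by (simp_all add: weight_def add_divide_distrib[symmetric])

lemma weight_cyclic: "weight u v w = weight v w u"
  using core.weight_cyclic[of u v w]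
  by (simp add: weight_def cone_weight_def core_weight_def mult_ac add_ac conj_ac)

lemma weight_swap: "weight u v w = weight v u w"
  using core.weight_swap[of u v w]
  by (simp add: weight_def cone_weight_def core_weight_def share_def
      A_sym[of v u] A_sym[of u w] A_sym[of w v] mult_ac add_ac conj_ac)

lemma cover_sym: "cover u v = cover v u"
  unfolding cover_def by (intro sum.cong refl weight_swap)

lemma weight_nonzeroD:
  assumes "weight u v w \<noteq> 0"
  shows "u \<in> V \<and> v \<in> V \<and> w \<in> V \<and> A u v = 1 \<and> A v w = 1 \<and> A w u = 1"
proof -
  consider (cone) "cone_weight u v w \<noteq> 0" | (core) "core_weight u v w \<noteq> 0"
    using assms by (cases "cone_weight u v w = 0") (auto simp: weight_def)
  then show ?thesis
  proof cases
    case cone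
    then have "A u v = 1" "A v w = 1" "A w u = 1" "share u v w + share v w u + share w u v \<noteq> 0"
      using A_01[of u v] A_01[of v w] A_01[of w u] by (auto simp: cone_weight_def)
    then show ?thesis using parts_subset by (auto simp: share_def split: if_splits)
  next
    case core
    then show ?thesis
      using core.weight_nonzeroD[of u v w] parts_subset(4) by (auto simp: core_weight_def split: if_splits)
  qed
qed

lemma cover_eq_0:
  assumes "u \<in> deficient \<or> u \<in> apexes \<and> v \<in> apexes"
  shows "cover u v = 0"
proof -
  have "u \<notin> core" "u \<in> deficient \<Longrightarrow> u \<notin> apexes" "u \<notin> deficient \<Longrightarrow> v \<notin> core"
    using assms parts_partition by auto
  then have "cone_weight u v w = 0" "core_weight u v w = 0" for w
    using assms by (auto simp: cone_weight_def core_weight_def share_def)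
  then show ?thesis by (simp add: cover_def weight_def)
qed

lemma cover_core:
  assumes u: "u \<in> core" and v: "v \<in> core" and A: "A u v = 1"
  shows "cover u v = (\<Sum>w\<in>core. core.weight u v w) + U u v"
proof -
  have "cone_weight u v w = (if w \<in> apexes then A w u * A w v / (p * d w) else 0)" for w
    using u v A apex_not_core by (auto simp: cone_weight_def share_def A_sym[of v w])
  then have "(\<Sum>w\<in>V. cone_weight u v w) = U u v"
    using V parts_subset(3) by (simp add: U_def sum.inter_restrict[symmetric] Int_absorb1)
  moreover have "(\<Sum>w\<in>V. core_weight u v w) = (\<Sum>w\<in>core. core.weight u v w)"
    using u v V parts_subset(4) by (simp add: core_weight_def sum.inter_restrict[symmetric] Int_absorb1)
  ultimately show ?thesis by (simp add: cover_def weight_def sum.distrib)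
qed

definition cone_error :: "'a \<Rightarrow> 'a \<Rightarrow> real" where
  "cone_error x v = (\<Sum>w\<in>core. A x w * A v w) / (p * d x) - 1"

lemma cover_apex:
  assumes x: "x \<in> apexes" and v: "v \<in> core" and A: "A x v = 1"
  shows "cover x v = 1 + cone_error x v"
proof -
  have "weight x v w = (if w \<in> core then A x w * A v w / (p * d x) else 0)" for w
    using x v A apex_not_core by (auto simp: weight_def core_weight_def cone_weight_def share_def A_sym[of w x])
  then show ?thesis
    using V parts_subset(4)
    by (simp add: cover_def cone_error_def sum_divide_distrib sum.inter_restrict[symmetric] Int_absorb1)
qed

lemma abs_cone_error_le:
  assumes x: "x \<in> apexes"
  shows "\<bar>cone_error x v\<bar> \<le> (\<bar>\<Sum>w\<in>V. (A v w - p) * A x w\<bar> + real (card irregular)) / (p * d x)"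
proof -
  let ?a = "\<Sum>w\<in>V. (A v w - p) * A x w" and ?b = "\<Sum>w\<in>irregular. A x w * A v w"
  have pd: "0 < p * d x" using apex_degree(1)[OF x] p by simp
  have "(\<Sum>w\<in>core. A x w * A v w) = (\<Sum>w\<in>V. A x w * A v w) - ?b"
    unfolding core_def using V parts_subset by (simp add: sum_diff)
  also have "(\<Sum>w\<in>V. A x w * A v w) = ?a + p * d x"
    by (simp add: d_def sum_distrib_left sum.distrib[symmetric] algebra_simps)
  finally have "(\<Sum>w\<in>core. A x w * A v w) = ?a + p * d x - ?b" .
  then have "cone_error x v = (?a - ?b) / (p * d x)"
    using p apex_degree(1)[OF x] by (simp add: cone_error_def diff_divide_distrib add_divide_distrib)
  moreover have "0 \<le> ?b" using A_bounds by (intro sum_nonneg) auto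
  moreover have "?b \<le> (\<Sum>w\<in>irregular. 1)" using A_bounds by (intro sum_mono mult_le_one) auto
  ultimately show ?thesis using pd by (simp add: divide_right_mono)
qed

lemma sum_cone_error_le:
  assumes x: "x \<in> apexes"
  shows "(\<Sum>v\<in>core. A x v * \<bar>cone_error x v\<bar>) \<le> 136 * \<epsilon> * n / p ^ 3 + real (card irregular) / p"
proof -
  let ?a = "\<lambda>v. \<bar>\<Sum>w\<in>V. (A v w - p) * A x w\<bar>" and ?z = "real (card irregular)"
  have pd: "0 < p * d x" using apex_degree(1)[OF x] p by simp
  have "A x v * \<bar>cone_error x v\<bar> \<le> (?a v + A x v * ?z) / (p * d x)" for v
    using A_01[of x v] abs_cone_error_le[OF x, of v] pd by auto
  then have "(\<Sum>v\<in>core. A x v * \<bar>cone_error x v\<bar>) \<le> (\<Sum>v\<in>core. (?a v + A x v * ?z) / (p * d x))"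
    by (intro sum_mono)
  also have "\<dots> \<le> (\<Sum>v\<in>V. (?a v + A x v * ?z) / (p * d x))"
    using V parts_subset pd A_bounds by (intro sum_mono2) auto
  also have "\<dots> = ((\<Sum>v\<in>V. ?a v) + d x * ?z) / (p * d x)"
    by (simp add: sum_divide_distrib[symmetric] sum.distrib d_def sum_distrib_right)
  also have "\<dots> \<le> (17 / 2 * \<epsilon> * n\<^sup>2 + d x * ?z) / (p * d x)"
    using pd sum_abs_deviation_le[of "A x"] A_bounds by (intro divide_right_mono add_right_mono) auto
  also have "\<dots> = 17 / 2 * \<epsilon> * n\<^sup>2 * (1 / (p * d x)) + ?z / p"
    using apex_degree(1)[OF x] p by (simp add: field_simps)
  also have "\<dots> \<le> 17 / 2 * \<epsilon> * n\<^sup>2 * (16 / (p ^ 3 * n)) + ?z / p"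
    using apex_degree(2)[OF x] \<epsilon> n_pos by (intro add_right_mono mult_left_mono) auto
  also have "\<dots> = 136 * \<epsilon> * n / p ^ 3 + ?z / p" using p n_pos by (simp add: field_simps power2_eq_square)
  finally show ?thesis .
qed

lemma sum_core_cost_le:
  "(\<Sum>u\<in>core. \<Sum>v\<in>core. A u v * cover_cost (cover u v)) \<le> 99 / 20 * (\<epsilon> * p * n\<^sup>2)"
proof -
  have "(\<Sum>u\<in>core. \<Sum>v\<in>core. A u v * cover_cost (cover u v))
      = (\<Sum>u\<in>core. \<Sum>v\<in>core. A u v * cover_cost ((\<Sum>w\<in>core. core.weight u v w) + U u v))"
    using cover_core A_01 by (intro sum.cong refl) (metis mult_eq_0_iff)
  also have "\<dots> \<le> 11 / 20 * p * (3 * sqrt \<epsilon>)\<^sup>2 * (real (card core))\<^sup>2"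
    using core.sum_cover_cost_le by (simp only: core.N_def)
  also have "\<dots> \<le> 11 / 20 * p * (9 * \<epsilon>) * n\<^sup>2"
    using p \<epsilon> card_core_bounds(1) by (intro mult_mono power_mono) (auto simp: power_mult_distrib)
  finally show ?thesis by (simp add: mult_ac)
qed

lemma sum_deficient_cost_le: "(\<Sum>u\<in>deficient. \<Sum>v\<in>V. A u v * cover_cost (cover u v)) \<le> 17 / 30 * (\<epsilon> * p * n\<^sup>2)"
proof -
  have "(\<Sum>u\<in>deficient. \<Sum>v\<in>V. A u v * cover_cost (cover u v)) = (\<Sum>u\<in>deficient. d u)"
    by (simp add: cover_eq_0 cover_cost_def d_def)
  also have "\<dots> \<le> (\<Sum>u\<in>deficient. p\<^sup>2 * n / 16)" by (intro sum_mono) (auto simp: deficient_def)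
  also have "\<dots> = real (card deficient) * (15 / 16 * p * n) * (p / 15)" by (simp add: power2_eq_square)
  also have "\<dots> \<le> 17 / 2 * \<epsilon> * n\<^sup>2 * (p / 15)"
    using p by (intro mult_right_mono card_deviating_le parts_subset deficient_deviation) auto
  finally show ?thesis by (simp add: mult_ac)
qed

lemma \<epsilon>_square_div_le: "i \<le> 9 \<Longrightarrow> \<epsilon>\<^sup>2 / p ^ i \<le> \<epsilon> * p / 16777216"
proof -
  assume "i \<le> 9"
  then have "\<epsilon>\<^sup>2 / p ^ i \<le> \<epsilon>\<^sup>2 / p ^ 9" using p by (intro divide_left_mono power_decreasing) auto
  also have "\<dots> \<le> \<epsilon> * (p ^ 12 / 16777216) / p ^ 9"
    unfolding power2_eq_square using \<epsilon> \<epsilon>_le p by (intro divide_right_mono mult_left_mono) auto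
  also have "\<dots> = \<epsilon> * p ^ 3 / 16777216" using p by (simp add: field_simps power_add[symmetric])
  also have "\<dots> \<le> \<epsilon> * p / 16777216"
    using \<epsilon> p power_decreasing[of 1 3 p] by (intro divide_right_mono mult_left_mono) auto
  finally show ?thesis .
qed

lemma sum_apex_pair_cost_le:
  "(\<Sum>u\<in>apexes. \<Sum>v\<in>apexes. A u v * cover_cost (cover u v)) \<le> 1 / 9 * (\<epsilon> * p * n\<^sup>2)"
proof -
  have "(\<Sum>u\<in>apexes. \<Sum>v\<in>apexes. A u v * cover_cost (cover u v)) \<le> (\<Sum>u\<in>apexes. \<Sum>v\<in>apexes. 1)"
    using A_bounds by (intro sum_mono) (simp add: cover_eq_0 cover_cost_def)
  also have "\<dots> = (real (card apexes))\<^sup>2" by (simp add: power2_eq_square)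
  also have "\<dots> \<le> (1360 * \<epsilon> / p ^ 4 * n)\<^sup>2"
    using card_apexes_le card_irregular_le(1) by (intro power_mono) auto
  also have "\<dots> = 1849600 * (\<epsilon>\<^sup>2 / p ^ 8) * n\<^sup>2"
    by (simp add: power_mult_distrib power_divide power_mult[symmetric])
  also have "\<dots> \<le> 1849600 * (\<epsilon> * p / 16777216) * n\<^sup>2"
    by (intro mult_left_mono mult_right_mono \<epsilon>_square_div_le) auto
  also have "\<dots> = 1849600 / 16777216 * (\<epsilon> * p * n\<^sup>2)" by simp
  also have "\<dots> \<le> 1 / 9 * (\<epsilon> * p * n\<^sup>2)" using \<epsilon> p by (intro mult_right_mono) auto
  finally show ?thesis .
qed

lemma apex_cost_le:
  assumes x: "x \<in> apexes"
  shows "(\<Sum>v\<in>core. A x v * cover_cost (cover x v)) \<le> 2992 * \<epsilon> * n / p ^ 5"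
proof -
  have "A x v * cover_cost (cover x v) \<le> 2 * (A x v * \<bar>cone_error x v\<bar>)" if "v \<in> core" for v
    using cover_apex[OF x that] A_01[of x v] cover_cost_le[of 0 "cone_error x v"] by auto
  then have "(\<Sum>v\<in>core. A x v * cover_cost (cover x v)) \<le> 2 * (\<Sum>v\<in>core. A x v * \<bar>cone_error x v\<bar>)"
    unfolding sum_distrib_left by (intro sum_mono)
  also have "\<dots> \<le> 2 * (136 * \<epsilon> * n / p ^ 3 + real (card irregular) / p)"
    using sum_cone_error_le[OF x] by simp
  also have "\<dots> \<le> 2 * (136 * \<epsilon> * n / p ^ 5 + 1360 * \<epsilon> * n / p ^ 5)"
  proof (intro mult_left_mono add_mono)
    show "136 * \<epsilon> * n / p ^ 3 \<le> 136 * \<epsilon> * n / p ^ 5"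
      using p n_pos \<epsilon> power_decreasing[of 3 5 p] by (intro divide_left_mono) auto
    have "real (card irregular) / p \<le> (1360 * \<epsilon> / p ^ 4 * n) / p"
      using card_irregular_le(1) p by (intro divide_right_mono) auto
    then show "real (card irregular) / p \<le> 1360 * \<epsilon> * n / p ^ 5"
      by (simp add: eval_nat_numeral mult_ac)
  qed simp
  also have "\<dots> = 2992 * \<epsilon> * n / p ^ 5" by (simp add: add_divide_distrib[symmetric])
  finally show ?thesis .
qed

lemma sum_apex_cost_le:
  "(\<Sum>x\<in>apexes. \<Sum>v\<in>core. A x v * cover_cost (cover x v)) \<le> 1 / 4 * (\<epsilon> * p * n\<^sup>2)"
proof -
  have "(\<Sum>x\<in>apexes. \<Sum>v\<in>core. A x v * cover_cost (cover x v)) \<le> (\<Sum>x\<in>apexes. 2992 * \<epsilon> * n / p ^ 5)"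
    by (intro sum_mono apex_cost_le)
  also have "\<dots> = real (card apexes) * (2992 * \<epsilon> * n / p ^ 5)" by simp
  also have "\<dots> \<le> (1360 * \<epsilon> / p ^ 4 * n) * (2992 * \<epsilon> * n / p ^ 5)"
    using card_apexes_le card_irregular_le(1) \<epsilon> n_pos p by (intro mult_right_mono) auto
  also have "\<dots> = 4069120 * (\<epsilon>\<^sup>2 / p ^ 9) * n\<^sup>2"
    using p by (simp add: field_simps power2_eq_square power_add[symmetric])
  also have "\<dots> \<le> 4069120 * (\<epsilon> * p / 16777216) * n\<^sup>2"
    by (intro mult_left_mono mult_right_mono \<epsilon>_square_div_le) auto
  also have "\<dots> = 4069120 / 16777216 * (\<epsilon> * p * n\<^sup>2)" by simp
  also have "\<dots> \<le> 1 / 4 * (\<epsilon> * p * n\<^sup>2)" using \<epsilon> p by (intro mult_right_mono) auto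
  finally show ?thesis .
qed

lemma sum_cost_le: "(\<Sum>u\<in>V. \<Sum>v\<in>V. A u v * cover_cost (cover u v)) \<le> 8 * \<epsilon> * p * n\<^sup>2"
proof -
  let ?h = "\<lambda>u v. A u v * cover_cost (cover u v)" and ?t = "\<epsilon> * p * n\<^sup>2"
  have "?h u v = ?h v u" "0 \<le> ?h u v" for u v
    using A_sym[of u v] cover_sym[of u v] A_bounds(1) cover_cost_nonneg by auto
  then have "(\<Sum>u\<in>V. \<Sum>v\<in>V. ?h u v) \<le> (\<Sum>u\<in>core. \<Sum>v\<in>core. ?h u v) + 2 * (\<Sum>u\<in>apexes. \<Sum>v\<in>core. ?h u v)
      + (\<Sum>u\<in>apexes. \<Sum>v\<in>apexes. ?h u v) + 2 * (\<Sum>u\<in>deficient. \<Sum>v\<in>V. ?h u v)"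
    using sum_symmetric_split_le[OF finite_parts(4,3,2) parts_partition(2-4), of ?h] unfolding parts_partition(1) by blast
  also have "\<dots> \<le> 99 / 20 * ?t + 2 * (1 / 4 * ?t) + 1 / 9 * ?t + 2 * (17 / 30 * ?t)"
    by (intro add_mono mult_left_mono sum_core_cost_le sum_apex_cost_le sum_apex_pair_cost_le
        sum_deficient_cost_le) auto
  also have "\<dots> = (99 / 20 + 1 / 2 + 1 / 9 + 17 / 15) * ?t" by (simp only: distrib_right)
  also have "\<dots> \<le> 8 * ?t" using \<epsilon> p by (intro mult_right_mono) auto
  finally show ?thesis by (simp only: mult.assoc)
qed

end

theorem fractional_triangle_cover:
  fixes E :: "('a \<times> 'a) set" and p \<epsilon> :: real
  assumes V: "finite V" "V \<noteq> {}" and E: "E \<subseteq> V \<times> V" "sym E" "irrefl E"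
    and p: "0 < p" "p \<le> 1" and \<epsilon>: "0 < \<epsilon>" "\<epsilon> < (p / 4) ^ 12"
    and norm: "infty_one_norm_le V V (\<lambda>u v. of_bool ((u, v) \<in> E) - p) (17 / 2 * \<epsilon> * (real (card V))\<^sup>2)"
  obtains X where "triangle_weighting E (20 / (p ^ 3 * real (card V))) X"
    and "total_cost V E X \<le> 8 * \<epsilon> * p * (real (card V))\<^sup>2"
proof -
  interpret cut_close_matrix V "\<lambda>u v. of_bool ((u, v) \<in> E)" p \<epsilon>
  proof
    show "of_bool ((u, v) \<in> E) = (of_bool ((v, u) \<in> E) :: real)" for u v
      using E(2) by (auto dest: symD)
  qed (use V p \<epsilon> norm in simp_all)
  have "triangle_weighting E (20 / (p ^ 3 * real (card V))) weight"
    unfolding triangle_weighting_def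
  proof (intro allI conjI impI)
    fix u v w
    show "0 \<le> weight u v w" "weight u v w \<le> 20 / (p ^ 3 * real (card V))"
      using weight_bounds[of u v w] by (simp_all add: n_def)
    show "weight u v w = weight v w u" by (rule weight_cyclic)
    assume "weight u v w \<noteq> 0"
    then have arcs: "(u, v) \<in> E" "(v, w) \<in> E" "(w, u) \<in> E" using weight_nonzeroD[of u v w] by simp_all
    then show "tri u v w \<subseteq> E" by (simp add: tri_def)
    show "distinct [u, v, w]" using arcs E(3) by (auto simp: irrefl_def)
  qed
  moreover have "total_cost V E weight \<le> 8 * \<epsilon> * p * (real (card V))\<^sup>2"
    using sum_cost_le unfolding total_cost_def sum_arcs_eq[OF V(1) E(1)] cover_def n_def .
  ultimately show thesis by (rule that)
qed

section \<open>Second moments of weighted sums of indicators\<close>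

lemma pmf_expectation_attained:
  fixes f :: "'a \<Rightarrow> real"
  assumes "finite (set_pmf M)" "measure_pmf.expectation M f \<le> c"
  obtains x where "x \<in> set_pmf M" "f x \<le> c"
proof (rule ccontr)
  assume "\<not> thesis"
  then have "AE x in M. c < f x" using that by (auto simp: AE_measure_pmf_iff not_le[symmetric])
  then have "measure_pmf.expectation M (\<lambda>x. - f x) < - c"
    using assms(1) by (intro measure_pmf.expectation_less) (auto simp: integrable_measure_pmf_finite)
  with assms(2) show False by simp
qed

lemma pmf_expectation_abs_le:
  fixes f :: "'a \<Rightarrow> real"
  assumes fin: "finite (set_pmf M)"
    and square: "measure_pmf.expectation M (\<lambda>x. (f x)\<^sup>2) \<le> \<gamma>\<^sup>2" and \<gamma>: "\<gamma> \<ge> 0"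
  shows "measure_pmf.expectation M (\<lambda>x. \<bar>f x\<bar>) \<le> \<gamma>"
proof -
  have int: "integrable (measure_pmf M) g" for g :: "'a \<Rightarrow> real"
    using fin by (rule integrable_measure_pmf_finite)
  have "(measure_pmf.expectation M (\<lambda>x. \<bar>f x\<bar>))\<^sup>2 \<le> measure_pmf.expectation M (\<lambda>x. \<bar>f x\<bar>\<^sup>2)"
    using measure_pmf.variance_eq[of M "\<lambda>x. \<bar>f x\<bar>"] measure_pmf.variance_positive[of M "\<lambda>x. \<bar>f x\<bar>"] int
    by simp
  then show ?thesis using square \<gamma> by (simp add: power2_le_imp_le[OF order_trans])
qed

lemma expectation_square_weighted_indicators:
  fixes M :: "'a pmf" and x :: "'b \<Rightarrow> real" and \<mu> t :: real
  assumes fin: "finite (set_pmf M)" and A: "\<And>j. j \<in> J \<Longrightarrow> A j \<subseteq> B"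
  shows "measure_pmf.expectation M (\<lambda>\<omega>. (indicator B \<omega> * ((\<Sum>j\<in>J. x j / t * indicator (A j) \<omega>) - \<mu>))\<^sup>2) =
    (\<Sum>j\<in>J. \<Sum>j'\<in>J. x j * x j' / t\<^sup>2 * measure_pmf.prob M (A j \<inter> A j'))
    - 2 * \<mu> * (\<Sum>j\<in>J. x j / t * measure_pmf.prob M (A j)) + \<mu>\<^sup>2 * measure_pmf.prob M B"
proof -
  have "(indicator B \<omega> * ((\<Sum>j\<in>J. x j / t * indicator (A j) \<omega>) - \<mu>))\<^sup>2 =
      (\<Sum>j\<in>J. \<Sum>j'\<in>J. x j * x j' / t\<^sup>2 * indicator (A j \<inter> A j') \<omega>)
      - 2 * \<mu> * (\<Sum>j\<in>J. x j / t * indicator (A j) \<omega>) + \<mu>\<^sup>2 * indicator B \<omega>" for \<omega>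
  proof (cases "\<omega> \<in> B")
    case True
    have "(\<Sum>j\<in>J. x j / t * indicator (A j) \<omega>)\<^sup>2 =
        (\<Sum>j\<in>J. \<Sum>j'\<in>J. x j * x j' / t\<^sup>2 * indicator (A j \<inter> A j') \<omega>)"
      unfolding power2_eq_square sum_product by (simp add: indicator_inter_arith mult_ac)
    then show ?thesis using True by (simp add: power2_diff)
  next
    case False
    then have "\<omega> \<notin> A j" if "j \<in> J" for j using A that by auto
    with False show ?thesis by simp
  qed
  then show ?thesis by (simp add: integrable_measure_pmf_finite[OF fin])
qed

lemma sum_weighted_joint_probabilities_le:
  fixes M :: "'a pmf" and x :: "'b \<Rightarrow> real" and t c \<Delta> :: real
  assumes J: "finite J" and x: "\<And>j. j \<in> J \<Longrightarrow> 0 \<le> x j" and t: "t > 0" and c: "0 \<le> c"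
    and pair: "\<And>j j'. j \<in> J \<Longrightarrow> j' \<in> J \<Longrightarrow> j \<noteq> j' \<Longrightarrow> measure_pmf.prob M (A j \<inter> A j') \<le> c * t\<^sup>2"
    and diagonal: "\<And>j. j \<in> J \<Longrightarrow> x j * measure_pmf.prob M (A j) \<le> \<Delta> * t\<^sup>2"
  shows "(\<Sum>j\<in>J. \<Sum>j'\<in>J. x j * x j' / t\<^sup>2 * measure_pmf.prob M (A j \<inter> A j'))
    \<le> (\<Sum>j\<in>J. x j)\<^sup>2 * c + \<Delta> * (\<Sum>j\<in>J. x j)"
proof -
  let ?P = "measure_pmf.prob M"
  have "x j * x j' / t\<^sup>2 * ?P (A j \<inter> A j') \<le> x j * x j' * c + (if j' = j then \<Delta> * x j else 0)"
    if j: "j \<in> J" "j' \<in> J" for j j'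
  proof (cases "j' = j")
    case True
    have "x j * (x j * ?P (A j)) \<le> x j * (\<Delta> * t\<^sup>2)" using x j diagonal by (intro mult_left_mono) auto
    then have "x j * x j / t\<^sup>2 * ?P (A j) \<le> \<Delta> * x j" using t by (simp add: field_simps)
    moreover have "0 \<le> x j * x j * c" using c by simp
    ultimately show ?thesis using True by simp
  next
    case False
    have "x j * x j' / t\<^sup>2 * ?P (A j \<inter> A j') \<le> x j * x j' / t\<^sup>2 * (c * t\<^sup>2)"
      using pair[OF j] False x j by (intro mult_left_mono) auto
    then show ?thesis using False t by simp
  qed
  then have "(\<Sum>j\<in>J. \<Sum>j'\<in>J. x j * x j' / t\<^sup>2 * ?P (A j \<inter> A j'))
      \<le> (\<Sum>j\<in>J. \<Sum>j'\<in>J. x j * x j' * c + (if j' = j then \<Delta> * x j else 0))"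
    by (intro sum_mono)
  also have "\<dots> = (\<Sum>j\<in>J. \<Sum>j'\<in>J. x j * x j') * c + \<Delta> * (\<Sum>j\<in>J. x j)"
    using J by (simp add: sum.distrib sum_distrib_right sum_distrib_left)
  finally show ?thesis by (simp add: power2_eq_square sum_product)
qed

lemma second_moment_weighted_indicators:
  fixes M :: "'a pmf" and x :: "'b \<Rightarrow> real" and t \<kappa> \<Delta> :: real
  assumes fin: "finite (set_pmf M)" "finite J"
    and A: "\<And>j. j \<in> J \<Longrightarrow> A j \<subseteq> B" and x: "\<And>j. j \<in> J \<Longrightarrow> 0 \<le> x j" and t: "t > 0" and \<kappa>: "1 \<le> \<kappa>"
    and single: "\<And>j. j \<in> J \<Longrightarrow> t * measure_pmf.prob M B \<le> measure_pmf.prob M (A j)"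
    and pair: "\<And>j j'. j \<in> J \<Longrightarrow> j' \<in> J \<Longrightarrow> j \<noteq> j' \<Longrightarrow>
      measure_pmf.prob M (A j \<inter> A j') \<le> \<kappa> * t\<^sup>2 * measure_pmf.prob M B"
    and diagonal: "\<And>j. j \<in> J \<Longrightarrow> x j * measure_pmf.prob M (A j) \<le> \<Delta> * t\<^sup>2"
  defines "\<mu> \<equiv> \<Sum>j\<in>J. x j"
  shows "measure_pmf.expectation M
      (\<lambda>\<omega>. (indicator B \<omega> * ((\<Sum>j\<in>J. x j / t * indicator (A j) \<omega>) - \<mu>))\<^sup>2)
    \<le> \<mu>\<^sup>2 * (\<kappa> - 1) + \<Delta> * \<mu>"
proof -
  let ?P = "measure_pmf.prob M" and ?E = "measure_pmf.expectation M"
  have "?E (\<lambda>\<omega>. (indicator B \<omega> * ((\<Sum>j\<in>J. x j / t * indicator (A j) \<omega>) - \<mu>))\<^sup>2) =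
      (\<Sum>j\<in>J. \<Sum>j'\<in>J. x j * x j' / t\<^sup>2 * ?P (A j \<inter> A j')) - 2 * \<mu> * (\<Sum>j\<in>J. x j / t * ?P (A j)) + \<mu>\<^sup>2 * ?P B"
    using fin(1) A by (rule expectation_square_weighted_indicators)
  also have "\<dots> \<le> (\<mu>\<^sup>2 * (\<kappa> * ?P B) + \<Delta> * \<mu>) - 2 * \<mu> * (\<mu> * ?P B) + \<mu>\<^sup>2 * ?P B"
  proof (intro add_mono diff_mono mult_left_mono order_refl)
    show "(\<Sum>j\<in>J. \<Sum>j'\<in>J. x j * x j' / t\<^sup>2 * ?P (A j \<inter> A j')) \<le> \<mu>\<^sup>2 * (\<kappa> * ?P B) + \<Delta> * \<mu>"
      unfolding \<mu>_def using fin(2) x t \<kappa> pair diagonal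
      by (intro sum_weighted_joint_probabilities_le) (auto simp: mult_ac)
    have "x j / t * (t * ?P B) \<le> x j / t * ?P (A j)" if "j \<in> J" for j
      using single x t that by (intro mult_left_mono) auto
    then show "\<mu> * ?P B \<le> (\<Sum>j\<in>J. x j / t * ?P (A j))"
      unfolding \<mu>_def sum_distrib_right using t by (intro sum_mono) simp
    show "0 \<le> 2 * \<mu>" using x by (simp add: \<mu>_def sum_nonneg)
  qed simp
  also have "\<dots> = \<mu>\<^sup>2 * (\<kappa> - 1) * ?P B + \<Delta> * \<mu>" by (simp add: algebra_simps power2_eq_square)
  also have "\<dots> \<le> \<mu>\<^sup>2 * (\<kappa> - 1) + \<Delta> * \<mu>" using \<kappa> by (simp add: mult_left_le)
  finally show ?thesis .
qed

lemma expectation_sum_filter: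
  fixes g :: "'b \<Rightarrow> real"
  assumes "finite (set_pmf M)" "finite J"
  shows "measure_pmf.expectation M (\<lambda>\<omega>. \<Sum>j\<in>{j \<in> J. P j \<omega>}. g j) = (\<Sum>j\<in>J. g j * measure_pmf.prob M {\<omega>. P j \<omega>})"
proof -
  have "(\<Sum>j\<in>{j \<in> J. P j \<omega>}. g j) = (\<Sum>j\<in>J. g j * indicator {\<omega>. P j \<omega>} \<omega>)" for \<omega>
    using assms(2) by (intro sum.mono_neutral_cong_left) auto
  then show ?thesis by (simp add: integrable_measure_pmf_finite[OF assms(1)])
qed

section \<open>Near-perfect matchings in linear triple systems\<close>

definition weighted_degree :: "'b set set \<Rightarrow> ('b set \<Rightarrow> real) \<Rightarrow> 'b \<Rightarrow> real" where
  "weighted_degree H x e = (\<Sum>T\<in>{T \<in> H. e \<in> T}. x T)"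

lemma sum_weighted_degree_mult:
  assumes "finite X" "H \<subseteq> Pow X"
  shows "(\<Sum>e\<in>X. g e * weighted_degree H x e) = (\<Sum>T\<in>H. x T * (\<Sum>e\<in>T. g e))"
proof -
  have "finite H" using assms by (simp add: finite_subset)
  then have "(\<Sum>e\<in>X. g e * weighted_degree H x e) = (\<Sum>T\<in>H. \<Sum>e\<in>{e \<in> X. e \<in> T}. g e * x T)"
    unfolding weighted_degree_def sum_distrib_left using assms(1) by (intro sum.swap_restrict)
  also have "\<dots> = (\<Sum>T\<in>H. x T * (\<Sum>e\<in>T. g e))"
  proof (rule sum.cong[OF refl])
    fix T assume "T \<in> H"
    then have "{e \<in> X. e \<in> T} = T" using assms(2) by auto
    then show "(\<Sum>e\<in>{e \<in> X. e \<in> T}. g e * x T) = x T * (\<Sum>e\<in>T. g e)"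
      by (simp add: sum_distrib_left mult.commute)
  qed
  finally show ?thesis .
qed

definition linear_triples :: "'b set \<Rightarrow> 'b set set \<Rightarrow> bool" where
  "linear_triples X H \<longleftrightarrow> finite X \<and> (\<forall>T\<in>H. T \<subseteq> X \<and> card T = 3) \<and>
     (\<forall>T\<in>H. \<forall>T'\<in>H. \<forall>e f. e \<noteq> f \<longrightarrow> {e, f} \<subseteq> T \<inter> T' \<longrightarrow> T = T')"

lemma linear_triplesD:
  assumes "linear_triples X H"
  shows "finite X" "H \<subseteq> Pow X" "finite H" "T \<in> H \<Longrightarrow> card T = 3" "T \<in> H \<Longrightarrow> finite T"
proof -
  show X: "finite X" "H \<subseteq> Pow X" and "T \<in> H \<Longrightarrow> card T = 3"
    using assms by (auto simp: linear_triples_def)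
  from X show "finite H" by (simp add: finite_subset)
  from X show "T \<in> H \<Longrightarrow> finite T" by (auto intro: finite_subset)
qed

lemma linear_triples_subset:
  assumes "linear_triples X H" "Y \<subseteq> X" "H' \<subseteq> H" "H' \<subseteq> Pow Y"
  shows "linear_triples Y H'"
proof -
  have "finite Y" using assms(1,2) finite_subset by (auto simp: linear_triples_def)
  then show ?thesis using assms(1,3,4) by (auto simp: linear_triples_def subset_iff)
qed

lemma sum_weighted_degree:
  assumes "linear_triples X H"
  shows "(\<Sum>e\<in>X. weighted_degree H x e) = 3 * (\<Sum>T\<in>H. x T)"
  using sum_weighted_degree_mult[of X H "\<lambda>_. 1" x] linear_triplesD[OF assms]
  by (simp add: sum_distrib_right[symmetric] mult.commute)

definition fractional_matching :: "'b set \<Rightarrow> 'b set set \<Rightarrow> real \<Rightarrow> ('b set \<Rightarrow> real) \<Rightarrow> bool" where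
  "fractional_matching X H \<delta> x \<longleftrightarrow> linear_triples X H \<and> (\<forall>T\<in>H. 0 \<le> x T \<and> x T \<le> \<delta>) \<and>
     (\<forall>e\<in>X. weighted_degree H x e \<le> 1)"

lemma sum_fractional_matching_le:
  assumes "fractional_matching X H \<delta> x"
  shows "3 * (\<Sum>T\<in>H. x T) \<le> card X"
proof -
  have "(\<Sum>e\<in>X. weighted_degree H x e) \<le> (\<Sum>e\<in>X. 1)"
    using assms by (intro sum_mono) (auto simp: fractional_matching_def)
  then show ?thesis using assms sum_weighted_degree[of X H x] by (simp add: fractional_matching_def)
qed

text \<open>Scale down every triple by the relative excesses \<open>c e\<close> of its points.\<close>

lemma fractional_matching_truncate:
  assumes lin: "linear_triples X H" and x: "\<And>T. T \<in> H \<Longrightarrow> 0 \<le> x T \<and> x T \<le> \<delta>"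
  obtains y where "fractional_matching X H \<delta> y"
    "(\<Sum>T\<in>H. x T) \<le> (\<Sum>T\<in>H. y T) + (\<Sum>e\<in>X. max 0 (weighted_degree H x e - 1))"
proof
  note H = linear_triplesD[OF lin]
  define c where "c e = (if weighted_degree H x e > 1 then 1 - 1 / weighted_degree H x e else 0)" for e
  define y where "y T = x T * (\<Prod>e\<in>T. 1 - c e)" for T
  have c: "0 \<le> c e" "c e \<le> 1" for e by (auto simp: c_def field_simps)
  have c_degree: "c e * weighted_degree H x e = max 0 (weighted_degree H x e - 1)" for e
    by (auto simp: c_def field_simps)
  have prod: "0 \<le> (\<Prod>e\<in>T. 1 - c e)" "(\<Prod>e\<in>T. 1 - c e) \<le> 1" for T
    using c by (auto intro!: prod_nonneg prod_le_1)
  have "weighted_degree H y e \<le> 1" for e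
  proof -
    have "(\<Prod>e\<in>T. 1 - c e) \<le> 1 - c e" if "T \<in> H" "e \<in> T" for T
    proof -
      have "(\<Prod>e\<in>T. 1 - c e) = (1 - c e) * (\<Prod>e\<in>T - {e}. 1 - c e)"
        using that H(5) by (intro prod.remove) auto
      also have "\<dots> \<le> (1 - c e) * 1" using c prod(2) by (intro mult_left_mono) auto
      finally show ?thesis by simp
    qed
    then have "weighted_degree H y e \<le> (\<Sum>T\<in>{T \<in> H. e \<in> T}. x T * (1 - c e))"
      unfolding weighted_degree_def y_def using x by (intro sum_mono mult_left_mono) auto
    also have "\<dots> = weighted_degree H x e - c e * weighted_degree H x e"
      unfolding weighted_degree_def sum_distrib_right[symmetric] by (simp add: algebra_simps)
    finally show ?thesis unfolding c_degree by auto
  qed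
  moreover have "0 \<le> y T \<and> y T \<le> \<delta>" if "T \<in> H" for T
    using x[OF that] prod[of T] mult_left_le[of "\<Prod>e\<in>T. 1 - c e" "x T"] by (auto simp: y_def)
  ultimately show "fractional_matching X H \<delta> y" using lin by (simp add: fractional_matching_def)
  have "(\<Sum>T\<in>H. x T) - (\<Sum>e\<in>X. max 0 (weighted_degree H x e - 1)) = (\<Sum>T\<in>H. x T * (1 - (\<Sum>e\<in>T. c e)))"
    unfolding c_degree[symmetric] sum_weighted_degree_mult[OF H(1,2)]
    by (simp add: sum_subtractf right_diff_distrib)
  also have "\<dots> \<le> (\<Sum>T\<in>H. y T)"
    unfolding y_def using x c by (intro sum_mono mult_left_mono Weierstrass_prod_ineq) auto
  finally show "(\<Sum>T\<in>H. x T) \<le> (\<Sum>T\<in>H. y T) + (\<Sum>e\<in>X. max 0 (weighted_degree H x e - 1))" by simp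
qed

text \<open>
  One bite of the semi-random greedy algorithm: select each triple with probability \<open>\<theta> x T\<close>, keep the
  selected triples that meet no other selected one, and continue on the points that survive, which is
  where no selected triple passes. A coin \<open>Inl T\<close> selects the triple \<open>T\<close>; the coin \<open>Inr e\<close> deletes \<open>e\<close>,
  with the probability that makes every point survive with probability exactly \<open>s\<close>.
\<close>

locale random_bite =
  fixes X :: "'b set" and H :: "'b set set" and x :: "'b set \<Rightarrow> real" and \<delta> \<theta> :: real
  assumes matching: "fractional_matching X H \<delta> x"
    and \<theta>: "0 < \<theta>" "\<theta> \<le> 1 / 2" and \<delta>: "0 < \<delta>" "\<delta> \<le> 1"
begin

definition s :: real where "s = 1 - \<theta>"
definition r :: real where "r = 1 - \<theta> * \<delta>"

definition unselected :: "'b \<Rightarrow> real" where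
  "unselected e = (\<Prod>T\<in>{T \<in> H. e \<in> T}. 1 - \<theta> * x T)"

definition q :: "'b set + 'b \<Rightarrow> real" where
  "q i = (case i of Inl T \<Rightarrow> \<theta> * x T | Inr e \<Rightarrow> 1 - s / unselected e)"

definition coins :: "('b set + 'b) set" where "coins = Inl ` H \<union> Inr ` X"

definition bite :: "('b set + 'b \<Rightarrow> bool) pmf" where
  "bite = Pi_pmf coins False (\<lambda>i. bernoulli_pmf (q i))"

definition coins_at :: "'b \<Rightarrow> ('b set + 'b) set" where
  "coins_at e = Inl ` {T \<in> H. e \<in> T} \<union> {Inr e}"

definition surviving :: "('b set + 'b \<Rightarrow> bool) \<Rightarrow> 'b set" where
  "surviving c = {e \<in> X. \<forall>i\<in>coins_at e. \<not> c i}"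

definition remaining :: "('b set + 'b \<Rightarrow> bool) \<Rightarrow> 'b set set" where
  "remaining c = {T \<in> H. T \<subseteq> surviving c}"

definition isolated :: "('b set + 'b \<Rightarrow> bool) \<Rightarrow> 'b set set" where
  "isolated c = {T \<in> H. c (Inl T) \<and> (\<forall>T'\<in>H. c (Inl T') \<longrightarrow> T' \<noteq> T \<longrightarrow> T' \<inter> T = {})}"

definition survival :: "'b set \<Rightarrow> real" where
  "survival F = measure_pmf.prob bite {c. F \<subseteq> surviving c}"

lemma linear: "linear_triples X H"
  and x_nonneg: "T \<in> H \<Longrightarrow> 0 \<le> x T" and x_le: "T \<in> H \<Longrightarrow> x T \<le> \<delta>"
  and degree_le: "e \<in> X \<Longrightarrow> weighted_degree H x e \<le> 1"
  using matching by (auto simp: fractional_matching_def)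

lemmas H = linear_triplesD[OF linear]

lemma finite_coins: "finite coins"
  using H(1,3) by (simp add: coins_def)

lemma s_bounds: "1 / 2 \<le> s" "s < 1" "0 < s"
  using \<theta> by (auto simp: s_def)

lemma r_bounds: "0 < r" "r < 1"
proof -
  have "\<theta> * \<delta> \<le> 1 / 2 * 1" using \<theta> \<delta> by (intro mult_mono) auto
  then show "0 < r" by (simp add: r_def)
  show "r < 1" using \<theta> \<delta> by (simp add: r_def)
qed

lemma selection_bounds:
  assumes "T \<in> H"
  shows "0 \<le> \<theta> * x T" "\<theta> * x T \<le> 1 - r" "\<theta> * x T \<le> 1"
proof -
  show "0 \<le> \<theta> * x T" using x_nonneg[OF assms] \<theta> by simp
  show "\<theta> * x T \<le> 1 - r" using x_le[OF assms] \<theta> by (simp add: r_def)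
  then show "\<theta> * x T \<le> 1" using r_bounds by simp
qed

lemma unselected_bounds:
  assumes "e \<in> X"
  shows "s \<le> unselected e" "unselected e \<le> 1"
proof -
  have "1 - \<theta> * weighted_degree H x e \<le> unselected e"
    unfolding unselected_def weighted_degree_def sum_distrib_left
    using selection_bounds by (intro Weierstrass_prod_ineq) auto
  moreover have "\<theta> * weighted_degree H x e \<le> \<theta> * 1"
    using degree_le[OF assms] \<theta> by (intro mult_left_mono) auto
  ultimately show "s \<le> unselected e" by (simp add: s_def)
  show "unselected e \<le> 1" unfolding unselected_def using selection_bounds by (intro prod_le_1) auto
qed

lemma q_bounds: "i \<in> coins \<Longrightarrow> 0 \<le> q i \<and> q i \<le> 1"
  using selection_bounds unselected_bounds s_bounds by (force simp: coins_def q_def field_simps)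

lemma finite_bite: "finite (set_pmf bite)"
proof (rule finite_subset)
  show "set_pmf bite \<subseteq> PiE_dflt coins False (\<lambda>_. UNIV)"
    unfolding bite_def using set_Pi_pmf_subset'[OF finite_coins]
    by (rule order_trans) (auto simp: PiE_dflt_def)
qed (simp add: finite_PiE_dflt finite_coins)

lemma prob_coins:
  assumes "A \<subseteq> coins" "B \<subseteq> coins" "A \<inter> B = {}"
  shows "measure_pmf.prob bite {c. (\<forall>i\<in>A. c i) \<and> (\<forall>i\<in>B. \<not> c i)} = (\<Prod>i\<in>A. q i) * (\<Prod>i\<in>B. 1 - q i)"
proof -
  let ?V = "\<lambda>i. if i \<in> A then {True} else if i \<in> B then {False} else UNIV"
  let ?p = "\<lambda>i. measure_pmf.prob (bernoulli_pmf (q i)) (?V i)"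
  have q: "0 \<le> q i" "q i \<le> 1" if "i \<in> A \<union> B" for i using q_bounds that assms by auto
  have "{c. (\<forall>i\<in>A. c i) \<and> (\<forall>i\<in>B. \<not> c i)} = Pi coins ?V"
    using assms by (auto simp: Pi_def split: if_splits)
  then have "measure_pmf.prob bite {c. (\<forall>i\<in>A. c i) \<and> (\<forall>i\<in>B. \<not> c i)} = (\<Prod>i\<in>coins. ?p i)"
    using measure_Pi_pmf_Pi[OF finite_coins] by (simp add: bite_def)
  also have "\<dots> = (\<Prod>i\<in>A \<union> B. ?p i)"
    using assms finite_coins by (intro prod.mono_neutral_right) auto
  also have "\<dots> = (\<Prod>i\<in>A. ?p i) * (\<Prod>i\<in>B. ?p i)"
    using assms finite_coins by (intro prod.union_disjoint) (auto intro: finite_subset)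
  also have "(\<Prod>i\<in>A. ?p i) = (\<Prod>i\<in>A. q i)"
    using q by (intro prod.cong) (auto simp: measure_pmf_single)
  also have "(\<Prod>i\<in>B. ?p i) = (\<Prod>i\<in>B. 1 - q i)"
    using q assms(3) by (intro prod.cong) (auto simp: measure_pmf_single)
  finally show ?thesis .
qed

lemma prob_selected:
  assumes "A \<subseteq> H"
  shows "measure_pmf.prob bite {c. \<forall>T\<in>A. c (Inl T)} = (\<Prod>T\<in>A. \<theta> * x T)"
  using prob_coins[of "Inl ` A" "{}"] assms by (auto simp: coins_def prod.reindex q_def)

lemma coins_at_subset: "e \<in> X \<Longrightarrow> coins_at e \<subseteq> coins" "finite (coins_at e)"
  using H(3) by (auto simp: coins_at_def coins_def)

lemma survival_eq_prod:
  assumes "F \<subseteq> X"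
  shows "survival F = (\<Prod>i\<in>(\<Union>e\<in>F. coins_at e). 1 - q i)"
proof -
  have "(F \<subseteq> surviving c) = (\<forall>i\<in>(\<Union>e\<in>F. coins_at e). \<not> c i)" for c
    using assms by (auto simp: surviving_def)
  moreover have "(\<Union>e\<in>F. coins_at e) \<subseteq> coins" using assms coins_at_subset(1) by blast
  ultimately show ?thesis using prob_coins[of "{}" "\<Union>e\<in>F. coins_at e"] by (simp add: survival_def)
qed

lemma prod_coins_at:
  assumes "e \<in> X"
  shows "(\<Prod>i\<in>coins_at e. 1 - q i) = s"
proof -
  have "(\<Prod>i\<in>coins_at e. 1 - q i) = (1 - q (Inr e)) * (\<Prod>i\<in>Inl ` {T \<in> H. e \<in> T}. 1 - q i)"
    using H(3) by (simp add: coins_at_def) (subst prod.insert, auto)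
  also have "(\<Prod>i\<in>Inl ` {T \<in> H. e \<in> T}. 1 - q i) = unselected e"
    by (simp add: prod.reindex unselected_def q_def)
  finally show ?thesis using unselected_bounds[OF assms] s_bounds by (simp add: q_def)
qed

lemma survival_singleton: "e \<in> X \<Longrightarrow> survival {e} = s"
  by (simp add: survival_eq_prod prod_coins_at)

lemma card_shared_coins_le:
  assumes "finite F" "f \<notin> F"
  shows "coins_at f \<inter> (\<Union>e\<in>F. coins_at e) \<subseteq> Inl ` H" "card (coins_at f \<inter> (\<Union>e\<in>F. coins_at e)) \<le> card F"
proof -
  let ?C = "\<Union>g\<in>F. {T \<in> H. f \<in> T \<and> g \<in> T}"
  have shared: "coins_at f \<inter> (\<Union>e\<in>F. coins_at e) \<subseteq> Inl ` ?C" using assms(2) by (auto simp: coins_at_def)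
  then show "coins_at f \<inter> (\<Union>e\<in>F. coins_at e) \<subseteq> Inl ` H" by blast
  have "card {T \<in> H. f \<in> T \<and> g \<in> T} \<le> 1" if "g \<in> F" for g
  proof -
    have "f \<noteq> g" using assms(2) that by auto
    then have "\<forall>T\<in>{T \<in> H. f \<in> T \<and> g \<in> T}. \<forall>T'\<in>{T \<in> H. f \<in> T \<and> g \<in> T}. T = T'"
      using linear unfolding linear_triples_def by blast
    then show ?thesis using H(3) by (simp add: card_le_Suc0_iff_eq)
  qed
  then have "card ?C \<le> (\<Sum>g\<in>F. 1)"
    by (intro order_trans[OF card_UN_le[OF assms(1)]] sum_mono)
  moreover have "card (coins_at f \<inter> (\<Union>e\<in>F. coins_at e)) \<le> card (Inl ` ?C :: ('b set + 'b) set)"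
    using shared H(3) assms(1) by (intro card_mono) auto
  ultimately show "card (coins_at f \<inter> (\<Union>e\<in>F. coins_at e)) \<le> card F"
    by (simp add: card_image)
qed

lemma survival_insert:
  assumes F: "finite F" "F \<subseteq> X" and f: "f \<in> X" "f \<notin> F"
  obtains P where "survival (insert f F) = survival F * P" "s \<le> P" "P * r ^ card F \<le> s"
proof
  let ?U = "\<Union>e\<in>F. coins_at e"
  let ?P = "\<Prod>i\<in>coins_at f - ?U. 1 - q i" and ?Q = "\<Prod>i\<in>coins_at f \<inter> ?U. 1 - q i"
  have "survival (insert f F) = (\<Prod>i\<in>?U \<union> (coins_at f - ?U). 1 - q i)"
    using F(2) f(1) by (simp add: survival_eq_prod Un_commute)
  also have "\<dots> = survival F * ?P"
    unfolding survival_eq_prod[OF F(2)] using F(1) coins_at_subset(2) by (intro prod.union_disjoint) auto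
  finally show "survival (insert f F) = survival F * ?P" .
  have "?P * ?Q = (\<Prod>i\<in>coins_at f. 1 - q i)"
    using coins_at_subset(2)[of f]
    by (simp add: Diff_Int_distrib2 prod.Int_Diff[of "coins_at f" _ ?U] mult.commute)
  then have PQ: "?P * ?Q = s" by (simp add: prod_coins_at f(1))
  have unit: "0 \<le> 1 - q i" "1 - q i \<le> 1" if "i \<in> coins_at f" for i
    using q_bounds[of i] coins_at_subset(1)[OF f(1)] that by auto
  have P: "0 \<le> ?P" using unit by (intro prod_nonneg) auto
  have "?Q \<le> 1" using unit by (intro prod_le_1) auto
  then show "s \<le> ?P" using mult_left_mono[OF _ P] PQ by fastforce
  have "r ^ card F \<le> r ^ card (coins_at f \<inter> ?U)"
    using card_shared_coins_le(2)[OF F(1) f(2)] r_bounds by (intro power_decreasing) auto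
  also have "\<dots> = (\<Prod>i\<in>coins_at f \<inter> ?U. r)" by simp
  also have "\<dots> \<le> ?Q"
  proof (intro prod_mono conjI)
    fix i assume "i \<in> coins_at f \<inter> ?U"
    then obtain T where "i = Inl T" "T \<in> H" using card_shared_coins_le(1)[OF F(1) f(2)] by blast
    then show "r \<le> 1 - q i" using selection_bounds[of T] by (simp add: q_def)
  qed (use r_bounds in auto)
  finally show "?P * r ^ card F \<le> s" using mult_left_mono[OF _ P] PQ by metis
qed

lemma survival_bounds:
  assumes "finite F" "F \<subseteq> X"
  shows "s ^ card F \<le> survival F \<and> survival F * r ^ (card F)\<^sup>2 \<le> s ^ card F"
  using assms
proof (induction F rule: finite_induct)
  case empty
  show ?case by (simp add: survival_eq_prod)
next
  case (insert f F)
  then have IH: "s ^ card F \<le> survival F" "survival F * r ^ (card F)\<^sup>2 \<le> s ^ card F" by auto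
  obtain P where P: "survival (insert f F) = survival F * P" "s \<le> P" "P * r ^ card F \<le> s"
    using survival_insert[of F f] insert by auto
  have nonneg: "0 \<le> survival F" by (simp add: survival_def)
  have "s ^ card F * s \<le> survival F * P" using IH P s_bounds nonneg by (intro mult_mono) auto
  moreover have "survival F * P * r ^ (Suc (card F))\<^sup>2 \<le> s ^ card F * s"
  proof -
    have "r ^ (Suc (card F))\<^sup>2 \<le> r ^ (card F)\<^sup>2 * r ^ card F"
      unfolding power_add[symmetric] using r_bounds by (intro power_decreasing) (auto simp: power2_eq_square)
    then have "survival F * P * r ^ (Suc (card F))\<^sup>2 \<le> survival F * P * (r ^ (card F)\<^sup>2 * r ^ card F)"
      using nonneg P s_bounds by (intro mult_left_mono) auto
    also have "\<dots> = (survival F * r ^ (card F)\<^sup>2) * (P * r ^ card F)" by simp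
    also have "\<dots> \<le> s ^ card F * s" using IH P s_bounds r_bounds nonneg by (intro mult_mono) auto
    finally show ?thesis .
  qed
  ultimately show ?case using insert.hyps P(1) by (simp add: mult.commute)
qed

lemma survival_triple_ge: "T \<in> H \<Longrightarrow> s ^ 3 \<le> survival T"
  using survival_bounds[of T] H(2,4,5) by (metis PowD subsetD)

lemma survival_two_triples_le:
  assumes T: "T \<in> H" "T' \<in> H" "T \<noteq> T'" and e: "e \<in> T" "e \<in> T'"
  shows "survival (T \<union> T') \<le> s ^ 5 / r ^ 25"
proof -
  have "T \<inter> T' = {e}" using T e linear unfolding linear_triples_def by blast
  then have "card (T \<union> T') = 5"
    using card_Un_Int[of T T'] H(4,5) T by simp
  then have "survival (T \<union> T') * r ^ 25 \<le> s ^ 5"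
    using survival_bounds[of "T \<union> T'"] H(2,5) T by auto
  then show ?thesis using r_bounds by (simp add: field_simps)
qed

lemma expectation_card_surviving:
  "measure_pmf.expectation bite (\<lambda>c. real (card (surviving c))) = s * card X"
proof -
  have "measure_pmf.expectation bite (\<lambda>c. real (card (surviving c))) =
      measure_pmf.expectation bite (\<lambda>c. \<Sum>e\<in>{e \<in> X. {e} \<subseteq> surviving c}. 1)"
  proof -
    have "{e \<in> X. {e} \<subseteq> surviving c} = surviving c" for c by (auto simp: surviving_def)
    then show ?thesis by simp
  qed
  also have "\<dots> = (\<Sum>e\<in>X. survival {e})"
    using expectation_sum_filter[OF finite_bite H(1), where P = "\<lambda>e c. {e} \<subseteq> surviving c" and g = "\<lambda>_. 1"]
    by (simp add: survival_def)
  finally show ?thesis by (simp add: survival_singleton)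
qed

lemma expectation_remaining_ge:
  "s * (\<Sum>T\<in>H. x T) \<le> measure_pmf.expectation bite (\<lambda>c. \<Sum>T\<in>remaining c. x T / s\<^sup>2)"
proof -
  have "s * x T \<le> x T / s\<^sup>2 * survival T" if "T \<in> H" for T
  proof -
    have "s * x T = x T / s\<^sup>2 * s ^ 3" using s_bounds by (simp add: eval_nat_numeral)
    also have "\<dots> \<le> x T / s\<^sup>2 * survival T"
      using survival_triple_ge x_nonneg that by (intro mult_left_mono) auto
    finally show ?thesis .
  qed
  then show ?thesis
    unfolding remaining_def expectation_sum_filter[OF finite_bite H(3)] sum_distrib_left survival_def
    by (rule sum_mono)
qed

lemma sum_conflicting_le:
  assumes T: "T \<in> H"
  shows "(\<Sum>T'\<in>{T' \<in> H. T' \<noteq> T \<and> T' \<inter> T \<noteq> {}}. x T') \<le> 3"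
proof -
  let ?C = "{T' \<in> H. T' \<noteq> T \<and> T' \<inter> T \<noteq> {}}"
  have "x T' \<le> (\<Sum>e\<in>{e \<in> T. e \<in> T'}. x T')" if "T' \<in> ?C" for T'
    using that x_nonneg[of T'] member_le_sum[of _ "{e \<in> T. e \<in> T'}" "\<lambda>_. x T'"] H(5)[OF T] by auto
  then have "(\<Sum>T'\<in>?C. x T') \<le> (\<Sum>T'\<in>?C. \<Sum>e\<in>{e \<in> T. e \<in> T'}. x T')"
    by (rule sum_mono)
  also have "\<dots> \<le> (\<Sum>T'\<in>H. \<Sum>e\<in>{e \<in> T. e \<in> T'}. x T')"
    using x_nonneg H(3) by (intro sum_mono2) (auto intro!: sum_nonneg)
  also have "\<dots> = (\<Sum>e\<in>T. weighted_degree H x e)"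
    unfolding weighted_degree_def using H(3) H(5)[OF T] by (intro sum.swap_restrict)
  also have "\<dots> \<le> (\<Sum>e\<in>T. 1)" using degree_le H(2) T by (intro sum_mono) auto
  finally show ?thesis using H(4)[OF T] by simp
qed

lemma prob_isolated_ge:
  assumes T: "T \<in> H"
  shows "\<theta> * x T - 3 * \<theta>\<^sup>2 * x T \<le> measure_pmf.prob bite {c. T \<in> isolated c}"
proof -
  let ?P = "measure_pmf.prob bite"
  define conf where "conf = {T' \<in> H. T' \<noteq> T \<and> T' \<inter> T \<noteq> {}}"
  define selected where "selected A = {c. \<forall>T\<in>A. c (Inl T :: 'b set + 'b)}" for A
  have conf: "finite conf" using H(3) by (simp add: conf_def)
  have "?P (selected {T}) \<le> ?P ({c. T \<in> isolated c} \<union> (\<Union>T'\<in>conf. selected {T, T'}))"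
    using T by (intro measure_pmf.finite_measure_mono) (auto simp: selected_def isolated_def conf_def)
  also have "\<dots> \<le> ?P {c. T \<in> isolated c} + (\<Sum>T'\<in>conf. ?P (selected {T, T'}))"
    using conf by (intro order_trans[OF measure_Un_le] add_left_mono measure_UNION_le) auto
  also have "(\<Sum>T'\<in>conf. ?P (selected {T, T'})) = \<theta>\<^sup>2 * x T * (\<Sum>T'\<in>conf. x T')"
  proof -
    have "?P (selected {T, T'}) = \<theta>\<^sup>2 * x T * x T'" if "T' \<in> conf" for T'
      using prob_selected[of "{T, T'}"] that T
      by (cases "T = T'") (simp_all add: conf_def selected_def power2_eq_square)
    then show ?thesis by (simp add: sum_distrib_left)
  qed
  also have "\<dots> \<le> \<theta>\<^sup>2 * x T * 3"
    using sum_conflicting_le[OF T] x_nonneg[OF T] by (intro mult_left_mono) (auto simp: conf_def)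
  finally have "?P (selected {T}) \<le> ?P {c. T \<in> isolated c} + \<theta>\<^sup>2 * x T * 3" by simp
  moreover have "?P (selected {T}) = \<theta> * x T" using prob_selected[of "{T}"] T by (simp add: selected_def)
  ultimately show ?thesis by simp
qed

lemma expectation_card_isolated_ge:
  "\<theta> * (\<Sum>T\<in>H. x T) - \<theta>\<^sup>2 * card X \<le> measure_pmf.expectation bite (\<lambda>c. real (card (isolated c)))"
proof -
  have "\<theta>\<^sup>2 * (3 * (\<Sum>T\<in>H. x T)) \<le> \<theta>\<^sup>2 * card X"
    using sum_fractional_matching_le[OF matching] by (intro mult_left_mono) auto
  then have "\<theta> * (\<Sum>T\<in>H. x T) - \<theta>\<^sup>2 * card X \<le> (\<Sum>T\<in>H. \<theta> * x T - 3 * \<theta>\<^sup>2 * x T)"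
    by (simp only: sum_subtractf sum_distrib_left[symmetric])
  also have "\<dots> \<le> (\<Sum>T\<in>H. measure_pmf.prob bite {c. T \<in> isolated c})"
    by (intro sum_mono prob_isolated_ge)
  also have "\<dots> = measure_pmf.expectation bite (\<lambda>c. real (card (isolated c)))"
  proof -
    have "{T \<in> H. T \<in> isolated c} = isolated c" for c by (auto simp: isolated_def)
    then show ?thesis
      using expectation_sum_filter[OF finite_bite H(3), where P = "\<lambda>T c. T \<in> isolated c" and g = "\<lambda>_. 1"] by simp
  qed
  finally show ?thesis .
qed

definition degree_change :: "('b set + 'b \<Rightarrow> bool) \<Rightarrow> 'b \<Rightarrow> real" where
  "degree_change c e = weighted_degree (remaining c) (\<lambda>T. x T / s\<^sup>2) e - weighted_degree H x e"

lemma degree_change_eq: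
  "degree_change c e = (\<Sum>T\<in>{T \<in> H. e \<in> T}. x T / s\<^sup>2 * indicator {c. T \<subseteq> surviving c} c) - weighted_degree H x e"
proof -
  have "{T \<in> remaining c. e \<in> T} = {T \<in> {T \<in> H. e \<in> T}. T \<subseteq> surviving c}" by (auto simp: remaining_def)
  moreover have "(\<Sum>T\<in>{T \<in> {T \<in> H. e \<in> T}. T \<subseteq> surviving c}. x T / s\<^sup>2) =
      (\<Sum>T\<in>{T \<in> H. e \<in> T}. x T / s\<^sup>2 * indicator {c. T \<subseteq> surviving c} c)"
    using H(3) by (intro sum.mono_neutral_cong_left) auto
  ultimately show ?thesis by (simp add: degree_change_def weighted_degree_def)
qed

lemma expectation_degree_change_square_le:
  assumes e: "e \<in> X"
  shows "measure_pmf.expectation bite (\<lambda>c. (indicator {c. e \<in> surviving c} c * degree_change c e)\<^sup>2)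
    \<le> 1 / r ^ 25 - 1 + 16 * \<delta>"
proof -
  define J where "J = {T \<in> H. e \<in> T}"
  define w where "w = (\<Sum>T\<in>J. x T)"
  have J: "finite J" using H(3) by (simp add: J_def)
  have w: "0 \<le> w" "w \<le> 1"
    using degree_le[OF e] x_nonneg by (auto simp: w_def J_def weighted_degree_def intro!: sum_nonneg)
  have "measure_pmf.expectation bite (\<lambda>c. (indicator {c. e \<in> surviving c} c * degree_change c e)\<^sup>2)
      \<le> w\<^sup>2 * (1 / r ^ 25 - 1) + 16 * \<delta> * w"
    unfolding degree_change_eq weighted_degree_def w_def J_def[symmetric]
  proof (rule second_moment_weighted_indicators[OF finite_bite J])
    have prob_e: "measure_pmf.prob bite {c. e \<in> surviving c} = s"
      using survival_singleton[OF e] by (simp add: survival_def)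
    show "1 \<le> 1 / r ^ 25" using r_bounds by (simp add: field_simps power_le_one)
    fix T assume T: "T \<in> J"
    then show "{c. T \<subseteq> surviving c} \<subseteq> {c. e \<in> surviving c}" "0 \<le> x T" using x_nonneg by (auto simp: J_def)
    show "s\<^sup>2 * measure_pmf.prob bite {c. e \<in> surviving c} \<le> measure_pmf.prob bite {c. T \<subseteq> surviving c}"
      using survival_triple_ge[of T] T by (simp add: prob_e J_def survival_def eval_nat_numeral mult_ac)
    have "(1 / 2) ^ 4 \<le> s ^ 4" using s_bounds by (intro power_mono) auto
    then have "1 \<le> 16 * s ^ 4" by (simp add: power_one_over)
    then have "x T * 1 \<le> \<delta> * (16 * s ^ 4)" using x_le T x_nonneg \<delta> by (intro mult_mono) (auto simp: J_def)
    then show "x T * measure_pmf.prob bite {c. T \<subseteq> surviving c} \<le> 16 * \<delta> * (s\<^sup>2)\<^sup>2"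
      using mult_left_mono[OF measure_pmf.prob_le_1[of bite "{c. T \<subseteq> surviving c}"], of "x T"] x_nonneg T
      by (simp add: J_def mult_ac)
    fix T' assume T': "T' \<in> J" "T \<noteq> T'"
    have "{c. T \<subseteq> surviving c} \<inter> {c. T' \<subseteq> surviving c} = {c. T \<union> T' \<subseteq> surviving c}" by auto
    then show "measure_pmf.prob bite ({c. T \<subseteq> surviving c} \<inter> {c. T' \<subseteq> surviving c})
        \<le> 1 / r ^ 25 * (s\<^sup>2)\<^sup>2 * measure_pmf.prob bite {c. e \<in> surviving c}"
      using survival_two_triples_le[of T T' e] T T'
      by (simp add: prob_e J_def survival_def eval_nat_numeral mult_ac)
  qed (use s_bounds in auto)
  also have "\<dots> \<le> 1 * (1 / r ^ 25 - 1) + 16 * \<delta> * 1"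
    using w \<delta> r_bounds by (intro add_mono mult_right_mono mult_left_mono) (auto simp: power_le_one field_simps)
  finally show ?thesis by simp
qed

lemma expectation_degree_change_le:
  assumes \<gamma>: "1 / r ^ 25 - 1 + 16 * \<delta> \<le> \<gamma>\<^sup>2" "\<gamma> \<ge> 0"
  shows "measure_pmf.expectation bite (\<lambda>c. \<Sum>e\<in>surviving c. \<bar>degree_change c e\<bar>) \<le> \<gamma> * card X"
proof -
  have "(\<Sum>e\<in>surviving c. \<bar>degree_change c e\<bar>) = (\<Sum>e\<in>X. \<bar>indicator {c. e \<in> surviving c} c * degree_change c e\<bar>)"
    for c
    using H(1) by (intro sum.mono_neutral_cong_left) (auto simp: surviving_def)
  then have "measure_pmf.expectation bite (\<lambda>c. \<Sum>e\<in>surviving c. \<bar>degree_change c e\<bar>) =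
      (\<Sum>e\<in>X. measure_pmf.expectation bite (\<lambda>c. \<bar>indicator {c. e \<in> surviving c} c * degree_change c e\<bar>))"
    by (simp only: Bochner_Integration.integral_sum integrable_measure_pmf_finite[OF finite_bite])
  also have "\<dots> \<le> (\<Sum>e\<in>X. \<gamma>)"
    using order_trans[OF expectation_degree_change_square_le \<gamma>(1)] \<gamma>(2)
    by (intro sum_mono pmf_expectation_abs_le finite_bite)
  finally show ?thesis by (simp add: mult.commute)
qed

lemma exists_bite:
  fixes a :: real
  assumes \<gamma>: "1 / r ^ 25 - 1 + 16 * \<delta> \<le> \<gamma>\<^sup>2" "\<gamma> \<ge> 0" and a: "a \<ge> 0"
  obtains c where "(\<Sum>T\<in>H. x T) + (\<Sum>e\<in>surviving c. \<bar>degree_change c e\<bar>) + a * card (surviving c)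
    \<le> card (isolated c) + (\<Sum>T\<in>remaining c. x T / s\<^sup>2) + (\<theta>\<^sup>2 + s * a + \<gamma>) * card X"
proof -
  let ?E = "measure_pmf.expectation bite"
  define f where "f c = (\<Sum>e\<in>surviving c. \<bar>degree_change c e\<bar>) + a * real (card (surviving c))
      - real (card (isolated c)) - (\<Sum>T\<in>remaining c. x T / s\<^sup>2)" for c
  have "?E f = ?E (\<lambda>c. \<Sum>e\<in>surviving c. \<bar>degree_change c e\<bar>) + a * ?E (\<lambda>c. real (card (surviving c)))
      - ?E (\<lambda>c. real (card (isolated c))) - ?E (\<lambda>c. \<Sum>T\<in>remaining c. x T / s\<^sup>2)"
    unfolding f_def
    by (simp only: Bochner_Integration.integral_add Bochner_Integration.integral_diff
        integral_mult_right_zero integrable_measure_pmf_finite[OF finite_bite])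
  also have "\<dots> \<le> \<gamma> * card X + a * (s * card X) - (\<theta> * (\<Sum>T\<in>H. x T) - \<theta>\<^sup>2 * card X) - s * (\<Sum>T\<in>H. x T)"
    using expectation_degree_change_le[OF \<gamma>] expectation_card_isolated_ge expectation_remaining_ge a
    by (simp add: expectation_card_surviving)
  also have "\<dots> = (\<theta>\<^sup>2 + s * a + \<gamma>) * card X - (\<Sum>T\<in>H. x T)" by (simp add: s_def algebra_simps)
  finally obtain c where "f c \<le> (\<theta>\<^sup>2 + s * a + \<gamma>) * card X - (\<Sum>T\<in>H. x T)"
    using pmf_expectation_attained[OF finite_bite] by blast
  then show ?thesis using that[of c] by (simp add: f_def)
qed

lemma disjoint_isolated_remaining:
  assumes "M \<subseteq> remaining c" "disjoint M"
  shows "disjoint (isolated c \<union> M)" "isolated c \<inter> M = {}"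
proof -
  have inter: "T \<inter> T' = {}" if "T \<in> isolated c" "T' \<in> remaining c" for T T'
    using that by (auto simp: isolated_def remaining_def surviving_def coins_at_def)
  have "T \<inter> T' = {}" if "T \<in> isolated c" "T' \<in> isolated c" "T \<noteq> T'" for T T'
    using that by (auto simp: isolated_def)
  then show "disjoint (isolated c \<union> M)"
    using assms inter unfolding disjoint_def by (metis Un_iff inf_commute subsetD)
  have "T \<noteq> {}" if "T \<in> isolated c" for T using H(4)[of T] that by (auto simp: isolated_def)
  then show "isolated c \<inter> M = {}" using inter assms(1) by blast
qed

lemma fractional_matching_remaining:
  assumes "4 * \<delta> \<le> \<delta>'"
  obtains y where "fractional_matching (surviving c) (remaining c) \<delta>' y"
    "(\<Sum>T\<in>remaining c. x T / s\<^sup>2) \<le> (\<Sum>T\<in>remaining c. y T) + (\<Sum>e\<in>surviving c. \<bar>degree_change c e\<bar>)"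
proof -
  have sub: "surviving c \<subseteq> X" "remaining c \<subseteq> H" by (auto simp: surviving_def remaining_def)
  have "0 \<le> x T / s\<^sup>2 \<and> x T / s\<^sup>2 \<le> \<delta>'" if "T \<in> remaining c" for T
  proof -
    have "x T / s\<^sup>2 \<le> \<delta> / (1 / 2)\<^sup>2"
      using that sub x_le \<delta> s_bounds by (intro frac_le power_mono) auto
    also have "\<dots> \<le> \<delta>'" using assms by (simp add: power2_eq_square)
    finally show ?thesis using x_nonneg sub that by auto
  qed
  moreover have "linear_triples (surviving c) (remaining c)"
    using linear sub by (rule linear_triples_subset) (auto simp: remaining_def)
  ultimately obtain y where y: "fractional_matching (surviving c) (remaining c) \<delta>' y"
    "(\<Sum>T\<in>remaining c. x T / s\<^sup>2) \<le> (\<Sum>T\<in>remaining c. y T)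
      + (\<Sum>e\<in>surviving c. max 0 (weighted_degree (remaining c) (\<lambda>T. x T / s\<^sup>2) e - 1))"
    using fractional_matching_truncate[of "surviving c" "remaining c" "\<lambda>T. x T / s\<^sup>2" \<delta>'] by blast
  moreover have "(\<Sum>e\<in>surviving c. max 0 (weighted_degree (remaining c) (\<lambda>T. x T / s\<^sup>2) e - 1))
      \<le> (\<Sum>e\<in>surviving c. \<bar>degree_change c e\<bar>)"
    using degree_le sub(1) by (intro sum_mono) (fastforce simp: degree_change_def)
  ultimately show thesis using that[of y] by linarith
qed

lemma exists_matching:
  assumes \<gamma>: "1 / r ^ 25 - 1 + 16 * \<delta> \<le> \<gamma>\<^sup>2" "\<gamma> \<ge> 0" and a: "a \<ge> 0" and \<delta>': "4 * \<delta> \<le> \<delta>'"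
    and rest: "\<And>(Y :: 'b set) K y. fractional_matching Y K \<delta>' y \<Longrightarrow>
      \<exists>M\<subseteq>K. disjoint M \<and> (\<Sum>T\<in>K. y T) \<le> real (card M) + a * real (card Y)"
  shows "\<exists>M\<subseteq>H. disjoint M \<and> (\<Sum>T\<in>H. x T) \<le> real (card M) + (\<theta>\<^sup>2 + (1 - \<theta>) * a + \<gamma>) * real (card X)"
proof -
  obtain c where c: "(\<Sum>T\<in>H. x T) + (\<Sum>e\<in>surviving c. \<bar>degree_change c e\<bar>) + a * card (surviving c)
      \<le> card (isolated c) + (\<Sum>T\<in>remaining c. x T / s\<^sup>2) + (\<theta>\<^sup>2 + s * a + \<gamma>) * card X"
    using exists_bite[OF \<gamma> a] .
  obtain y where y: "fractional_matching (surviving c) (remaining c) \<delta>' y"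
    "(\<Sum>T\<in>remaining c. x T / s\<^sup>2) \<le> (\<Sum>T\<in>remaining c. y T) + (\<Sum>e\<in>surviving c. \<bar>degree_change c e\<bar>)"
    using fractional_matching_remaining[OF \<delta>'] .
  obtain M where M: "M \<subseteq> remaining c" "disjoint M"
    "(\<Sum>T\<in>remaining c. y T) \<le> real (card M) + a * real (card (surviving c))"
    using rest[OF y(1)] by blast
  have sub: "isolated c \<subseteq> H" "M \<subseteq> H" using M(1) by (auto simp: isolated_def remaining_def)
  have "card (isolated c \<union> M) = card (isolated c) + card M"
    using disjoint_isolated_remaining(2)[OF M(1,2)] H(3) sub
    by (intro card_Un_disjoint) (auto intro: finite_subset)
  then have "(\<Sum>T\<in>H. x T) \<le> real (card (isolated c \<union> M)) + (\<theta>\<^sup>2 + (1 - \<theta>) * a + \<gamma>) * real (card X)"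
    using c y(2) M(3) by (simp add: s_def)
  then show ?thesis using disjoint_isolated_remaining(1)[OF M(1,2)] sub by blast
qed

end

definition achievable_loss :: "'b itself \<Rightarrow> real \<Rightarrow> bool" where
  "achievable_loss _ a \<longleftrightarrow> (\<exists>\<delta>>0. \<forall>(X :: 'b set) H (x :: 'b set \<Rightarrow> real). fractional_matching X H \<delta> x \<longrightarrow>
     (\<exists>M\<subseteq>H. disjoint M \<and> (\<Sum>T\<in>H. x T) \<le> real (card M) + a * real (card X)))"

lemma achievable_loss_mono:
  assumes "achievable_loss TYPE('b) a" "a \<le> b"
  shows "achievable_loss TYPE('b) b"
proof -
  have "a * real n \<le> b * real n" for n using assms(2) by (rule mult_right_mono) simp
  then show ?thesis using assms(1) unfolding achievable_loss_def by (meson add_left_mono order_trans)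
qed

lemma achievable_loss_third: "achievable_loss TYPE('b) (1 / 3)"
  unfolding achievable_loss_def
proof (intro exI[of _ 1] conjI allI impI exI[of _ "{}"])
  fix X :: "'b set" and H x
  assume "fractional_matching X H 1 x"
  then show "(\<Sum>T\<in>H. x T) \<le> card {} + 1 / 3 * card X" using sum_fractional_matching_le[of X H 1 x] by simp
qed (auto simp: disjoint_def)

lemma achievable_loss_step:
  assumes a: "achievable_loss TYPE('b) a" "0 \<le> a" and \<theta>: "0 < \<theta>" "\<theta> \<le> 1 / 2" and \<eta>: "0 < \<eta>"
  shows "achievable_loss TYPE('b) (\<theta>\<^sup>2 + (1 - \<theta>) * a + \<eta>)"
proof -
  obtain \<delta>' where \<delta>': "\<delta>' > 0" and rest: "\<And>(X :: 'b set) H x. fractional_matching X H \<delta>' x \<Longrightarrow>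
      \<exists>M\<subseteq>H. disjoint M \<and> (\<Sum>T\<in>H. x T) \<le> real (card M) + a * real (card X)"
    using a(1) unfolding achievable_loss_def by blast
  have "((\<lambda>\<delta>. 1 / (1 - \<theta> * \<delta>) ^ 25 - 1 + 16 * \<delta>) \<longlongrightarrow> 1 / (1 - \<theta> * 0) ^ 25 - 1 + 16 * 0) (at_right 0)"
    by (intro tendsto_intros) auto
  then have "\<forall>\<^sub>F \<delta> in at_right 0. 1 / (1 - \<theta> * \<delta>) ^ 25 - 1 + 16 * \<delta> < \<eta>\<^sup>2"
    by (rule order_tendstoD) (use \<eta> in simp)
  moreover have "\<forall>\<^sub>F \<delta>::real in at_right 0. \<delta> < min 1 (\<delta>' / 4)"
    using \<delta>' by (intro order_tendstoD(2)[OF tendsto_ident_at]) auto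
  moreover have "\<forall>\<^sub>F \<delta>::real in at_right 0. 0 < \<delta>" by (rule eventually_at_right_less)
  ultimately have "\<forall>\<^sub>F \<delta> in at_right 0. 1 / (1 - \<theta> * \<delta>) ^ 25 - 1 + 16 * \<delta> < \<eta>\<^sup>2 \<and> \<delta> < min 1 (\<delta>' / 4) \<and> 0 < \<delta>"
    by eventually_elim auto
  then obtain \<delta> where small: "1 / (1 - \<theta> * \<delta>) ^ 25 - 1 + 16 * \<delta> < \<eta>\<^sup>2" "\<delta> < 1" "\<delta> < \<delta>' / 4" "0 < \<delta>"
    using eventually_happens'[OF trivial_limit_at_right_real] by auto
  have "\<exists>M\<subseteq>H. disjoint M \<and> (\<Sum>T\<in>H. x T) \<le> real (card M) + (\<theta>\<^sup>2 + (1 - \<theta>) * a + \<eta>) * real (card X)"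
    if matching: "fractional_matching X H \<delta> x" for X :: "'b set" and H x
  proof -
    interpret random_bite X H x \<delta> \<theta> using matching \<theta> small by unfold_locales auto
    show ?thesis by (rule exists_matching[OF _ _ a(2) _ rest]) (use small \<eta> in \<open>auto simp: r_def\<close>)
  qed
  then show ?thesis using small(4) unfolding achievable_loss_def by blast
qed

theorem near_perfect_matching:
  fixes \<eta> :: real
  assumes "\<eta> > 0"
  shows "achievable_loss TYPE('b) \<eta>"
proof -
  define losses where "losses = {a. 0 \<le> a \<and> achievable_loss TYPE('b) a}"
  define i where "i = Inf losses"
  have ne: "losses \<noteq> {}" using achievable_loss_third[where 'b = 'b] by (force simp: losses_def)
  have bdd: "bdd_below losses" by (auto simp: losses_def bdd_below_def)
  have "0 \<le> i" unfolding i_def using ne by (intro cInf_greatest) (auto simp: losses_def)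
  have "\<not> 0 < i"
  proof
    assume i: "0 < i"
    define \<theta> where "\<theta> = min (1 / 2) (i / 4)"
    have \<theta>: "0 < \<theta>" "\<theta> \<le> 1 / 2" "\<theta> \<le> i / 4" using i by (auto simp: \<theta>_def)
    have "i < i + \<theta> * i / 4" using i \<theta>(1) by simp
    then obtain a where a: "a \<in> losses" "a < i + \<theta> * i / 4"
      using cInf_lessD[OF ne] unfolding i_def by blast
    let ?b = "\<theta>\<^sup>2 + (1 - \<theta>) * a + \<theta> * i / 4"
    have "i \<le> a" unfolding i_def using a(1) bdd by (rule cInf_lower)
    have "\<theta>\<^sup>2 \<le> \<theta> * i / 4" using \<theta> by (simp add: power2_eq_square)
    moreover have "\<theta> * i \<le> \<theta> * a" using \<theta> \<open>i \<le> a\<close> by simp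
    moreover have "0 < \<theta> * i" using \<theta> i by simp
    ultimately have "?b < i" using a(2) by (simp add: algebra_simps)
    moreover have "?b \<in> losses"
      using achievable_loss_step[of a \<theta> "\<theta> * i / 4"] a(1) \<theta> i by (auto simp: losses_def)
    ultimately show False using cInf_lower[OF _ bdd] unfolding i_def by force
  qed
  with \<open>0 \<le> i\<close> have "Inf losses < \<eta>" using assms by (simp add: i_def)
  then obtain a where "a \<in> losses" "a < \<eta>" using cInf_lessD[OF ne] by blast
  then show ?thesis using achievable_loss_mono[where 'b = 'b, of a \<eta>] by (simp add: losses_def)
qed

section \<open>Random labels\<close>

lemma card_PiE_determined:
  assumes I: "finite I" "J \<subseteq> I"
    and g: "\<And>j f f'. j \<in> J \<Longrightarrow> (\<And>i. i \<in> I - J \<Longrightarrow> f i = f' i) \<Longrightarrow> g j f = g j f'"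
    and gB: "\<And>j f. j \<in> J \<Longrightarrow> f \<in> (\<Pi>\<^sub>E i\<in>I - J. B) \<Longrightarrow> g j f \<in> B"
  shows "card {f \<in> \<Pi>\<^sub>E i\<in>I. B. \<forall>j\<in>J. f j = g j f} = card B ^ card (I - J)"
proof -
  let ?S = "{f \<in> \<Pi>\<^sub>E i\<in>I. B. \<forall>j\<in>J. f j = g j f}" and ?P = "\<Pi>\<^sub>E i\<in>I - J. B"
  define extend where "extend h i = (if i \<in> J then g i h else h i)" for h i
  have g_extend: "g j (extend h) = g j h" "g j (restrict f (I - J)) = g j f" if "j \<in> J" for j h f
    using that by (auto intro!: g simp: extend_def)
  have "bij_betw (\<lambda>f. restrict f (I - J)) ?S ?P"
  proof (rule bij_betw_byWitness[where f' = extend])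
    show "\<forall>f\<in>?S. extend (restrict f (I - J)) = f"
    proof (intro ballI ext)
      fix f i assume "f \<in> ?S"
      then show "extend (restrict f (I - J)) i = f i"
        using g_extend(2) by (cases "i \<in> J"; cases "i \<in> I") (auto simp: extend_def PiE_iff extensional_def)
    qed
    show "\<forall>h\<in>?P. restrict (extend h) (I - J) = h"
      by (auto simp: extend_def fun_eq_iff PiE_iff extensional_def)
    show "(\<lambda>f. restrict f (I - J)) ` ?S \<subseteq> ?P" by (auto simp: restrict_PiE_iff)
    show "extend ` ?P \<subseteq> ?S"
    proof
      fix f assume "f \<in> extend ` ?P"
      then obtain h where h: "h \<in> ?P" "f = extend h" by blast
      have "f \<in> (\<Pi>\<^sub>E i\<in>I. B)"
        using h gB I(2) by (auto simp: extend_def PiE_iff extensional_def)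
      then show "f \<in> ?S" using g_extend(1) h(2) by (auto simp: extend_def)
    qed
  qed
  then have "card ?S = card ?P" by (rule bij_betw_same_card)
  then show ?thesis using I(1) by (simp add: card_PiE)
qed

definition labellings :: "'a set \<Rightarrow> nat \<Rightarrow> ('a \<times> 'a \<Rightarrow> nat) set" where
  "labellings V L = (\<Pi>\<^sub>E i\<in>V \<times> V. {..<L})"

definition ascending :: "nat \<Rightarrow> ('a \<times> 'a \<Rightarrow> nat) \<Rightarrow> 'a \<Rightarrow> 'a \<Rightarrow> 'a \<Rightarrow> bool" where
  "ascending L f u v w \<longleftrightarrow> f (v, w) = (f (v, u) + 1) mod L \<and> f (w, u) = (f (w, v) + 1) mod L \<and>
     f (u, v) = (f (u, w) + 1) mod L"

lemma ascending_rotate: "ascending L f u v w = ascending L f v w u"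
  by (auto simp: ascending_def)

lemma labellings_finite_nonempty:
  assumes "finite V" "L > 0"
  shows "finite (labellings V L)" "labellings V L \<noteq> {}"
  using assms by (auto simp: labellings_def PiE_eq_empty_iff intro!: finite_PiE)

lemma eq_Suc_mod_iff_pred:
  fixes x y L :: nat
  assumes "x < L" "y < L"
  shows "y = (x + 1) mod L \<longleftrightarrow> x = (y + (L - 1)) mod L"
proof (cases "y = 0")
  case True
  then show ?thesis using assms by (cases "x + 1 = L") auto
next
  case False
  then have "(y + (L - 1)) mod L = y - 1"
    using assms by (simp add: mod_if)
  then show ?thesis using assms False by (cases "x + 1 = L") auto
qed

lemma prob_ascending:
  assumes V: "finite V" "L > 0" and uv: "u \<in> V" "v \<in> V" "u \<noteq> v" and W: "W \<subseteq> V - {u, v}"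
  shows "measure_pmf.prob (pmf_of_set (labellings V L)) {f. \<forall>w\<in>W. ascending L f u v w}
    = (1 / real L ^ 3) ^ card W"
proof -
  define J where "J = (\<Union>w\<in>W. {(v, w), (w, u), (u, w)})"
  define g where "g j f = (if fst j = v then (f (v, u) + 1) mod L
      else if fst j = u then (f (u, v) + (L - 1)) mod L else (f (fst j, v) + 1) mod L)"
    for j :: "'a \<times> 'a" and f :: "'a \<times> 'a \<Rightarrow> nat"
  have J: "J \<subseteq> V \<times> V" using W uv by (auto simp: J_def)
  have finW: "finite W" using W V finite_subset by blast
  have "card J = (\<Sum>w\<in>W. card {(v, w), (w, u), (u, w)})"
    unfolding J_def using finW W by (intro card_UN_disjoint) auto
  also have "\<dots> = (\<Sum>w\<in>W. 3)" using W uv(3) by (intro sum.cong) auto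
  finally have card_J: "card J = 3 * card W" by simp
  have determined: "(\<forall>w\<in>W. ascending L f u v w) \<longleftrightarrow> (\<forall>j\<in>J. f j = g j f)" if f: "f \<in> labellings V L" for f
  proof -
    have "f (u, v) = (f (u, w) + 1) mod L \<longleftrightarrow> f (u, w) = (f (u, v) + (L - 1)) mod L" if "w \<in> W" for w
      using f that W uv(1,2) by (intro eq_Suc_mod_iff_pred) (auto simp: labellings_def)
    then have "ascending L f u v w \<longleftrightarrow> (\<forall>j\<in>{(v, w), (w, u), (u, w)}. f j = g j f)" if "w \<in> W" for w
      using that W uv(3) by (auto simp: g_def ascending_def)
    then show ?thesis by (simp add: J_def)
  qed
  have "card {f \<in> labellings V L. \<forall>j\<in>J. f j = g j f} = card {..<L} ^ card (V \<times> V - J)"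
    unfolding labellings_def
  proof (rule card_PiE_determined)
    fix j and f f' :: "'a \<times> 'a \<Rightarrow> nat"
    assume j: "j \<in> J" and eq: "\<And>i. i \<in> V \<times> V - J \<Longrightarrow> f i = f' i"
    have "f (v, u) = f' (v, u)" "f (u, v) = f' (u, v)" using uv W by (auto intro!: eq simp: J_def)
    moreover have "f (fst j, v) = f' (fst j, v)" if "fst j \<noteq> u" "fst j \<noteq> v"
      using that j W uv by (intro eq) (auto simp: J_def)
    ultimately show "g j f = g j f'" by (auto simp: g_def)
  qed (use V J in \<open>auto simp: g_def\<close>)
  moreover have "labellings V L \<inter> {f. \<forall>w\<in>W. ascending L f u v w} = {f \<in> labellings V L. \<forall>j\<in>J. f j = g j f}"
    using determined by auto
  moreover have "card (labellings V L) = L ^ (card (V \<times> V - J) + 3 * card W)"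
    using V J card_J card_mono[OF _ J] by (simp add: labellings_def card_PiE card_Diff_subset finite_subset[OF J])
  ultimately show ?thesis
    using labellings_finite_nonempty[OF V] V(2)
    by (simp add: measure_pmf_of_set power_add power_mult power_one_over divide_simps)
qed

definition thinned :: "nat \<Rightarrow> ('a \<times> 'a \<Rightarrow> nat) \<Rightarrow> ('a \<Rightarrow> 'a \<Rightarrow> 'a \<Rightarrow> real) \<Rightarrow> 'a \<Rightarrow> 'a \<Rightarrow> 'a \<Rightarrow> real" where
  "thinned L f X u v w = real L ^ 3 * X u v w * of_bool (ascending L f u v w)"

lemma triangle_weighting_thinned:
  assumes "triangle_weighting E \<delta> X"
  shows "triangle_weighting E (real L ^ 3 * \<delta>) (thinned L f X)"
proof -
  have \<delta>: "0 \<le> \<delta>" using triangle_weightingD(1,2)[OF assms] order_trans by blast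
  show ?thesis
    unfolding triangle_weighting_def
  proof (intro allI conjI impI)
    fix u v w
    note X = triangle_weightingD[OF assms, of u v w]
    show "0 \<le> thinned L f X u v w" using X(1) by (simp add: thinned_def)
    show "thinned L f X u v w \<le> real L ^ 3 * \<delta>" using X(2) \<delta> by (simp add: thinned_def mult_left_mono)
    show "thinned L f X u v w = thinned L f X v w u"
      using X(3) ascending_rotate[of L f u v w] by (simp add: thinned_def)
    assume "thinned L f X u v w \<noteq> 0"
    then show "distinct [u, v, w]" "tri u v w \<subseteq> E" using X(4) by (auto simp: thinned_def)
  qed
qed

lemma expectation_thinned_deviation_le:
  assumes X: "triangle_weighting E \<delta> X" and V: "finite V" "L > 0" and uv: "u \<in> V" "v \<in> V"
    and \<gamma>: "real L ^ 3 * \<delta> * (\<Sum>w\<in>V. X u v w) \<le> \<gamma>\<^sup>2" "\<gamma> \<ge> 0"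
  shows "measure_pmf.expectation (pmf_of_set (labellings V L))
      (\<lambda>f. \<bar>(\<Sum>w\<in>V. thinned L f X u v w) - (\<Sum>w\<in>V. X u v w)\<bar>) \<le> \<gamma>"
proof (cases "u = v")
  case True
  then have "X u v w = 0" for w using triangle_weightingD(4)[OF X, of u v w] by auto
  then show ?thesis using \<gamma>(2) by (simp add: thinned_def)
next
  case False
  let ?M = "pmf_of_set (labellings V L)" and ?W = "V - {u, v}"
  define \<mu> where "\<mu> = (\<Sum>w\<in>?W. X u v w)"
  note X_nonneg = triangle_weightingD(1)[OF X]
  have fin: "finite (set_pmf ?M)" using labellings_finite_nonempty[OF V] by simp
  have zero: "X u v w = 0" if "w \<in> V - ?W" for w using that triangle_weightingD(4)[OF X, of u v w] by auto
  have \<mu>: "(\<Sum>w\<in>V. X u v w) = \<mu>"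
    unfolding \<mu>_def using V(1) zero by (intro sum.mono_neutral_right) auto
  have thinned: "(\<Sum>w\<in>V. thinned L f X u v w) =
      (\<Sum>w\<in>?W. X u v w / (1 / real L ^ 3) * indicator {f. ascending L f u v w} f)" for f
    using V(1) zero by (intro sum.mono_neutral_cong_right) (auto simp: thinned_def indicator_def)
  have prob: "measure_pmf.prob ?M {f. ascending L f u v w} = 1 / real L ^ 3" if "w \<in> ?W" for w
    using prob_ascending[OF V uv False, of "{w}"] that by simp
  have "measure_pmf.expectation ?M (\<lambda>f. (indicator UNIV f * ((\<Sum>w\<in>V. thinned L f X u v w) - \<mu>))\<^sup>2)
      \<le> \<mu>\<^sup>2 * (1 - 1) + real L ^ 3 * \<delta> * \<mu>"
    unfolding thinned \<mu>_def
  proof (rule second_moment_weighted_indicators)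
    fix w assume w: "w \<in> ?W"
    show "X u v w * measure_pmf.prob ?M {f. ascending L f u v w} \<le> real L ^ 3 * \<delta> * (1 / real L ^ 3)\<^sup>2"
      using triangle_weightingD(2)[OF X, of u v w] V(2) by (simp add: prob[OF w] field_simps power2_eq_square)
    fix w' assume w': "w' \<in> ?W" "w \<noteq> w'"
    have "{f. ascending L f u v w} \<inter> {f. ascending L f u v w'} = {f. \<forall>w\<in>{w, w'}. ascending L f u v w}" by auto
    then show "measure_pmf.prob ?M ({f. ascending L f u v w} \<inter> {f. ascending L f u v w'})
        \<le> 1 * (1 / real L ^ 3)\<^sup>2 * measure_pmf.prob ?M UNIV"
      using prob_ascending[OF V uv False, of "{w, w'}"] w w' by (simp add: power2_eq_square)
  qed (use fin V X_nonneg prob in auto)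
  then have "measure_pmf.expectation ?M (\<lambda>f. ((\<Sum>w\<in>V. thinned L f X u v w) - \<mu>)\<^sup>2) \<le> \<gamma>\<^sup>2"
    using \<gamma>(1) by (simp add: \<mu>)
  then show ?thesis unfolding \<mu> using fin \<gamma>(2) by (intro pmf_expectation_abs_le)
qed

lemma exists_labelling:
  assumes X: "triangle_weighting E \<delta> X" and V: "finite V" "L > 0"
    and \<gamma>: "\<And>u v. u \<in> V \<Longrightarrow> v \<in> V \<Longrightarrow> real L ^ 3 * \<delta> * (\<Sum>w\<in>V. X u v w) \<le> \<gamma>\<^sup>2" "\<gamma> \<ge> 0"
  obtains f where "f \<in> labellings V L"
    "(\<Sum>u\<in>V. \<Sum>v\<in>V. \<bar>(\<Sum>w\<in>V. thinned L f X u v w) - (\<Sum>w\<in>V. X u v w)\<bar>) \<le> \<gamma> * (real (card V))\<^sup>2"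
proof -
  let ?M = "pmf_of_set (labellings V L)"
  have fin: "finite (set_pmf ?M)" using labellings_finite_nonempty[OF V] by simp
  have "measure_pmf.expectation ?M
      (\<lambda>f. \<Sum>u\<in>V. \<Sum>v\<in>V. \<bar>(\<Sum>w\<in>V. thinned L f X u v w) - (\<Sum>w\<in>V. X u v w)\<bar>) \<le> (\<Sum>u\<in>V. \<Sum>v\<in>V. \<gamma>)"
    unfolding Bochner_Integration.integral_sum[OF integrable_measure_pmf_finite[OF fin]]
    by (intro sum_mono expectation_thinned_deviation_le[OF X V] \<gamma>)
  also have "\<dots> = \<gamma> * (real (card V))\<^sup>2" by (simp add: power2_eq_square)
  finally obtain f where "f \<in> set_pmf ?M"
    "(\<Sum>u\<in>V. \<Sum>v\<in>V. \<bar>(\<Sum>w\<in>V. thinned L f X u v w) - (\<Sum>w\<in>V. X u v w)\<bar>) \<le> \<gamma> * (real (card V))\<^sup>2"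
    using pmf_expectation_attained[OF fin] by blast
  then show thesis using that labellings_finite_nonempty[OF V] by simp
qed

section \<open>Cyclic extensions of partial injections\<close>

lemma cyclic_on_insert:
  assumes g: "cyclic_on g A" and u: "u \<in> A" and w: "w \<notin> A"
  shows "cyclic_on (g(u := w, w := g u)) (insert w A)"
proof -
  define h where "h = g(u := w, w := g u)"
  have h: "h u = w" "h w = g u" "\<And>y. y \<noteq> u \<Longrightarrow> y \<noteq> w \<Longrightarrow> h y = g y"
    using u w by (auto simp: h_def)
  have A: "A = orbit g u" using g u by (simp add: cyclic_on_alldef)
  have start: "g u \<in> orbit h w" using orbit.base[of h w] h(2) by simp
  have "y \<in> orbit h w" if "y \<in> A" for y
  proof -
    have "y \<in> orbit g u" using that A by simp
    then show ?thesis
    proof induction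
      case (step y)
      then have "y \<noteq> w" using A w by auto
      then show ?case using start h(3)[of y] orbit.step[OF step.IH] by (cases "y = u") simp_all
    qed (rule start)
  qed
  then have "A \<subseteq> orbit h w" "w \<in> orbit h w"
    using u orbit.step[of u h w] h(1) by auto
  moreover have "y \<in> insert w A" if "y \<in> orbit h w" for y
    using that
    by induction (use u h(2) cyclic_on_inI[OF g] in \<open>auto simp: h_def\<close>)
  ultimately have "insert w A = orbit h w" by blast
  then show ?thesis unfolding h_def[symmetric] by (intro cyclic_on_singleI[of w]) auto
qed

lemma cyclic_on_exists:
  assumes "finite A" "A \<noteq> {}"
  shows "\<exists>g. cyclic_on g A"
  using assms
proof (induction A rule: finite_ne_induct)
  case (singleton x)
  have "orbit id x = {x}" by (simp add: orbit_eq_singleton_iff)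
  then show ?case by (metis cyclic_on_singleI singletonI)
next
  case (insert w A)
  then obtain g u where "cyclic_on g A" "u \<in> A" by blast
  then show ?case using cyclic_on_insert[of g A u w] insert.hyps by blast
qed

text \<open>Contract the last arc \<open>u \<rightarrow> f u\<close> of a path.\<close>

lemma cyclic_extension_of_acyclic:
  fixes r :: "'a \<Rightarrow> nat"
  assumes "finite A" "A \<noteq> {}" "D \<subseteq> A" "inj_on f D" "f ` D \<subseteq> A" "\<And>u. u \<in> D \<Longrightarrow> r u < r (f u)"
  shows "\<exists>g. cyclic_on g A \<and> (\<forall>u\<in>D. g u = f u)"
  using assms
proof (induction "card D" arbitrary: A D)
  case 0
  then have "D = {}" using finite_subset by fastforce
  then show ?case using cyclic_on_exists[of A] 0 by simp
next
  case (Suc n)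
  have fin: "finite D" using Suc.prems finite_subset by blast
  have "D \<noteq> {}" using Suc.hyps(2) by auto
  then obtain u where u: "u \<in> D" "\<And>x. x \<in> D \<Longrightarrow> r x \<le> r u"
    using obtains_MAX[OF fin, of r] fin by (metis Max_ge finite_imageI imageI)
  let ?w = "f u"
  have w: "?w \<notin> D" "?w \<in> A" "?w \<noteq> u"
    using u Suc.prems(5,6) by (fastforce simp: not_less)+
  have "\<exists>g. cyclic_on g (A - {?w}) \<and> (\<forall>x\<in>D - {u}. g x = f x)"
  proof (rule Suc.hyps(1))
    show "n = card (D - {u})" using Suc.hyps(2) u fin by simp
    show "A - {?w} \<noteq> {}" "D - {u} \<subseteq> A - {?w}" using u w Suc.prems(3) by auto
    show "f ` (D - {u}) \<subseteq> A - {?w}" using Suc.prems(4,5) u by (auto simp: inj_on_def)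
    show "inj_on f (D - {u})" using Suc.prems(4) by (rule inj_on_subset) auto
  qed (use Suc.prems in auto)
  then obtain g where g: "cyclic_on g (A - {?w})" "\<And>x. x \<in> D - {u} \<Longrightarrow> g x = f x" by blast
  let ?h = "g(u := ?w, ?w := g u)"
  have "cyclic_on ?h (insert ?w (A - {?w}))"
    using g(1) u w Suc.prems(3) by (intro cyclic_on_insert) auto
  then have "cyclic_on ?h A" using w(2) by (simp add: insert_absorb)
  moreover have "?h x = f x" if "x \<in> D" for x using that w g(2) by auto
  ultimately show ?case by blast
qed

lemma exists_rare_label:
  fixes lab :: "'a \<Rightarrow> nat"
  assumes "finite A" "L > 0" "\<And>u. u \<in> A \<Longrightarrow> lab u < L"
  obtains j where "j < L" "L * card {u \<in> A. lab u = j} \<le> card A"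
proof -
  have "\<exists>j<L. L * card {u \<in> A. lab u = j} \<le> card A"
  proof (rule ccontr)
    assume "\<not> ?thesis"
    then have large: "card A < L * card {u \<in> A. lab u = j}" if "j < L" for j
      using that by (auto simp: not_le)
    have "(\<Sum>j<L. card {u \<in> A. lab u = j}) = card A"
      using assms sum_fun_comp[of A "{..<L}" lab "\<lambda>_. 1 :: nat"] by (simp add: image_subset_iff)
    then have "(\<Sum>j<L. L * card {u \<in> A. lab u = j}) = L * card A"
      by (simp add: sum_distrib_left[symmetric])
    moreover have "(\<Sum>j<L. card A) < (\<Sum>j<L. L * card {u \<in> A. lab u = j})"
      using large assms(2) by (intro sum_strict_mono) auto
    ultimately show False by simp
  qed
  then show thesis using that by blast
qed

text \<open>
  A label that increases by 1 modulo \<open>L\<close> along \<open>f\<close> takes every value on each cycle of \<open>f\<close>, so all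
  cycles can be cut open at the elements of a rare label.
\<close>

lemma cyclic_extension_of_labelled:
  fixes lab :: "'a \<Rightarrow> nat"
  assumes A: "finite A" "A \<noteq> {}" and f: "D \<subseteq> A" "inj_on f D" "f ` D \<subseteq> A" and L: "L > 0"
    and lab: "\<And>u. u \<in> D \<Longrightarrow> lab (f u) = (lab u + 1) mod L" "\<And>u. u \<in> A \<Longrightarrow> lab u < L"
  shows "\<exists>g. cyclic_on g A \<and> L * card {u \<in> D. g u \<noteq> f u} \<le> card A"
proof -
  obtain j where j: "j < L" "L * card {u \<in> A. lab u = j} \<le> card A"
    using exists_rare_label[of A L lab] A(1) L lab(2) by blast
  define r where "r u = (lab u + (L - 1 - j)) mod L" for u
  have "r u < r (f u)" if u: "u \<in> D" "lab u \<noteq> j" for u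
  proof -
    have "r (f u) = (r u + 1) mod L"
      using lab(1)[OF u(1)] by (simp add: r_def mod_simps add.commute add.left_commute)
    moreover have "r u \<noteq> L - 1"
    proof
      assume "r u = L - 1"
      moreover have "lab u < L" using lab(2) f(1) u(1) by auto
      ultimately show False using u(2) j(1)
        by (cases "lab u + (L - 1 - j) < L") (auto simp: r_def le_mod_geq)
    qed
    moreover have "r u < L" using L by (simp add: r_def)
    ultimately show ?thesis by simp
  qed
  then obtain g where g: "cyclic_on g A" "\<And>u. u \<in> D \<Longrightarrow> lab u \<noteq> j \<Longrightarrow> g u = f u"
    using cyclic_extension_of_acyclic[of A "{u \<in> D. lab u \<noteq> j}" f r] A f
    by (force intro: inj_on_subset)
  have "card {u \<in> D. g u \<noteq> f u} \<le> card {u \<in> A. lab u = j}"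
    using g(2) A(1) f(1) by (intro card_mono) auto
  then have "L * card {u \<in> D. g u \<noteq> f u} \<le> card A"
    using j(2) by (meson le_trans mult_le_mono2)
  then show ?thesis using g(1) by blast
qed

section \<open>From weighted triangles to embeddings\<close>

lemma tri_eq_iff:
  assumes "distinct [u, v, w]"
  shows "tri u v w = tri a b c \<longleftrightarrow> (a, b, c) = (u, v, w) \<or> (a, b, c) = (v, w, u) \<or> (a, b, c) = (w, u, v)"
proof
  assume "tri u v w = tri a b c"
  then have "(a, b) \<in> tri u v w" "(b, c) \<in> tri u v w" by (auto simp: tri_def)
  then show "(a, b, c) = (u, v, w) \<or> (a, b, c) = (v, w, u) \<or> (a, b, c) = (w, u, v)"
    using assms by (auto simp: tri_def)
qed (auto simp: tri_def)

lemma tri_third_eq: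
  assumes "distinct [u, v, w]" "tri u v w = tri u v w'"
  shows "w = w'"
  using assms tri_eq_iff[OF assms(1), of u v w'] by auto

lemma card_tri: "distinct [u, v, w] \<Longrightarrow> card (tri u v w) = 3"
  by (auto simp: tri_def)

lemma tri_through_arc:
  assumes "(u, v) \<in> tri a b c" "P a b c" and rotate: "\<And>a b c. P a b c \<Longrightarrow> P b c a"
  obtains w where "tri a b c = tri u v w" "P u v w"
proof -
  from assms(1) consider "u = a" "v = b" | "u = b" "v = c" | "u = c" "v = a" by (auto simp: tri_def)
  then show thesis
  proof cases
    case 1
    then show ?thesis using that[of c] assms(2) by simp
  next
    case 2
    then show ?thesis using that[of a] assms(2) rotate[of a b c] tri_rotate[of a b c] by simp
  next
    case 3
    then show ?thesis using that[of b] rotate[OF rotate[OF assms(2)]] tri_rotate[of c a b] by simp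
  qed
qed

definition support_triangles :: "('a \<Rightarrow> 'a \<Rightarrow> 'a \<Rightarrow> real) \<Rightarrow> ('a \<times> 'a) set set" where
  "support_triangles X = {tri u v w | u v w. X u v w \<noteq> 0}"

definition tri_weight :: "('a \<Rightarrow> 'a \<Rightarrow> 'a \<Rightarrow> real) \<Rightarrow> ('a \<times> 'a) set \<Rightarrow> real" where
  "tri_weight X T = (THE r. \<exists>u v w. distinct [u, v, w] \<and> T = tri u v w \<and> r = X u v w)"

lemma tri_weight_tri:
  assumes X: "triangle_weighting E \<delta> X" and "distinct [u, v, w]"
  shows "tri_weight X (tri u v w) = X u v w"
  unfolding tri_weight_def
proof (rule the_equality)
  fix r assume "\<exists>a b c. distinct [a, b, c] \<and> tri u v w = tri a b c \<and> r = X a b c"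
  then show "r = X u v w"
    using triangle_weightingD(3)[OF X, of u v w] triangle_weightingD(3)[OF X, of v w u]
    unfolding tri_eq_iff[OF assms(2)] by auto
qed (use assms(2) in blast)

lemma support_triangles_arc:
  assumes X: "triangle_weighting E \<delta> X" and T: "T \<in> support_triangles X" "(u, v) \<in> T"
  obtains w where "T = tri u v w" "X u v w \<noteq> 0" "distinct [u, v, w]"
proof -
  from T obtain a b c where abc: "T = tri a b c" "X a b c \<noteq> 0" by (auto simp: support_triangles_def)
  then have "(u, v) \<in> tri a b c" using T(2) by simp
  then obtain w where "tri a b c = tri u v w" "X u v w \<noteq> 0"
    using abc(2) by (rule tri_through_arc) (metis triangle_weightingD(3)[OF X])
  then show thesis using that triangle_weightingD(4)[OF X] abc(1) by blast
qed

lemma linear_triples_support_triangles: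
  assumes X: "triangle_weighting E \<delta> X" and "finite E"
  shows "linear_triples E (support_triangles X)"
  unfolding linear_triples_def
proof (intro conjI ballI allI impI assms(2))
  fix T assume "T \<in> support_triangles X"
  then obtain u v w where T: "T = tri u v w" "X u v w \<noteq> 0" by (auto simp: support_triangles_def)
  then show "T \<subseteq> E" "card T = 3" using triangle_weightingD(4)[OF X T(2)] card_tri[of u v w] by auto
next
  fix T T' e f
  assume T: "T \<in> support_triangles X" "T' \<in> support_triangles X" "e \<noteq> f" "{e, f} \<subseteq> T \<inter> T'"
  obtain u v where e: "e = (u, v)" by (cases e)
  obtain w where w: "T = tri u v w" "distinct [u, v, w]"
    using support_triangles_arc[OF X T(1), of u v] T(4) e by auto
  obtain w' where w': "T' = tri u v w'" "distinct [u, v, w']"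
    using support_triangles_arc[OF X T(2), of u v] T(4) e by auto
  have "f \<in> tri u v w" "f \<in> tri u v w'" using T(4) w w' by auto
  then have "w = w'" using w(2) w'(2) T(3) e by (auto simp: tri_def)
  then show "T = T'" using w w' by simp
qed

lemma weighted_degree_support_triangles:
  assumes X: "triangle_weighting E \<delta> X" and V: "finite V" "E \<subseteq> V \<times> V"
  shows "weighted_degree (support_triangles X) (tri_weight X) (u, v) = (\<Sum>w\<in>V. X u v w)"
proof -
  let ?W = "{w \<in> V. X u v w \<noteq> 0}"
  have supp: "distinct [u, v, w]" "w \<in> V" if "X u v w \<noteq> 0" for w
    using triangle_weightingD(4)[OF X that] V(2) by (auto simp: tri_def)
  have "{T \<in> support_triangles X. (u, v) \<in> T} = tri u v ` ?W"
  proof (intro equalityI subsetI)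
    fix T assume "T \<in> {T \<in> support_triangles X. (u, v) \<in> T}"
    then obtain w where "T = tri u v w" "X u v w \<noteq> 0" using support_triangles_arc[OF X] by blast
    then show "T \<in> tri u v ` ?W" using supp by auto
  qed (auto simp: support_triangles_def tri_def)
  moreover have "inj_on (tri u v) ?W"
    using supp(1) tri_third_eq by (fastforce intro!: inj_onI)
  ultimately have "weighted_degree (support_triangles X) (tri_weight X) (u, v) = (\<Sum>w\<in>?W. tri_weight X (tri u v w))"
    by (simp add: weighted_degree_def sum.reindex)
  also have "\<dots> = (\<Sum>w\<in>?W. X u v w)"
    using supp(1) tri_weight_tri[OF X] by (intro sum.cong) auto
  also have "\<dots> = (\<Sum>w\<in>V. X u v w)" using V(1) by (intro sum.mono_neutral_left) auto
  finally show ?thesis .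
qed

lemma total_cost_eq:
  assumes X: "triangle_weighting E \<delta> X" and V: "finite V" "E \<subseteq> V \<times> V"
  defines "H \<equiv> support_triangles X" and "x \<equiv> tri_weight X"
  shows "total_cost V E X = real (card E) - 3 * (\<Sum>T\<in>H. x T) + 3 * (\<Sum>e\<in>E. max 0 (weighted_degree H x e - 1))"
proof -
  have lin: "linear_triples E H"
    unfolding H_def using V finite_subset by (intro linear_triples_support_triangles[OF X]) blast
  have "total_cost V E X = (\<Sum>e\<in>E. 1 - weighted_degree H x e + 3 * max 0 (weighted_degree H x e - 1))"
    unfolding total_cost_def H_def x_def
    by (intro sum.cong refl) (auto simp: weighted_degree_support_triangles[OF X V] cover_cost_def max_def)
  then show ?thesis
    unfolding sum_weighted_degree[OF lin, of x, symmetric]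
    by (simp add: sum.distrib sum_subtractf sum_distrib_left)
qed

theorem triangle_packing:
  fixes \<eta> :: real
  assumes "\<eta> > 0"
  obtains \<delta> :: real where "\<delta> > 0"
    "\<And>V (E :: ('a \<times> 'a) set) X. finite V \<Longrightarrow> E \<subseteq> V \<times> V \<Longrightarrow> triangle_weighting E \<delta> X \<Longrightarrow>
      \<exists>M\<subseteq>support_triangles X. disjoint M \<and>
        real (card E) \<le> 3 * real (card M) + total_cost V E X + \<eta> * real (card E)"
proof -
  obtain \<delta> where \<delta>: "\<delta> > 0" and matching:
    "\<And>(E :: ('a \<times> 'a) set) H x. fractional_matching E H \<delta> x \<Longrightarrow>
      \<exists>M\<subseteq>H. disjoint M \<and> (\<Sum>T\<in>H. x T) \<le> real (card M) + \<eta> / 3 * real (card E)"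
    using near_perfect_matching[where 'b = "'a \<times> 'a", of "\<eta> / 3"] assms
    unfolding achievable_loss_def by auto
  have "\<exists>M\<subseteq>support_triangles X. disjoint M \<and>
      real (card E) \<le> 3 * real (card M) + total_cost V E X + \<eta> * real (card E)"
    if V: "finite V" "E \<subseteq> V \<times> V" and X: "triangle_weighting E \<delta> X" for V and E :: "('a \<times> 'a) set" and X
  proof -
    let ?H = "support_triangles X" and ?x = "tri_weight X"
    have lin: "linear_triples E ?H"
      using V finite_subset by (intro linear_triples_support_triangles[OF X]) blast
    have "0 \<le> ?x T \<and> ?x T \<le> \<delta>" if T: "T \<in> ?H" for T
    proof -
      obtain u v w where "T = tri u v w" "X u v w \<noteq> 0" using T by (auto simp: support_triangles_def)
      then have "?x T = X u v w" using triangle_weightingD(4)[OF X] tri_weight_tri[OF X] by blast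
      then show ?thesis using triangle_weightingD(1,2)[OF X] by simp
    qed
    then obtain y where y: "fractional_matching E ?H \<delta> y"
      "(\<Sum>T\<in>?H. ?x T) \<le> (\<Sum>T\<in>?H. y T) + (\<Sum>e\<in>E. max 0 (weighted_degree ?H ?x e - 1))"
      using fractional_matching_truncate[OF lin] by blast
    obtain M where M: "M \<subseteq> ?H" "disjoint M" "(\<Sum>T\<in>?H. y T) \<le> real (card M) + \<eta> / 3 * real (card E)"
      using matching[OF y(1)] by blast
    then show ?thesis using y(2) by (intro exI[of _ M]) (auto simp: total_cost_eq[OF X V])
  qed
  then show thesis using that \<delta> by blast
qed

lemma card_uncovered_le:
  assumes E: "finite E" "M \<subseteq> Pow E" and M: "\<And>T. T \<in> M \<Longrightarrow> card T = 3" "disjoint M" and B: "finite B"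
  shows "card (E - \<Union>{T \<in> M. T \<inter> B = {}}) + 3 * card M \<le> card E + 3 * card B"
proof -
  define M' where "M' = {T \<in> M. T \<inter> B = {}}"
  have fin: "finite M" "finite M'" "finite (\<Union>M')" and sub: "M' \<subseteq> M" "\<Union>M' \<subseteq> E"
    using E by (auto simp: M'_def finite_subset intro: finite_subset[of _ E])
  have disj: "pairwise disjnt M" using M(2) by simp
  have "card (\<Union>M') = (\<Sum>T\<in>M'. card T)"
    using disj sub(1) E by (intro card_Union_disjoint) (auto intro: pairwise_subset finite_subset)
  also have "\<dots> = 3 * card M'" using M(1) sub(1) by (simp add: subset_iff)
  finally have covered: "card (E - \<Union>M') + 3 * card M' = card E"
    using sub(2) fin(3) E(1) card_mono[of E "\<Union>M'"] by (simp add: card_Diff_subset)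
  have "card (M - M') \<le> (\<Sum>T\<in>M - M'. card (T \<inter> B))"
  proof -
    have "1 \<le> card (T \<inter> B)" if "T \<in> M - M'" for T
      using that B by (auto simp: M'_def Suc_le_eq card_gt_0_iff)
    then show ?thesis using sum_mono[of "M - M'" "\<lambda>_. 1" "\<lambda>T. card (T \<inter> B)"] by simp
  qed
  also have "\<dots> = card (\<Union>T\<in>M - M'. T \<inter> B)"
    using disj B fin(1) by (intro card_UN_disjoint[symmetric]) (auto simp: pairwise_def disjnt_def)
  also have "\<dots> \<le> card B" using B by (intro card_mono) auto
  finally have "card M \<le> card M' + card B"
    using fin sub(1) by (simp add: card_Diff_subset)
  then show ?thesis using covered unfolding M'_def[symmetric] by linarith
qed

lemma triangular_face_tri: "distinct [u, v, w] \<Longrightarrow> triangular_face (tri u v w)"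
  unfolding triangular_face_def tri_def by blast

lemma orbit_face_step_triangle:
  assumes "rot v u = w" "rot w v = u" "rot u w = v"
  shows "orbit (face_step rot) (u, v) = tri u v w"
proof -
  have "orbit (face_step rot) (u, v) = {(face_step rot ^^ m) (u, v) | m. m < 3}"
    using assms by (intro orbit_altdef_bounded) (simp_all add: eval_nat_numeral)
  also have "\<dots> = (\<lambda>m. (face_step rot ^^ m) (u, v)) ` {..<3}" by blast
  also have "{..<3} = {0, 1, 2 :: nat}" by auto
  finally show ?thesis using assms by (simp add: tri_def eval_nat_numeral)
qed

lemma (in pair_graph) arc_sym: "(u, v) \<in> parcs G \<longleftrightarrow> (v, u) \<in> parcs G"
  using pair_sym_arcs by (auto simp: symmetric_def sym_def)

lemma (in pair_graph) card_edges_not_in_two_triangular_faces_le: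
  assumes F: "F \<subseteq> faces G rot" "\<And>T. T \<in> F \<Longrightarrow> triangular_face T"
  shows "card {e \<in> uedges G. \<not> in_two_triangular_faces G rot e} \<le> card (parcs G - \<Union>F)"
proof -
  have "{e \<in> uedges G. \<not> in_two_triangular_faces G rot e} \<subseteq> (\<lambda>(u, v). {u, v}) ` (parcs G - \<Union>F)"
  proof
    fix e assume "e \<in> {e \<in> uedges G. \<not> in_two_triangular_faces G rot e}"
    then obtain u v where e: "e = {u, v}" "(u, v) \<in> parcs G" and bad: "\<not> in_two_triangular_faces G rot e"
      by (auto simp: uedges_def)
    have "(u, v) \<notin> \<Union>F \<or> (v, u) \<notin> \<Union>F"
    proof (rule ccontr)
      assume "\<not> ((u, v) \<notin> \<Union>F \<or> (v, u) \<notin> \<Union>F)"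
      then obtain T T' where T: "T \<in> F" "(u, v) \<in> T" "T' \<in> F" "(v, u) \<in> T'" by auto
      then have "T \<noteq> T'" using F(2)[OF T(1)] by (auto simp: triangular_face_def)
      moreover have "edge_on_face e T" "edge_on_face e T'"
        unfolding edge_on_face_def e(1) using T by (blast, metis insert_commute)
      ultimately show False using bad T F unfolding in_two_triangular_faces_def by blast
    qed
    then show "e \<in> (\<lambda>(u, v). {u, v}) ` (parcs G - \<Union>F)"
      using e arc_sym[of u v] by (auto simp: image_iff insert_commute)
  qed
  then show ?thesis
    using pair_finite_arcs by (intro order_trans[OF card_mono card_image_le]) auto
qed

locale labelled_packing = pair_graph G
  for G :: "'a pair_pre_digraph" and L :: nat and f :: "'a \<times> 'a \<Rightarrow> nat" and M :: "('a \<times> 'a) set set" +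
  assumes L_pos: "L > 0" and labelling: "f \<in> labellings (pverts G) L"
    and triangles: "T \<in> M \<Longrightarrow> \<exists>u v w. T = tri u v w \<and> distinct [u, v, w] \<and> tri u v w \<subseteq> parcs G \<and> ascending L f u v w"
    and disjoint: "disjoint M"
begin

definition preds :: "'a \<Rightarrow> 'a set" where
  "preds v = {u. \<exists>w. distinct [u, v, w] \<and> tri u v w \<in> M}"

definition third :: "'a \<Rightarrow> 'a \<Rightarrow> 'a" where
  "third v u = (THE w. distinct [u, v, w] \<and> tri u v w \<in> M)"

definition broken :: "('a \<Rightarrow> 'a \<Rightarrow> 'a) \<Rightarrow> ('a \<times> 'a) set" where
  "broken rot = {(u, v). u \<in> preds v \<and> rot v u \<noteq> third v u}"

lemma packing_arc:
  assumes T: "T \<in> M" "(u, v) \<in> T"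
  obtains w where "T = tri u v w" "distinct [u, v, w]" "ascending L f u v w"
proof -
  obtain a b c where abc: "T = tri a b c" "distinct [a, b, c] \<and> ascending L f a b c"
    using triangles[OF T(1)] by blast
  then have "(u, v) \<in> tri a b c" using T(2) by simp
  then obtain w where "tri a b c = tri u v w" "distinct [u, v, w] \<and> ascending L f u v w"
    using abc(2) by (rule tri_through_arc) (auto simp: ascending_rotate[symmetric])
  then show thesis using that abc(1) by blast
qed

lemma packing_subset:
  assumes "T \<in> M"
  shows "T \<subseteq> parcs G" "card T = 3"
proof -
  obtain u v w where "T = tri u v w" "distinct [u, v, w]" "tri u v w \<subseteq> parcs G"
    using triangles[OF assms] by blast
  then show "T \<subseteq> parcs G" "card T = 3" using card_tri[of u v w] by auto
qed

lemma third_eq: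
  assumes w: "distinct [u, v, w]" "tri u v w \<in> M"
  shows "third v u = w"
  unfolding third_def
proof (rule the_equality)
  fix w' assume w': "distinct [u, v, w'] \<and> tri u v w' \<in> M"
  then have "tri u v w = tri u v w'"
    using disjointD[OF disjoint w(2), of "tri u v w'"] by (auto simp: tri_def)
  then show "w' = w" using tri_third_eq[OF w(1)] by simp
qed (use w in blast)

lemma third_in_packing:
  assumes "u \<in> preds v"
  shows "distinct [u, v, third v u]" "tri u v (third v u) \<in> M" "tri u v (third v u) \<subseteq> parcs G"
    and "ascending L f u v (third v u)"
proof -
  obtain w where w: "distinct [u, v, w]" "tri u v w \<in> M" using assms by (auto simp: preds_def)
  note eq = third_eq[OF w]
  show "distinct [u, v, third v u]" "tri u v (third v u) \<in> M" "tri u v (third v u) \<subseteq> parcs G"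
    unfolding eq using w packing_subset(1) by auto
  obtain w' where "tri u v w = tri u v w'" "ascending L f u v w'"
    using packing_arc[OF w(2), of u v] by (auto simp: tri_def[of u v w])
  then show "ascending L f u v (third v u)" unfolding eq using tri_third_eq[OF w(1)] by auto
qed

lemma preds_subset: "u \<in> preds v \<Longrightarrow> (u, v) \<in> parcs G"
  using third_in_packing(3) by (auto simp: tri_def)

lemma exists_vertex_rotation:
  assumes "parcs G `` {v} \<noteq> {}"
  shows "\<exists>g. cyclic_on g (parcs G `` {v}) \<and> L * card {u \<in> preds v. g u \<noteq> third v u} \<le> card (parcs G `` {v})"
proof (rule cyclic_extension_of_labelled[where lab = "\<lambda>u. f (v, u)"])
  show "finite (parcs G `` {v})" using pair_finite_arcs by (simp add: finite_Image)
  show "preds v \<subseteq> parcs G `` {v}" using preds_subset arc_sym by blast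
  show "third v ` preds v \<subseteq> parcs G `` {v}" using third_in_packing(3) by (auto simp: tri_def)
  show "inj_on (third v) (preds v)"
  proof (rule inj_onI)
    fix u u' assume u: "u \<in> preds v" "u' \<in> preds v" "third v u = third v u'"
    let ?w = "third v u"
    have "distinct [v, ?w, u]" "tri v ?w u \<in> M" "distinct [v, ?w, u']" "tri v ?w u' \<in> M"
      using third_in_packing(1,2)[OF u(1)] third_in_packing(1,2)[OF u(2)] u(3)
        tri_rotate[of u v ?w] tri_rotate[of u' v ?w]
      by auto
    then show "u = u'" using third_eq by metis
  qed
  show "f (v, third v u) = (f (v, u) + 1) mod L" if "u \<in> preds v" for u
    using third_in_packing(4)[OF that] by (simp add: ascending_def)
  show "f (v, u) < L" if "u \<in> parcs G `` {v}" for u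
    using that labelling in_arcsD1 in_arcsD2 by (auto simp: labellings_def)
qed (use assms L_pos in auto)

lemma exists_rotation_system:
  obtains rot where "rotation_system G rot" "L * card (broken rot) \<le> card (parcs G)"
proof -
  let ?nb = "\<lambda>v. parcs G `` {v}" and ?bad = "\<lambda>rot v. {u \<in> preds v. rot v u \<noteq> third v u}"
  have "\<forall>v. \<exists>g. ?nb v \<noteq> {} \<longrightarrow> cyclic_on g (?nb v) \<and> L * card {u \<in> preds v. g u \<noteq> third v u} \<le> card (?nb v)"
    using exists_vertex_rotation by blast
  from choice[OF this] obtain rot where rot:
    "\<And>v. ?nb v \<noteq> {} \<Longrightarrow> cyclic_on (rot v) (?nb v) \<and> L * card (?bad rot v) \<le> card (?nb v)"
    by blast
  have preds_verts: "v \<in> pverts G" "?nb v \<noteq> {}" if "u \<in> preds v" for u v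
    using preds_subset[OF that] arc_sym in_arcsD2 by blast+
  have fin: "finite (preds v)" for v
    using preds_subset pair_finite_arcs by (intro finite_subset[of "preds v" "fst ` parcs G"]) force+
  have "broken rot = (\<lambda>(v, u). (u, v)) ` (SIGMA v:pverts G. ?bad rot v)"
    using preds_verts(1) by (auto simp: broken_def)
  then have "card (broken rot) \<le> card (SIGMA v:pverts G. ?bad rot v)"
    by (simp only:) (intro card_image_le finite_SigmaI; use fin pair_finite_verts in simp)
  also have "\<dots> = (\<Sum>v\<in>pverts G. card (?bad rot v))"
    using fin pair_finite_verts by simp
  finally have "L * card (broken rot) \<le> (\<Sum>v\<in>pverts G. L * card (?bad rot v))"
    by (simp add: sum_distrib_left[symmetric])
  also have "\<dots> \<le> (\<Sum>v\<in>pverts G. card (?nb v))"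
  proof (rule sum_mono)
    fix v
    show "L * card (?bad rot v) \<le> card (?nb v)"
      using rot[of v] preds_verts(2)[of _ v] by (cases "preds v = {}") auto
  qed
  also have "\<dots> = card (SIGMA v:pverts G. ?nb v)"
    using pair_finite_verts pair_finite_arcs by (simp add: finite_Image)
  also have "(SIGMA v:pverts G. ?nb v) = parcs G" using in_arcsD1 by auto
  finally show thesis using that rot by (auto simp: rotation_system_def)
qed

lemma unbroken_triangle_face:
  assumes T: "T \<in> M" "T \<inter> broken rot = {}"
  shows "T \<in> faces G rot" "triangular_face T"
proof -
  obtain u v w where uvw: "T = tri u v w" "distinct [u, v, w]" "tri u v w \<subseteq> parcs G"
    using triangles[OF T(1)] by blast
  have step: "rot b a = c" if abc: "tri a b c = T" "distinct [a, b, c]" for a b c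
  proof -
    have "a \<in> preds b" "third b a = c" using abc T(1) by (auto simp: preds_def third_eq)
    moreover have "(a, b) \<notin> broken rot" using T(2) abc(1) by (auto simp: tri_def)
    ultimately show ?thesis by (auto simp: broken_def)
  qed
  have "rot v u = w" "rot w v = u" "rot u w = v"
    using uvw tri_rotate[of u v w] tri_rotate[of v w u] by (auto intro!: step)
  then have "orbit (face_step rot) (u, v) = T" using orbit_face_step_triangle uvw(1) by metis
  moreover have "(u, v) \<in> parcs G" using uvw by (auto simp: tri_def)
  ultimately show "T \<in> faces G rot" unfolding faces_def by blast
  show "triangular_face T" using uvw triangular_face_tri by simp
qed

lemma exists_embedding:
  obtains rot where "rotation_system G rot"
    "real (card {e \<in> uedges G. \<not> in_two_triangular_faces G rot e}) + 3 * real (card M)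
      \<le> real (card (parcs G)) + 3 * real (card (parcs G)) / real L"
proof -
  obtain rot where rot: "rotation_system G rot" "L * card (broken rot) \<le> card (parcs G)"
    by (rule exists_rotation_system)
  have "finite (broken rot)"
    using preds_subset pair_finite_arcs by (intro finite_subset[of "broken rot" "parcs G"]) (auto simp: broken_def)
  then have "card (parcs G - \<Union>{T \<in> M. T \<inter> broken rot = {}}) + 3 * card M \<le> card (parcs G) + 3 * card (broken rot)"
    using packing_subset disjoint pair_finite_arcs by (intro card_uncovered_le) blast+
  moreover have "card {e \<in> uedges G. \<not> in_two_triangular_faces G rot e}
      \<le> card (parcs G - \<Union>{T \<in> M. T \<inter> broken rot = {}})"
    using unbroken_triangle_face by (intro card_edges_not_in_two_triangular_faces_le) auto
  moreover have "real (card (broken rot)) \<le> real (card (parcs G)) / real L"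
    using rot(2) L_pos by (simp add: le_divide_eq mult.commute flip: of_nat_mult)
  ultimately show thesis using that[OF rot(1)] by linarith
qed

end

lemma total_cost_le:
  assumes "finite V" "E \<subseteq> V \<times> V"
  shows "total_cost V E Y \<le> total_cost V E X + 2 * (\<Sum>u\<in>V. \<Sum>v\<in>V. \<bar>(\<Sum>w\<in>V. Y u v w) - (\<Sum>w\<in>V. X u v w)\<bar>)"
proof -
  let ?d = "\<lambda>u v. \<bar>(\<Sum>w\<in>V. Y u v w) - (\<Sum>w\<in>V. X u v w)\<bar>"
  have "total_cost V E Y \<le> (\<Sum>(u, v)\<in>E. cover_cost (\<Sum>w\<in>V. X u v w) + 2 * ?d u v)"
    unfolding total_cost_def using cover_cost_lipschitz by (intro sum_mono) auto
  also have "\<dots> = total_cost V E X + 2 * (\<Sum>(u, v)\<in>E. ?d u v)"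
    by (simp add: total_cost_def case_prod_unfold sum.distrib sum_distrib_left)
  also have "(\<Sum>(u, v)\<in>E. ?d u v) \<le> (\<Sum>(u, v)\<in>V \<times> V. ?d u v)"
    using assms by (intro sum_mono2) auto
  finally show ?thesis by (simp add: sum.cartesian_product)
qed

context pair_graph
begin

lemma arcs_subset: "parcs G \<subseteq> pverts G \<times> pverts G"
  using in_arcsD1 in_arcsD2 by auto

lemma card_arcs_le: "real (card (parcs G)) \<le> (real (card (pverts G)))\<^sup>2"
proof -
  have "card (parcs G) \<le> card (pverts G) * card (pverts G)"
    using card_mono[OF _ arcs_subset] pair_finite_verts by (simp add: card_cartesian_product)
  then show ?thesis by (simp add: power2_eq_square flip: of_nat_mult)
qed

lemma labelled_packing_thinned:
  assumes X: "triangle_weighting (parcs G) \<delta> X" and f: "L > 0" "f \<in> labellings (pverts G) L"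
    and M: "M \<subseteq> support_triangles (thinned L f X)" "disjoint M"
  shows "labelled_packing G L f M"
proof
  fix T assume "T \<in> M"
  then obtain u v w where T: "T = tri u v w" "X u v w \<noteq> 0" "ascending L f u v w"
    using M(1) by (auto simp: support_triangles_def thinned_def)
  then show "\<exists>u v w. T = tri u v w \<and> distinct [u, v, w] \<and> tri u v w \<subseteq> parcs G \<and> ascending L f u v w"
    using triangle_weightingD(4)[OF X T(2)] by blast
qed (use f M in auto)

lemma embedding_of_packable_weighting:
  assumes X: "triangle_weighting (parcs G) \<delta> X" and L: "L > 0" "3 / real L \<le> \<eta>" and \<eta>: "0 \<le> \<eta>"
    and X_le: "\<And>u v. u \<in> pverts G \<Longrightarrow> v \<in> pverts G \<Longrightarrow> real L ^ 3 * \<delta> * (\<Sum>w\<in>pverts G. X u v w) \<le> \<eta>\<^sup>2"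
    and packing: "\<And>f. \<exists>M\<subseteq>support_triangles (thinned L f X). disjoint M \<and> real (card (parcs G))
      \<le> 3 * real (card M) + total_cost (pverts G) (parcs G) (thinned L f X) + \<eta> * real (card (parcs G))"
  obtains rot where "rotation_system G rot"
    "real (card {e \<in> uedges G. \<not> in_two_triangular_faces G rot e})
      \<le> total_cost (pverts G) (parcs G) X + 4 * \<eta> * (real (card (pverts G)))\<^sup>2"
proof -
  let ?V = "pverts G" and ?E = "parcs G"
  obtain f where f: "f \<in> labellings ?V L"
    "(\<Sum>u\<in>?V. \<Sum>v\<in>?V. \<bar>(\<Sum>w\<in>?V. thinned L f X u v w) - (\<Sum>w\<in>?V. X u v w)\<bar>) \<le> \<eta> * (real (card ?V))\<^sup>2"
    by (rule exists_labelling[OF X pair_finite_verts L(1) X_le \<eta>])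
  obtain M where M: "M \<subseteq> support_triangles (thinned L f X)" "disjoint M"
    "real (card ?E) \<le> 3 * real (card M) + total_cost ?V ?E (thinned L f X) + \<eta> * real (card ?E)"
    using packing by blast
  interpret P: labelled_packing G L f M by (rule labelled_packing_thinned[OF X L(1) f(1) M(1,2)])
  obtain rot where rot: "rotation_system G rot"
    "real (card {e \<in> uedges G. \<not> in_two_triangular_faces G rot e}) + 3 * real (card M)
      \<le> real (card ?E) + 3 * real (card ?E) / real L"
    by (rule P.exists_embedding)
  have "3 / real L * real (card ?E) \<le> \<eta> * real (card ?E)" using L(2) by (rule mult_right_mono) simp
  moreover have "\<eta> * real (card ?E) \<le> \<eta> * (real (card ?V))\<^sup>2" using card_arcs_le \<eta> by (rule mult_left_mono)
  ultimately have "real (card {e \<in> uedges G. \<not> in_two_triangular_faces G rot e})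
      \<le> total_cost ?V ?E X + 4 * \<eta> * (real (card ?V))\<^sup>2"
    using rot(2) M(3) f(2) total_cost_le[OF pair_finite_verts arcs_subset, of "thinned L f X" X] by simp
  with rot(1) show thesis by (rule that)
qed

end

theorem embedding_of_weighting:
  fixes \<eta> C :: real
  assumes "\<eta> > 0" "C > 0"
  obtains \<delta> :: real where "\<delta> > 0"
    "\<And>(G :: 'a pair_pre_digraph) X. pair_graph G \<Longrightarrow> triangle_weighting (parcs G) \<delta> X \<Longrightarrow>
      (\<And>u v. u \<in> pverts G \<Longrightarrow> v \<in> pverts G \<Longrightarrow> (\<Sum>w\<in>pverts G. X u v w) \<le> C) \<Longrightarrow>
      \<exists>rot. rotation_system G rot \<and> real (card {e \<in> uedges G. \<not> in_two_triangular_faces G rot e})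
        \<le> total_cost (pverts G) (parcs G) X + \<eta> * (real (card (pverts G)))\<^sup>2"
proof -
  define \<eta>' where "\<eta>' = \<eta> / 4"
  have \<eta>': "\<eta>' > 0" using assms by (simp add: \<eta>'_def)
  obtain \<delta>' :: real where \<delta>': "\<delta>' > 0" and packing: "\<And>V (E :: ('a \<times> 'a) set) X. finite V \<Longrightarrow> E \<subseteq> V \<times> V \<Longrightarrow>
      triangle_weighting E \<delta>' X \<Longrightarrow> \<exists>M\<subseteq>support_triangles X. disjoint M \<and>
        real (card E) \<le> 3 * real (card M) + total_cost V E X + \<eta>' * real (card E)"
    by (rule triangle_packing[OF \<eta>']) blast
  obtain k :: nat where "3 / \<eta>' \<le> real k" using real_arch_simple by blast
  define L where "L = Suc k"
  have L: "L > 0" "3 / real L \<le> \<eta>'" using \<open>3 / \<eta>' \<le> real k\<close> \<eta>' by (auto simp: L_def field_simps)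
  define \<delta> where "\<delta> = min (\<delta>' / real L ^ 3) (\<eta>'\<^sup>2 / (real L ^ 3 * C))"
  have \<delta>: "\<delta> > 0" "real L ^ 3 * \<delta> \<le> \<delta>'" "real L ^ 3 * \<delta> * C \<le> \<eta>'\<^sup>2"
    using \<delta>' \<eta>' L(1) assms(2) by (auto simp: \<delta>_def min_def field_simps)
  have "\<exists>rot. rotation_system G rot \<and> real (card {e \<in> uedges G. \<not> in_two_triangular_faces G rot e})
      \<le> total_cost (pverts G) (parcs G) X + \<eta> * (real (card (pverts G)))\<^sup>2"
    if G: "pair_graph G" and X: "triangle_weighting (parcs G) \<delta> X"
      and X_le: "\<And>u v. u \<in> pverts G \<Longrightarrow> v \<in> pverts G \<Longrightarrow> (\<Sum>w\<in>pverts G. X u v w) \<le> C"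
    for G :: "'a pair_pre_digraph" and X
  proof -
    interpret pair_graph G by (rule G)
    have X_le': "real L ^ 3 * \<delta> * (\<Sum>w\<in>pverts G. X u v w) \<le> \<eta>'\<^sup>2" if "u \<in> pverts G" "v \<in> pverts G" for u v
      using mult_left_mono[OF X_le[OF that], of "real L ^ 3 * \<delta>"] \<delta> by simp
    have thinned: "triangle_weighting (parcs G) \<delta>' (thinned L f X)" for f
      using triangle_weighting_thinned[OF X] \<delta>(2) by (rule triangle_weighting_mono)
    obtain rot where "rotation_system G rot" "real (card {e \<in> uedges G. \<not> in_two_triangular_faces G rot e})
        \<le> total_cost (pverts G) (parcs G) X + 4 * \<eta>' * (real (card (pverts G)))\<^sup>2"
      using embedding_of_packable_weighting[OF X L less_imp_le[OF \<eta>'] X_le']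
        packing[OF pair_finite_verts arcs_subset thinned] by blast
    then show ?thesis by (auto simp: \<eta>'_def)
  qed
  then show thesis using that \<delta>(1) by blast
qed

section \<open>Quasirandom graphs\<close>

lemma abs_sum_mult_le_split:
  fixes c f :: "'a \<Rightarrow> real"
  assumes I: "finite I" and f: "\<And>i. i \<in> I \<Longrightarrow> \<bar>f i\<bar> \<le> 1"
  obtains S where "S \<subseteq> I" "\<bar>\<Sum>i\<in>I. c i * f i\<bar> \<le> (\<Sum>i\<in>S. c i) - (\<Sum>i\<in>I - S. c i)"
proof
  let ?S = "{i \<in> I. 0 \<le> c i}"
  have "\<bar>\<Sum>i\<in>I. c i * f i\<bar> \<le> (\<Sum>i\<in>I. \<bar>c i\<bar>)"
    using f by (intro order_trans[OF sum_abs sum_mono]) (simp add: abs_mult mult_left_le)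
  also have "\<dots> = (\<Sum>i\<in>I - ?S. \<bar>c i\<bar>) + (\<Sum>i\<in>?S. \<bar>c i\<bar>)"
    using I by (intro sum.subset_diff) auto
  also have "(\<Sum>i\<in>I - ?S. \<bar>c i\<bar>) = (\<Sum>i\<in>I - ?S. - c i)" by (intro sum.cong) auto
  finally show "\<bar>\<Sum>i\<in>I. c i * f i\<bar> \<le> (\<Sum>i\<in>?S. c i) - (\<Sum>i\<in>I - ?S. c i)"
    by (simp add: sum_negf)
qed auto

lemma infty_one_norm_le_of_cut:
  fixes R :: "'i \<Rightarrow> 'j \<Rightarrow> real"
  assumes fin: "finite I" "finite J"
    and C: "\<And>U W. U \<subseteq> I \<Longrightarrow> W \<subseteq> J \<Longrightarrow> \<bar>\<Sum>i\<in>U. \<Sum>j\<in>W. R i j\<bar> \<le> C"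
  shows "infty_one_norm_le I J R (4 * C)"
  unfolding infty_one_norm_le_def
proof (intro allI impI)
  fix f g :: "_ \<Rightarrow> real" assume f: "\<forall>i\<in>I. \<bar>f i\<bar> \<le> 1" and g: "\<forall>j\<in>J. \<bar>g j\<bar> \<le> 1"
  obtain S where S: "S \<subseteq> I" "\<bar>\<Sum>i\<in>I. (\<Sum>j\<in>J. R i j * g j) * f i\<bar>
      \<le> (\<Sum>i\<in>S. \<Sum>j\<in>J. R i j * g j) - (\<Sum>i\<in>I - S. \<Sum>j\<in>J. R i j * g j)"
    by (rule abs_sum_mult_le_split[OF fin(1)]) (use f in auto)
  define c where "c j = (\<Sum>i\<in>S. R i j) - (\<Sum>i\<in>I - S. R i j)" for j
  have c_sum: "(\<Sum>j\<in>T. c j * h j) = (\<Sum>i\<in>S. \<Sum>j\<in>T. R i j * h j) - (\<Sum>i\<in>I - S. \<Sum>j\<in>T. R i j * h j)" for T h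
    unfolding c_def left_diff_distrib sum_subtractf sum_distrib_right
    by (intro arg_cong2[where f = "(-)"] sum.swap)
  obtain T where T: "T \<subseteq> J" "\<bar>\<Sum>j\<in>J. c j * g j\<bar> \<le> (\<Sum>j\<in>T. c j) - (\<Sum>j\<in>J - T. c j)"
    by (rule abs_sum_mult_le_split[OF fin(2)]) (use g in auto)
  have "\<bar>\<Sum>i\<in>I. \<Sum>j\<in>J. R i j * f i * g j\<bar> = \<bar>\<Sum>i\<in>I. (\<Sum>j\<in>J. R i j * g j) * f i\<bar>"
    unfolding sum_distrib_right by (simp add: mult_ac)
  also have "\<dots> \<le> (\<Sum>j\<in>J. c j * g j)"
    unfolding c_sum by (rule S(2))
  also have "\<dots> \<le> (\<Sum>j\<in>T. c j) - (\<Sum>j\<in>J - T. c j)" using T(2) by simp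
  also have "\<dots> = (\<Sum>i\<in>S. \<Sum>j\<in>T. R i j) - (\<Sum>i\<in>I - S. \<Sum>j\<in>T. R i j)
      - (\<Sum>i\<in>S. \<Sum>j\<in>J - T. R i j) + (\<Sum>i\<in>I - S. \<Sum>j\<in>J - T. R i j)"
    using c_sum[where T = T and h = "\<lambda>_. 1"] c_sum[where T = "J - T" and h = "\<lambda>_. 1"] by simp
  also have "\<dots> \<le> 4 * C"
    using C[of S T] C[of S "J - T"] C[of "I - S" T] C[of "I - S" "J - T"] S(1) T(1) by auto
  finally show "\<bar>\<Sum>i\<in>I. \<Sum>j\<in>J. R i j * f i * g j\<bar> \<le> 4 * C" .
qed

definition unordered_pairs :: "'a set \<Rightarrow> 'a set \<Rightarrow> 'a set set" where
  "unordered_pairs U W = {{u, v} | u v. u \<in> U \<and> v \<in> W \<and> u \<noteq> v}"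

lemma unordered_pairsI: "u \<in> U \<Longrightarrow> v \<in> W \<Longrightarrow> u \<noteq> v \<Longrightarrow> {u, v} \<in> unordered_pairs U W"
  unfolding unordered_pairs_def by blast

lemma card_orientations:
  assumes "e \<in> unordered_pairs U W"
  shows "card {x \<in> U \<times> W. fst x \<noteq> snd x \<and> {fst x, snd x} = e} = 1 + of_bool (e \<in> unordered_pairs (U \<inter> W) (U \<inter> W))"
proof -
  obtain u v where e: "e = {u, v}" "u \<in> U" "v \<in> W" "u \<noteq> v" using assms by (auto simp: unordered_pairs_def)
  show ?thesis
  proof (cases "v \<in> U \<and> u \<in> W")
    case True
    then have "{x \<in> U \<times> W. fst x \<noteq> snd x \<and> {fst x, snd x} = e} = {(u, v), (v, u)}"
      using e by (auto simp: doubleton_eq_iff)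
    moreover have "e \<in> unordered_pairs (U \<inter> W) (U \<inter> W)" using True e by (auto intro: unordered_pairsI)
    ultimately show ?thesis using e(4) by simp
  next
    case False
    then have "{x \<in> U \<times> W. fst x \<noteq> snd x \<and> {fst x, snd x} = e} = {(u, v)}"
      using e by (auto simp: doubleton_eq_iff)
    moreover have "e \<notin> unordered_pairs (U \<inter> W) (U \<inter> W)"
      using False e by (auto simp: unordered_pairs_def doubleton_eq_iff)
    ultimately show ?thesis by simp
  qed
qed

lemma sum_ordered_pairs_eq_cut_weight:
  assumes "finite U" "finite W"
  shows "(\<Sum>u\<in>U. \<Sum>v\<in>W. if u \<noteq> v then w {u, v} else 0) = cut_weight w U W + cut_weight w (U \<inter> W) (U \<inter> W)"
proof -
  let ?P = "unordered_pairs U W" and ?P' = "unordered_pairs (U \<inter> W) (U \<inter> W)"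
  let ?D = "{x \<in> U \<times> W. fst x \<noteq> snd x}" and ?e = "\<lambda>x. {fst x, snd x}"
  have pairs: "?e ` ?D = ?P"
  proof (intro equalityI subsetI)
    fix e assume "e \<in> ?P"
    then obtain u v where "e = {u, v}" "u \<in> U" "v \<in> W" "u \<noteq> v" by (auto simp: unordered_pairs_def)
    then show "e \<in> ?e ` ?D" by (intro image_eqI[of _ _ "(u, v)"]) auto
  qed (auto intro: unordered_pairsI)
  have fin: "finite ?D" "finite ?P" unfolding pairs[symmetric] using assms by auto
  have sub: "?P' \<subseteq> ?P" unfolding unordered_pairs_def by blast
  have "(\<Sum>u\<in>U. \<Sum>v\<in>W. if u \<noteq> v then w {u, v} else 0) = (\<Sum>x\<in>U \<times> W. if fst x \<noteq> snd x then w (?e x) else 0)"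
    by (simp add: sum.cartesian_product case_prod_beta)
  also have "\<dots> = (\<Sum>x\<in>?D. w (?e x))" using assms by (intro sum.inter_filter[symmetric]) auto
  also have "\<dots> = (\<Sum>e\<in>?P. of_nat (card {x \<in> ?D. ?e x = e}) * w e)"
    using fin pairs by (intro sum_fun_comp) auto
  also have "\<dots> = (\<Sum>e\<in>?P. w e + (if e \<in> ?P' then w e else 0))"
    using card_orientations[of _ U W] by (intro sum.cong refl) simp
  also have "\<dots> = (\<Sum>e\<in>?P. w e) + (\<Sum>e\<in>?P'. w e)"
    using fin(2) sub by (simp add: sum.distrib sum.inter_restrict[symmetric] Int_absorb1)
  finally show ?thesis by (simp add: cut_weight_def unordered_pairs_def)
qed

lemma cut_weight_diff_le:
  assumes V: "finite V" and cut: "cut_dist V w w' < \<epsilon>" and UW: "U \<subseteq> V" "W \<subseteq> V"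
  shows "\<bar>cut_weight (\<lambda>e. w e - w' e) U W\<bar> \<le> \<epsilon> * (real (card V))\<^sup>2"
proof (cases "V = {}")
  case True
  then show ?thesis using UW by (simp add: cut_weight_def)
next
  case False
  let ?h = "\<lambda>(U, W). \<bar>cut_weight w U W - cut_weight w' U W\<bar> / (real (card V))\<^sup>2"
  have "?h (U, W) \<le> Max (?h ` (Pow V \<times> Pow V))"
    using V UW by (intro Max_ge imageI) auto
  also have "\<dots> < \<epsilon>" using cut unfolding cut_dist_def .
  finally have "\<bar>cut_weight w U W - cut_weight w' U W\<bar> < \<epsilon> * (real (card V))\<^sup>2"
    using False V by (simp add: divide_less_eq card_gt_0_iff)
  then show ?thesis by (simp add: cut_weight_def sum_subtractf)
qed

lemma abs_sum_adjacency_le: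
  fixes G :: "'a pair_pre_digraph"
  assumes G: "G \<in> quasirandom_class n p \<epsilon>" and p: "0 \<le> p" and UW: "U \<subseteq> pverts G" "W \<subseteq> pverts G"
  shows "\<bar>\<Sum>u\<in>U. \<Sum>v\<in>W. of_bool ((u, v) \<in> parcs G) - p\<bar> \<le> 2 * \<epsilon> * (real n)\<^sup>2 + p * real n"
proof -
  from G obtain \<phi> where pg: "pair_graph G" and card: "card (pverts G) = n"
    and \<phi>: "bij_betw \<phi> (pverts G) {..<n}"
    and cut: "cut_dist (pverts G) (graph_weight G) (\<lambda>e. K_weight n p (\<phi> ` e)) < \<epsilon>"
    unfolding quasirandom_class_def by blast
  interpret pair_graph G by (rule pg)
  define w where "w e = graph_weight G e - K_weight n p (\<phi> ` e)" for e
  have fin: "finite U" "finite W" using UW pair_finite_verts finite_subset by blast+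
  have entry: "of_bool ((u, v) \<in> parcs G) - p = (if u \<noteq> v then w {u, v} else 0) + (if v = u then - p else 0)"
    if uv: "u \<in> pverts G" "v \<in> pverts G" for u v
  proof (cases "u = v")
    case True
    then show ?thesis using pair_no_loops[of "(u, u)"] by auto
  next
    case False
    have "{u, v} \<in> uedges G \<longleftrightarrow> (u, v) \<in> parcs G"
      using arc_sym[of u v] by (auto simp: uedges_def doubleton_eq_iff)
    moreover have "\<phi> u \<noteq> \<phi> v" "\<phi> u < n" "\<phi> v < n"
      using \<phi> uv False by (auto simp: bij_betw_def inj_on_def)
    ultimately show ?thesis using False by (simp add: w_def graph_weight_def K_weight_def)
  qed
  have "(\<Sum>u\<in>U. \<Sum>v\<in>W. of_bool ((u, v) \<in> parcs G) - p) =
      (\<Sum>u\<in>U. \<Sum>v\<in>W. (if u \<noteq> v then w {u, v} else 0) + (if v = u then - p else 0))"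
    using UW by (intro sum.cong refl entry) auto
  also have "\<dots> = cut_weight w U W + cut_weight w (U \<inter> W) (U \<inter> W) + (\<Sum>u\<in>U. if u \<in> W then - p else 0)"
    unfolding sum.distrib sum_ordered_pairs_eq_cut_weight[OF fin] using fin by simp
  finally have sum: "(\<Sum>u\<in>U. \<Sum>v\<in>W. of_bool ((u, v) \<in> parcs G) - p) =
      cut_weight w U W + cut_weight w (U \<inter> W) (U \<inter> W) + (\<Sum>u\<in>U. if u \<in> W then - p else 0)" .
  have "\<bar>\<Sum>u\<in>U. if u \<in> W then - p else 0\<bar> \<le> (\<Sum>u\<in>U. p)"
    by (rule order_trans[OF sum_abs sum_mono]) (use p in auto)
  also have "\<dots> \<le> p * real n"
    using card_mono[OF pair_finite_verts UW(1)] card p by (simp add: mult.commute mult_left_mono)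
  finally have diagonal: "\<bar>\<Sum>u\<in>U. if u \<in> W then - p else 0\<bar> \<le> p * real n" .
  have "\<bar>cut_weight w U W\<bar> \<le> \<epsilon> * (real n)\<^sup>2" "\<bar>cut_weight w (U \<inter> W) (U \<inter> W)\<bar> \<le> \<epsilon> * (real n)\<^sup>2"
    unfolding w_def using cut_weight_diff_le[OF pair_finite_verts cut] UW card by (simp_all add: le_infI1)
  then show ?thesis unfolding sum using diagonal by linarith
qed

lemma quasirandom_infty_one_norm_le:
  fixes G :: "'a pair_pre_digraph"
  assumes G: "G \<in> quasirandom_class n p \<epsilon>" and p: "0 \<le> p" and n: "8 * p \<le> \<epsilon> * real n"
  shows "infty_one_norm_le (pverts G) (pverts G) (\<lambda>u v. of_bool ((u, v) \<in> parcs G) - p) (17 / 2 * \<epsilon> * (real n)\<^sup>2)"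
proof (rule infty_one_norm_le_mono)
  interpret pair_graph G using G by (simp add: quasirandom_class_def)
  show "infty_one_norm_le (pverts G) (pverts G) (\<lambda>u v. of_bool ((u, v) \<in> parcs G) - p)
      (4 * (2 * \<epsilon> * (real n)\<^sup>2 + p * real n))"
    by (intro infty_one_norm_le_of_cut pair_finite_verts abs_sum_adjacency_le[OF G p])
  have "(8 * p) * real n \<le> (\<epsilon> * real n) * real n" using n by (intro mult_right_mono) auto
  then show "4 * (2 * \<epsilon> * (real n)\<^sup>2 + p * real n) \<le> 17 / 2 * \<epsilon> * (real n)\<^sup>2"
    by (simp add: power2_eq_square)
qed

lemma (in pair_graph) card_arcs_le_edges: "card (parcs G) \<le> 2 * card (uedges G)"
proof -
  define orientations where "orientations e = {(u, v). e = {u, v} \<and> (u, v) \<in> parcs G}" for e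
  have le_2: "card (orientations e) \<le> 2" for e
  proof (cases "orientations e = {}")
    case False
    then obtain a b where "e = {a, b}" by (auto simp: orientations_def)
    then have "orientations e \<subseteq> {(a, b), (b, a)}" by (auto simp: orientations_def doubleton_eq_iff)
    then have "card (orientations e) \<le> card {(a, b), (b, a)}" by (intro card_mono) auto
    also have "\<dots> \<le> 2" by (cases "a = b") auto
    finally show ?thesis .
  qed simp
  have "uedges G \<subseteq> Pow (pverts G)" using arcs_subset by (auto simp: uedges_def)
  then have fin: "finite (uedges G)" using pair_finite_verts by (simp add: finite_subset)
  have arcs: "parcs G = (\<Union>e\<in>uedges G. orientations e)"
  proof (intro equalityI subrelI)
    fix u v assume uv: "(u, v) \<in> parcs G"
    then have "{u, v} \<in> uedges G" unfolding uedges_def by blast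
    with uv show "(u, v) \<in> (\<Union>e\<in>uedges G. orientations e)" by (auto simp: orientations_def)
  qed (simp add: orientations_def)
  have "card (parcs G) \<le> (\<Sum>e\<in>uedges G. card (orientations e))"
    unfolding arcs using fin by (rule card_UN_le)
  also have "\<dots> \<le> (\<Sum>e\<in>uedges G. 2)" using le_2 by (rule sum_mono)
  finally show ?thesis by simp
qed

lemma quasirandom_card_edges_ge:
  fixes G :: "'a pair_pre_digraph"
  assumes G: "G \<in> quasirandom_class n p \<epsilon>" and p: "0 \<le> p" and n: "8 * p \<le> \<epsilon> * real n"
  shows "(p - 17 / 2 * \<epsilon>) * (real n)\<^sup>2 \<le> 2 * real (card (uedges G))"
proof -
  have pg: "pair_graph G" and card: "card (pverts G) = n" using G by (auto simp: quasirandom_class_def)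
  interpret pair_graph G by (rule pg)
  have "real (card (parcs G)) =
      (\<Sum>u\<in>pverts G. \<Sum>v\<in>pverts G. (of_bool ((u, v) \<in> parcs G) - p) * 1 * 1) + p * (real n)\<^sup>2"
    using sum_arcs_eq[OF pair_finite_verts arcs_subset, of "\<lambda>_ _. 1"]
    by (simp add: sum_subtractf card power2_eq_square)
  then have "(p - 17 / 2 * \<epsilon>) * (real n)\<^sup>2 \<le> real (card (parcs G))"
    using infty_one_norm_leD[OF quasirandom_infty_one_norm_le[OF G p n], of "\<lambda>_. 1" 1 "\<lambda>_. 1" 1]
    by (simp add: left_diff_distrib)
  then show ?thesis using card_arcs_le_edges by linarith
qed

lemma quasirandom_triangle_weighting:
  fixes G :: "'a pair_pre_digraph" and p \<epsilon> :: real
  assumes G: "G \<in> quasirandom_class n p \<epsilon>" and p: "0 < p" "p \<le> 1" and \<epsilon>: "0 < \<epsilon>" "\<epsilon> < (p / 4) ^ 12"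
    and n: "8 * p \<le> \<epsilon> * real n"
  obtains X where "triangle_weighting (parcs G) (20 / (p ^ 3 * real n)) X"
    and "\<And>u v. (\<Sum>w\<in>pverts G. X u v w) \<le> 20 / p ^ 3"
    and "total_cost (pverts G) (parcs G) X \<le> 8 * \<epsilon> * p * (real n)\<^sup>2"
proof -
  have pg: "pair_graph G" and card: "card (pverts G) = n" using G by (auto simp: quasirandom_class_def)
  interpret pair_graph G by (rule pg)
  have n_pos: "n > 0" using n p(1) by (cases n) auto
  have nonempty: "pverts G \<noteq> {}" using card n_pos by auto
  have sym: "sym (parcs G)" using arc_sym by (auto intro: symI)
  have irrefl: "irrefl (parcs G)" using pair_no_loops by (fastforce simp: irrefl_def)
  obtain X where X: "triangle_weighting (parcs G) (20 / (p ^ 3 * real n)) X"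
    "total_cost (pverts G) (parcs G) X \<le> 8 * \<epsilon> * p * (real n)\<^sup>2"
    using quasirandom_infty_one_norm_le[OF G less_imp_le[OF p(1)] n]
    by (rule fractional_triangle_cover[OF pair_finite_verts nonempty arcs_subset sym irrefl p \<epsilon>, unfolded card])
  have "(\<Sum>w\<in>pverts G. X u v w) \<le> (\<Sum>w\<in>pverts G. 20 / (p ^ 3 * real n))" for u v
    by (intro sum_mono triangle_weightingD(2)[OF X(1)])
  then have "(\<Sum>w\<in>pverts G. X u v w) \<le> 20 / p ^ 3" for u v using card n_pos by simp
  with X show thesis using that by blast
qed

theorem quasirandom_embedding:
  fixes p \<epsilon> \<eta> :: real
  assumes p: "0 < p" "p \<le> 1" and \<epsilon>: "0 < \<epsilon>" "\<epsilon> < (p / 4) ^ 12" and \<eta>: "0 < \<eta>"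
  shows "\<forall>\<^sub>F n in sequentially. \<forall>G \<in> (quasirandom_class n p \<epsilon> :: 'a pair_pre_digraph set).
    \<exists>rot. rotation_system G rot \<and> real (card {e \<in> uedges G. \<not> in_two_triangular_faces G rot e})
      \<le> 8 * \<epsilon> * p * (real n)\<^sup>2 + \<eta> * (real n)\<^sup>2"
proof -
  have "20 / p ^ 3 > 0" using p by simp
  with \<eta> obtain \<delta> :: real where \<delta>: "\<delta> > 0" and embedding:
    "\<And>(G :: 'a pair_pre_digraph) X. pair_graph G \<Longrightarrow> triangle_weighting (parcs G) \<delta> X \<Longrightarrow>
      (\<And>u v. u \<in> pverts G \<Longrightarrow> v \<in> pverts G \<Longrightarrow> (\<Sum>w\<in>pverts G. X u v w) \<le> 20 / p ^ 3) \<Longrightarrow>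
      \<exists>rot. rotation_system G rot \<and> real (card {e \<in> uedges G. \<not> in_two_triangular_faces G rot e})
        \<le> total_cost (pverts G) (parcs G) X + \<eta> * (real (card (pverts G)))\<^sup>2"
    by (rule embedding_of_weighting) blast
  have "\<forall>\<^sub>F n in sequentially. 8 * p \<le> \<epsilon> * real n \<and> 20 / (p ^ 3 * real n) \<le> \<delta>"
    using p \<epsilon> \<delta> by (intro eventually_conj) real_asymp+
  then show ?thesis
  proof (rule eventually_mono, intro ballI)
    fix n and G :: "'a pair_pre_digraph"
    assume n: "8 * p \<le> \<epsilon> * real n \<and> 20 / (p ^ 3 * real n) \<le> \<delta>" and G: "G \<in> quasirandom_class n p \<epsilon>"
    obtain X where X: "triangle_weighting (parcs G) (20 / (p ^ 3 * real n)) X"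
      "\<And>u v. (\<Sum>w\<in>pverts G. X u v w) \<le> 20 / p ^ 3"
      "total_cost (pverts G) (parcs G) X \<le> 8 * \<epsilon> * p * (real n)\<^sup>2"
      using quasirandom_triangle_weighting[OF G p \<epsilon> conjunct1[OF n]] by blast
    have pg: "pair_graph G" and card: "card (pverts G) = n" using G by (auto simp: quasirandom_class_def)
    obtain rot where "rotation_system G rot" "real (card {e \<in> uedges G. \<not> in_two_triangular_faces G rot e})
        \<le> total_cost (pverts G) (parcs G) X + \<eta> * (real n)\<^sup>2"
      using embedding[OF pg triangle_weighting_mono[OF X(1) conjunct2[OF n]] X(2)] unfolding card by blast
    then show "\<exists>rot. rotation_system G rot \<and> real (card {e \<in> uedges G. \<not> in_two_triangular_faces G rot e})
        \<le> 8 * \<epsilon> * p * (real n)\<^sup>2 + \<eta> * (real n)\<^sup>2"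
      using X(3) by (intro exI[of _ rot]) simp
  qed
qed

lemma quasirandom_near_triangularI:
  fixes G :: "'a pair_pre_digraph" and p \<epsilon> :: real
  assumes G: "G \<in> quasirandom_class n p \<epsilon>" and p: "0 < p" "p \<le> 1" and \<epsilon>: "0 < \<epsilon>" "\<epsilon> < (p / 4) ^ 12"
    and n: "8 * p \<le> \<epsilon> * real n"
    and few: "real (card {e \<in> uedges G. \<not> in_two_triangular_faces G rot e})
      \<le> 8 * \<epsilon> * p * (real n)\<^sup>2 + \<epsilon> * p / 100 * (real n)\<^sup>2"
  shows "near_triangular (9 * \<epsilon>) G rot"
proof -
  have "(p / 4) ^ 12 \<le> p / 16777216"
    using p power_decreasing[of 1 12 p] by (simp add: power_divide)
  with \<epsilon>(2) have "\<epsilon> < p / 16777216" by (rule less_le_trans)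
  then have "801 / 100 * p \<le> 9 * (p - 17 / 2 * \<epsilon>)" using p(1) by simp
  then have "\<epsilon> * (801 / 100 * p) * (real n)\<^sup>2 \<le> \<epsilon> * (9 * (p - 17 / 2 * \<epsilon>)) * (real n)\<^sup>2"
    using \<epsilon>(1) by (intro mult_right_mono mult_left_mono) auto
  also have "\<dots> = 9 * \<epsilon> * ((p - 17 / 2 * \<epsilon>) * (real n)\<^sup>2)" by simp
  also have "\<dots> \<le> 9 * \<epsilon> * (2 * real (card (uedges G)))"
    using quasirandom_card_edges_ge[OF G _ n] p(1) \<epsilon>(1) by (intro mult_left_mono) auto
  finally show ?thesis using few unfolding near_triangular_def by (simp add: algebra_simps)
qed

theorem theorem3p4:
  fixes p \<epsilon> :: real
  assumes "0 < p" and "p \<le> 1"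
    and "0 < \<epsilon>" and "\<epsilon> < (p / 4) ^ 12"
  shows "\<exists>n\<^sub>0::nat. \<forall>n\<ge>n\<^sub>0. \<forall>G \<in> (quasirandom_class n p \<epsilon> :: 'a pair_pre_digraph set).
           \<exists>rot. rotation_system G rot \<and> near_triangular (9 * \<epsilon>) G rot"
proof -
  have "0 < \<epsilon> * p / 100" using assms by simp
  from quasirandom_embedding[OF assms this]
  have "\<forall>\<^sub>F n in sequentially. \<forall>G \<in> (quasirandom_class n p \<epsilon> :: 'a pair_pre_digraph set).
    \<exists>rot. rotation_system G rot \<and> real (card {e \<in> uedges G. \<not> in_two_triangular_faces G rot e})
      \<le> 8 * \<epsilon> * p * (real n)\<^sup>2 + \<epsilon> * p / 100 * (real n)\<^sup>2" .
  moreover have "\<forall>\<^sub>F n in sequentially. 8 * p \<le> \<epsilon> * real n" using assms(3) by real_asymp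
  ultimately have "\<forall>\<^sub>F n in sequentially. \<forall>G \<in> (quasirandom_class n p \<epsilon> :: 'a pair_pre_digraph set).
    \<exists>rot. rotation_system G rot \<and> near_triangular (9 * \<epsilon>) G rot"
    by eventually_elim (use quasirandom_near_triangularI[OF _ assms] in blast)
  then show ?thesis unfolding eventually_sequentially .
qed

end
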